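(* Let $k,l\ge1$. The base space of the principal groupoid $\mathfrak G_{k,l}$-bundle $(\mathrm H_{k,l}(A_k^{univ}),\mathfrak G_{k,l},\varphi)$ is $\mathrm{BPU}(k)$, with bundle projection $p_{k,l}\colon\mathrm H_{k,l}(A_k^{univ})\to\mathrm{BPU}(k)$.
   Context: A $k$-subalgebra is a unital $*$-subalgebra of $M_{kl}(\mathbb C)$ isomorphic to $M_k(\mathbb C)$; $\mathrm{Gr}_{k,l}$ is the space of $k$-subalgebras, the homogeneous space $\mathrm{PU}(kl)/(\mathrm{PU}(k)\otimes\mathrm{PU}(l))$. The topological groupoid $\mathfrak G_{k,l}$ has object space $\mathfrak G_{k,l}^0=\mathrm{Gr}_{k,l}$; its morphisms from $M_{k,\alpha}$ to $M_{k,\beta}$ are all unital $*$-homomorphisms (hence $*$-isomorphisms) $M_{k,\alpha}\to M_{k,\beta}$, composition is composition of maps, and $s,t$ denote source and target. As a space, $\mathfrak G_{k,l}$ is the total space of the bundle over $\mathrm{Gr}_{k,l}$ whose fiber over $M_{k,\alpha}$ is the space of unital $*$-homomorphisms $M_{k,\alpha}\to M_{kl}(\mathbb C)$ (with $s$ the projection and $t(h)=h(M_{k,\alpha})$). $A_k^{univ}\to\mathrm{BPU}(k)$ is the universal $M_k(\mathbb C)$-bundle (structure group $\mathrm{PU}(k)=\mathrm{Aut}(M_k(\mathbb C))$), and $p_{k,l}\colon\mathrm H_{k,l}(A_k^{univ})\to\mathrm{BPU}(k)$ is the bundle whose fiber over $x$ is the space of unital $*$-homomorphisms $h\colon(A_k^{univ})_x\to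 M_{kl}(\mathbb C)$. The moment map is $\tau=\tau_{k,l}\colon\mathrm H_{k,l}(A_k^{univ})\to\mathrm{Gr}_{k,l}$, $\tau(h)=h((A_k^{univ})_x)$ for $h\in p_{k,l}^{-1}(x)$. The action $\varphi\colon\mathfrak G_{k,l}\times_{s,\mathrm{Gr}_{k,l},\tau}\mathrm H_{k,l}(A_k^{univ})\to\mathrm H_{k,l}(A_k^{univ})$ is given, for $s(g)=\tau(h)$, by composition of algebra homomorphisms $\varphi(g,h)=g\circ h$, so that $\tau(\varphi(g,h))=t(g)$; it is free and proper. That a groupoid action with moment map on $P$ is a principal bundle with base $B$ and projection $p\colon P\to B$ means that $p$ is a locally trivial surjection invariant under the action and $(g,h)\mapsto(gh,h)$ is a homeomorphism from $\mathfrak G_{k,l}\times_{s,\mathrm{Gr}_{k,l},\tau}P$ onto $P\times_BP$. *)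

theory Defs
  imports "HOL-Analysis.Analysis"
begin

subsection \<open>Topological preliminaries\<close>

definition final_topology :: "'s set \<Rightarrow> ('x topology \<times> ('x \<Rightarrow> 's)) set \<Rightarrow> 's topology"
  where "final_topology S F =
    topology (\<lambda>W. W \<subseteq> S \<and> (\<forall>(X, f) \<in> F. openin X {x \<in> topspace X. f x \<in> W}))"

lemma openin_final_topology:
  "openin (final_topology S F) W \<longleftrightarrow>
    W \<subseteq> S \<and> (\<forall>(X, f) \<in> F. openin X {x \<in> topspace X. f x \<in> W})"
proof -
  have "istopology (\<lambda>W. W \<subseteq> S \<and> (\<forall>(X, f) \<in> F. openin X {x \<in> topspace X. f x \<in> W}))"
    unfolding istopology_def
  proof (intro conjI allI impI)
    fix V W
    assume V: "V \<subseteq> S \<and> (\<forall>(X, f) \<in> F. openin X {x \<in> topspace X. f x \<in> V})"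
      and W: "W \<subseteq> S \<and> (\<forall>(X, f) \<in> F. openin X {x \<in> topspace X. f x \<in> W})"
    show "V \<inter> W \<subseteq> S" using V by blast
    have "openin X {x \<in> topspace X. f x \<in> V \<inter> W}" if "(X, f) \<in> F" for X f
    proof -
      have "openin X ({x \<in> topspace X. f x \<in> V} \<inter> {x \<in> topspace X. f x \<in> W})"
        using V W that by blast
      moreover have "{x \<in> topspace X. f x \<in> V} \<inter> {x \<in> topspace X. f x \<in> W}
          = {x \<in> topspace X. f x \<in> V \<inter> W}"
        by blast
      ultimately show ?thesis by simp
    qed
    then show "\<forall>(X, f) \<in> F. openin X {x \<in> topspace X. f x \<in> V \<inter> W}" by blast
  next
    fix K
    assume K: "\<forall>W\<in>K. W \<subseteq> S \<and> (\<forall>(X, f) \<in> F. openin X {x \<in> topspace X. f x \<in> W})"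
    show "\<Union>K \<subseteq> S" using K by blast
    have "openin X {x \<in> topspace X. f x \<in> \<Union>K}" if "(X, f) \<in> F" for X f
    proof -
      have "openin X (\<Union>W\<in>K. {x \<in> topspace X. f x \<in> W})"
        using K that by blast
      moreover have "(\<Union>W\<in>K. {x \<in> topspace X. f x \<in> W}) = {x \<in> topspace X. f x \<in> \<Union>K}"
        by blast
      ultimately show ?thesis by simp
    qed
    then show "\<forall>(X, f) \<in> F. openin X {x \<in> topspace X. f x \<in> \<Union>K}" by blast
  qed
  then show ?thesis
    unfolding final_topology_def by simp
qed

definition fibre_product ::
    "'x topology \<Rightarrow> 'y topology \<Rightarrow> ('x \<Rightarrow> 'z) \<Rightarrow> ('y \<Rightarrow> 'z) \<Rightarrow> ('x \<times> 'y) topology"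
  where "fibre_product X Y f g = subtopology (prod_topology X Y) {(x, y). f x = g y}"

text \<open>Every map from a sphere is null-homotopic; the case \<open>n = 0\<close> is path-connectedness.\<close>

definition weakly_contractible_space :: "'x topology \<Rightarrow> bool"
  where "weakly_contractible_space X \<longleftrightarrow>
    topspace X \<noteq> {} \<and>
    (\<forall>n f. continuous_map (nsphere n) X f \<longrightarrow>
      (\<exists>a. homotopic_with (\<lambda>_. True) (nsphere n) X f (\<lambda>_. a)))"

text \<open>The local fibre \<open>F\<close> is homeomorphic to the fibres of \<open>p\<close> over \<open>U\<close>, so it is no restriction
  to look for it on the type of points of the total space.\<close>

definition locally_trivial :: "'p topology \<Rightarrow> 'b topology \<Rightarrow> ('p \<Rightarrow> 'b) \<Rightarrow> bool"
  where "locally_trivial P B p \<longleftrightarrow>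
    p ` topspace P \<subseteq> topspace B \<and>
    (\<forall>b \<in> topspace B. \<exists>U (F :: 'p topology) \<psi>.
      openin B U \<and> b \<in> U \<and>
      homeomorphic_map (subtopology P {x. p x \<in> U}) (prod_topology (subtopology B U) F) \<psi> \<and>
      (\<forall>x \<in> topspace P. p x \<in> U \<longrightarrow> fst (\<psi> x) = p x))"


subsection \<open>Star algebras and matrices\<close>

record 'a star_algebra =
  sa_carrier :: "'a set"
  sa_add :: "'a \<Rightarrow> 'a \<Rightarrow> 'a"
  sa_scale :: "complex \<Rightarrow> 'a \<Rightarrow> 'a"
  sa_mult :: "'a \<Rightarrow> 'a \<Rightarrow> 'a"
  sa_star :: "'a \<Rightarrow> 'a"
  sa_one :: 'a

text \<open>Homomorphisms are extensional, so that equality of functions is equality of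
  homomorphisms.\<close>

definition star_homs :: "'a star_algebra \<Rightarrow> 'c star_algebra \<Rightarrow> ('a \<Rightarrow> 'c) set"
  where "star_homs A C = {h \<in> sa_carrier A \<rightarrow>\<^sub>E sa_carrier C.
    (\<forall>x \<in> sa_carrier A. \<forall>y \<in> sa_carrier A. h (sa_add A x y) = sa_add C (h x) (h y)) \<and>
    (\<forall>c. \<forall>x \<in> sa_carrier A. h (sa_scale A c x) = sa_scale C c (h x)) \<and>
    (\<forall>x \<in> sa_carrier A. \<forall>y \<in> sa_carrier A. h (sa_mult A x y) = sa_mult C (h x) (h y)) \<and>
    (\<forall>x \<in> sa_carrier A. h (sa_star A x) = sa_star C (h x)) \<and>
    h (sa_one A) = sa_one C}"

definition star_isos :: "'a star_algebra \<Rightarrow> 'c star_algebra \<Rightarrow> ('a \<Rightarrow> 'c) set"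
  where "star_isos A C = {h \<in> star_homs A C. bij_betw h (sa_carrier A) (sa_carrier C)}"

definition unital_star_subalgebra :: "'a star_algebra \<Rightarrow> 'a set \<Rightarrow> bool"
  where "unital_star_subalgebra A S \<longleftrightarrow>
    S \<subseteq> sa_carrier A \<and>
    (\<forall>x \<in> S. \<forall>y \<in> S. sa_add A x y \<in> S) \<and>
    (\<forall>c. \<forall>x \<in> S. sa_scale A c x \<in> S) \<and>
    (\<forall>x \<in> S. \<forall>y \<in> S. sa_mult A x y \<in> S) \<and>
    (\<forall>x \<in> S. sa_star A x \<in> S) \<and>
    sa_one A \<in> S"

type_synonym 'n cmat = "complex^'n^'n"

definition cmat_adjoint :: "'n::finite cmat \<Rightarrow> 'n cmat"
  where "cmat_adjoint A = map_matrix cnj (transpose A)"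

definition cmat_algebra :: "'n::finite cmat star_algebra"
  where "cmat_algebra =
    \<lparr>sa_carrier = UNIV, sa_add = (+), sa_scale = (\<lambda>c. map_matrix ((*) c)), sa_mult = (**),
     sa_star = cmat_adjoint, sa_one = mat 1\<rparr>"

definition cmat_subalgebra :: "'n::finite cmat set \<Rightarrow> 'n cmat star_algebra"
  where "cmat_subalgebra S = cmat_algebra\<lparr>sa_carrier := S\<rparr>"

definition unitary_group :: "'n::finite cmat set"
  where "unitary_group = {U. U ** cmat_adjoint U = mat 1 \<and> cmat_adjoint U ** U = mat 1}"


subsection \<open>The space of \<open>k\<close>-subalgebras\<close>

text \<open>Throughout, \<open>k\<close> and \<open>l\<close> are the cardinalities of the index types \<open>'k\<close> and \<open>'l\<close>, and matrices
  of size \<open>kl\<close> are indexed by \<open>'k \<times> 'l\<close>.\<close>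

definition k_subalgebras :: "('k::finite \<times> 'l::finite) cmat set set"
  where "k_subalgebras = {S. unital_star_subalgebra cmat_algebra S \<and>
    star_isos (cmat_algebra :: 'k cmat star_algebra) (cmat_subalgebra S) \<noteq> {}}"

definition tensor_one :: "'k::finite cmat \<Rightarrow> ('k \<times> 'l::finite) cmat"
  where "tensor_one T = (\<chi> i j. if snd i = snd j then T $ fst i $ fst j else 0)"

text \<open>The topology of the homogeneous space: the quotient topology along the orbit map
  \<open>U \<mapsto> U (M\<^sub>k \<otimes> 1) U*\<close>. The stabilizer of \<open>M\<^sub>k \<otimes> 1\<close> in the projective unitary group is
  \<open>PU(k) \<otimes> PU(l)\<close>, and the action is transitive on \<open>k\<close>-subalgebras (Skolem-Noether). As \<open>U(kl)\<close>
  maps onto \<open>PU(kl)\<close> by a quotient map, it may be used in place of \<open>PU(kl)\<close>.\<close>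

definition Gr :: "('k::finite \<times> 'l::finite) cmat set topology"
  where "Gr = final_topology k_subalgebras
    {(top_of_set unitary_group,
      \<lambda>U. (\<lambda>T. U ** T ** cmat_adjoint U) ` range (tensor_one :: 'k cmat \<Rightarrow> ('k \<times> 'l) cmat))}"


subsection \<open>Matrix algebra bundles\<close>

text \<open>A bundle is given as a topology on the disjoint union of its fibres, a point of the total
  space being a pair of a base point and an element of the fibre over it.\<close>

record ('b, 'a) algebra_bundle =
  ab_base :: "'b topology"
  ab_fibre :: "'b \<Rightarrow> 'a star_algebra"
  ab_total :: "('b \<times> 'a) topology"

definition local_trivializations ::
    "('b, 'a) algebra_bundle \<Rightarrow> ('b set \<times> ('b \<Rightarrow> 'k::finite cmat \<Rightarrow> 'a)) set"
  where "local_trivializations A = {(U, c).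
    openin (ab_base A) U \<and>
    (\<forall>x \<in> U. c x \<in> star_isos cmat_algebra (ab_fibre A x)) \<and>
    homeomorphic_map (prod_topology (subtopology (ab_base A) U) euclidean)
      (subtopology (ab_total A) (U \<times> UNIV)) (\<lambda>(x, T). (x, c x T))}"

definition matrix_bundle :: "'k::finite itself \<Rightarrow> ('b, 'a) algebra_bundle \<Rightarrow> bool"
  where "matrix_bundle _ A \<longleftrightarrow>
    topspace (ab_total A) = (SIGMA x : topspace (ab_base A). sa_carrier (ab_fibre A x)) \<and>
    (\<forall>x \<in> topspace (ab_base A). \<exists>(U, c :: 'b \<Rightarrow> 'k cmat \<Rightarrow> 'a) \<in> local_trivializations A. x \<in> U)"

text \<open>The principal \<open>PU(k)\<close>-bundle associated with \<open>A\<close>: its fibre over \<open>x\<close> consists of the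
  isomorphisms \<open>M\<^sub>k \<rightarrow> A\<^sub>x\<close>, on which \<open>PU(k) = Aut(M\<^sub>k)\<close> acts by precomposition. The topology is
  the one for which local trivializations of \<open>A\<close> induce local trivializations. Here, and for
  \<open>H_bundle\<close> below, the typical fibre has the topology of pointwise convergence, which on linear
  maps between finite-dimensional spaces is the norm topology.\<close>

definition frame_bundle ::
    "('b, 'a) algebra_bundle \<Rightarrow> ('b \<times> ('k::finite cmat \<Rightarrow> 'a)) topology"
  where "frame_bundle A = final_topology
    (SIGMA x : topspace (ab_base A). star_isos cmat_algebra (ab_fibre A x))
    {(prod_topology (subtopology (ab_base A) U) (top_of_set (star_isos cmat_algebra cmat_algebra)),
      \<lambda>(x, a). (x, c x \<circ> a)) | U c.
        (U, c :: 'b \<Rightarrow> 'k cmat \<Rightarrow> 'a) \<in> local_trivializations A}"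

text \<open>\<open>A\<close> is a universal \<open>M\<^sub>k\<close>-bundle, with base a model of \<open>BPU(k)\<close>, when the total space
  \<open>EPU(k)\<close> of its principal bundle is weakly contractible; \<open>A\<close> is then
  \<open>EPU(k) \<times>\<^bsub>PU(k)\<^esub> M\<^sub>k\<close>.\<close>

definition universal_matrix_bundle :: "'k::finite itself \<Rightarrow> ('b, 'a) algebra_bundle \<Rightarrow> bool"
  where "universal_matrix_bundle K A \<longleftrightarrow>
    matrix_bundle K A \<and>
    weakly_contractible_space (frame_bundle A :: ('b \<times> ('k cmat \<Rightarrow> 'a)) topology)"

text \<open>The bundle of unital star-homomorphisms \<open>A\<^sub>x \<rightarrow> M\<^bsub>kl\<^esub>\<close>.\<close>

definition H_bundle ::
    "('b, 'a) algebra_bundle \<Rightarrow> ('b \<times> ('a \<Rightarrow> ('k::finite \<times> 'l::finite) cmat)) topology"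
  where "H_bundle A = final_topology
    (SIGMA x : topspace (ab_base A). star_homs (ab_fibre A x) cmat_algebra)
    {(prod_topology (subtopology (ab_base A) U)
        (top_of_set (star_homs cmat_algebra cmat_algebra)),
      \<lambda>(x, f). (x, compose (sa_carrier (ab_fibre A x)) f (inv (c x)))) | U c.
        (U, c :: 'b \<Rightarrow> 'k cmat \<Rightarrow> 'a) \<in> local_trivializations A}"

definition H_proj :: "'b \<times> ('a \<Rightarrow> ('k::finite \<times> 'l::finite) cmat) \<Rightarrow> 'b"
  where "H_proj = fst"

definition moment_map ::
    "('b, 'a) algebra_bundle \<Rightarrow> 'b \<times> ('a \<Rightarrow> ('k::finite \<times> 'l::finite) cmat) \<Rightarrow> ('k \<times> 'l) cmat set"
  where "moment_map A = (\<lambda>(x, h). h ` sa_carrier (ab_fibre A x))"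


subsection \<open>Topological groupoids and principal bundles\<close>

record ('o, 'g) groupoid =
  gr_objects :: "'o topology"
  gr_arrows :: "'g topology"
  gr_source :: "'g \<Rightarrow> 'o"
  gr_target :: "'g \<Rightarrow> 'o"
  gr_comp :: "'g \<Rightarrow> 'g \<Rightarrow> 'g"
  gr_ident :: "'o \<Rightarrow> 'g"
  gr_inverse :: "'g \<Rightarrow> 'g"

definition topological_groupoid :: "('o, 'g) groupoid \<Rightarrow> bool"
  where "topological_groupoid G \<longleftrightarrow>
    (let Ob = gr_objects G; Ar = gr_arrows G; s = gr_source G; t = gr_target G;
         m = gr_comp G; e = gr_ident G; i = gr_inverse G
     in continuous_map Ar Ob s \<and> continuous_map Ar Ob t \<and>
        continuous_map (fibre_product Ar Ar s t) Ar (\<lambda>(g, h). m g h) \<and>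
        continuous_map Ob Ar e \<and> continuous_map Ar Ar i \<and>
        (\<forall>g \<in> topspace Ar. \<forall>h \<in> topspace Ar. s g = t h \<longrightarrow> s (m g h) = s h \<and> t (m g h) = t g) \<and>
        (\<forall>g \<in> topspace Ar. \<forall>h \<in> topspace Ar. \<forall>k \<in> topspace Ar.
          s g = t h \<and> s h = t k \<longrightarrow> m (m g h) k = m g (m h k)) \<and>
        (\<forall>x \<in> topspace Ob. s (e x) = x \<and> t (e x) = x) \<and>
        (\<forall>g \<in> topspace Ar. m g (e (s g)) = g \<and> m (e (t g)) g = g) \<and>
        (\<forall>g \<in> topspace Ar. s (i g) = t g \<and> t (i g) = s g \<and>
          m (i g) g = e (s g) \<and> m g (i g) = e (t g)))"

definition groupoid_action ::
    "('o, 'g) groupoid \<Rightarrow> 'p topology \<Rightarrow> ('p \<Rightarrow> 'o) \<Rightarrow> ('g \<Rightarrow> 'p \<Rightarrow> 'p) \<Rightarrow> bool"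
  where "groupoid_action G P \<tau> \<phi> \<longleftrightarrow>
    (let Ar = gr_arrows G; s = gr_source G; t = gr_target G
     in continuous_map P (gr_objects G) \<tau> \<and>
        continuous_map (fibre_product Ar P s \<tau>) P (\<lambda>(g, h). \<phi> g h) \<and>
        (\<forall>g \<in> topspace Ar. \<forall>h \<in> topspace P. s g = \<tau> h \<longrightarrow> \<tau> (\<phi> g h) = t g) \<and>
        (\<forall>h \<in> topspace P. \<phi> (gr_ident G (\<tau> h)) h = h) \<and>
        (\<forall>g \<in> topspace Ar. \<forall>g' \<in> topspace Ar. \<forall>h \<in> topspace P.
          s g = t g' \<and> s g' = \<tau> h \<longrightarrow> \<phi> (gr_comp G g g') h = \<phi> g (\<phi> g' h)))"

definition principal_groupoid_bundle ::
    "('o, 'g) groupoid \<Rightarrow> 'p topology \<Rightarrow> ('p \<Rightarrow> 'o) \<Rightarrow> ('g \<Rightarrow> 'p \<Rightarrow> 'p) \<Rightarrow>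
      'b topology \<Rightarrow> ('p \<Rightarrow> 'b) \<Rightarrow> bool"
  where "principal_groupoid_bundle G P \<tau> \<phi> B p \<longleftrightarrow>
    topological_groupoid G \<and>
    groupoid_action G P \<tau> \<phi> \<and>
    locally_trivial P B p \<and>
    p ` topspace P = topspace B \<and>
    (\<forall>g \<in> topspace (gr_arrows G). \<forall>h \<in> topspace P. gr_source G g = \<tau> h \<longrightarrow> p (\<phi> g h) = p h) \<and>
    homeomorphic_map (fibre_product (gr_arrows G) P (gr_source G) \<tau>) (fibre_product P P p p)
      (\<lambda>(g, h). (\<phi> g h, h))"


subsection \<open>The groupoid of \<open>k\<close>-subalgebras and its action\<close>

definition tautological_bundle ::
    "(('k::finite \<times> 'l::finite) cmat set, ('k \<times> 'l) cmat) algebra_bundle"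
  where "tautological_bundle =
    \<lparr>ab_base = Gr, ab_fibre = cmat_subalgebra,
     ab_total = subtopology (prod_topology Gr euclidean) {(S, T). T \<in> S}\<rparr>"

text \<open>An arrow is a pair \<open>(S, h)\<close> of a \<open>k\<close>-subalgebra and a unital star-homomorphism
  \<open>h : S \<rightarrow> M\<^bsub>kl\<^esub>\<close>, regarded as a morphism from \<open>S\<close> to \<open>h(S)\<close>.\<close>

definition subalgebra_groupoid ::
    "(('k::finite \<times> 'l::finite) cmat set,
      ('k \<times> 'l) cmat set \<times> (('k \<times> 'l) cmat \<Rightarrow> ('k \<times> 'l) cmat)) groupoid"
  where "subalgebra_groupoid =
    \<lparr>gr_objects = Gr,
     gr_arrows = H_bundle tautological_bundle,
     gr_source = fst,
     gr_target = (\<lambda>(S, h). h ` S),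
     gr_comp = (\<lambda>(S', g) (S, h). (S, compose S g h)),
     gr_ident = (\<lambda>S. (S, restrict id S)),
     gr_inverse = (\<lambda>(S, h). (h ` S, restrict (inv_into S h) (h ` S)))\<rparr>"

definition H_action ::
    "('b, 'a) algebra_bundle \<Rightarrow>
      ('k::finite \<times> 'l::finite) cmat set \<times> (('k \<times> 'l) cmat \<Rightarrow> ('k \<times> 'l) cmat) \<Rightarrow>
      'b \<times> ('a \<Rightarrow> ('k \<times> 'l) cmat) \<Rightarrow> 'b \<times> ('a \<Rightarrow> ('k \<times> 'l) cmat)"
  where "H_action A = (\<lambda>(S, g) (x, h). (x, compose (sa_carrier (ab_fibre A x)) g h))"

end

theory Submission
  imports Defs
begin

text \<open>
  Two points of \<open>H(A)\<close> over the same base point \<open>x\<close> are homomorphisms \<open>h, h' : A\<^sub>x \<rightarrow> M\<^bsub>kl\<^esub>\<close>; both are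
  injective, so there is exactly one isomorphism \<open>g = h' h\<^sup>-\<^sup>1\<close> from the image of \<open>h\<close> to the image of
  \<open>h'\<close> with \<open>h' = g h\<close>. Hence the action of the groupoid is free and its orbits are exactly the fibres
  of \<open>p\<close>. What remains is topology: \<open>p\<close> is locally trivial because its charts come from
  trivializations of \<open>A\<close>, and the division \<open>(h', h) \<mapsto> h' h\<^sup>-\<^sup>1\<close> as well as composition must be
  continuous.

  Continuity is handled without charts. A map into \<open>H(A)\<close> is continuous if and only if its base point
  and its evaluation on elements of \<open>A\<close> are (\<open>continuous_map_H_eval\<close>,
  \<open>continuous_map_into_H_bundle\<close>), and the inverse of a homomorphism is continuous because it is
  given by a trace formula (\<open>hom_retraction\<close>, \<open>continuous_map_H_inverse\<close>). The arrow space of the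
  groupoid is \<open>H\<close> of the tautological bundle over \<open>Gr\<close>, so the same lemmas applied to that bundle
  give the topological groupoid itself, with division supplying the inverses.

  This requires that the tautological bundle is locally trivial, that is, that the orbit map
  \<open>f \<mapsto> range f\<close> from homomorphisms \<open>M\<^sub>k \<rightarrow> M\<^bsub>kl\<^esub>\<close> to \<open>Gr\<close> has local sections
  (\<open>Gr_local_section\<close>). The group \<open>PU(k)\<close> acts freely on homomorphisms by precomposition, and by
  the Skolem--Noether theorem \<open>Gr\<close> is the orbit space. Near \<open>f0\<close> a slice is obtained by choosing
  from each orbit the homomorphism that is aligned with \<open>f0\<close>: to each \<open>f\<close> belongs a linear map
  \<open>compare f0 f\<close> on \<open>M\<^sub>k\<close> such that precomposing \<open>f\<close> with conjugation by \<open>u\<close> amounts to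
  precomposing that map with multiplication by \<open>u\<close>, up to a unitary factor; near \<open>f0\<close> it attains
  its norm in an invertible direction that is unique up to a phase, and exactly one point of the orbit
  makes this direction positive (polar decomposition). Both choices are extremal problems on compact
  sets with unique solutions, so their solutions depend continuously on the orbit.
\<close>

section \<open>Matrix algebra\<close>

abbreviation cscale :: "complex \<Rightarrow> 'n::finite cmat \<Rightarrow> 'n cmat"
  where "cscale c \<equiv> map_matrix ((*) c)"

abbreviation adj :: "'n::finite cmat \<Rightarrow> 'n cmat"
  where "adj \<equiv> cmat_adjoint"

definition matrix_unit :: "'n \<Rightarrow> 'n \<Rightarrow> 'n::finite cmat"
  where "matrix_unit i j = (\<chi> a b. if a = i \<and> b = j then 1 else 0)"

definition ket_bra :: "complex^'n \<Rightarrow> complex^'n \<Rightarrow> 'n::finite cmat"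
  where "ket_bra x y = (\<chi> i j. x $ i * cnj (y $ j))"

lemma adj_nth [simp]: "adj A $ i $ j = cnj (A $ j $ i)"
  by (simp add: cmat_adjoint_def transpose_def)

lemma cmat_eq_iff: "A = B \<longleftrightarrow> (\<forall>i j. A $ i $ j = B $ i $ j)" for A B :: "'n::finite cmat"
  by (simp add: vec_eq_iff)

lemma cmat_mult_nth: "(A ** B) $ i $ j = (\<Sum>k\<in>UNIV. A $ i $ k * B $ k $ j)" for A B :: "'n::finite cmat"
  by (simp add: matrix_matrix_mult_def)

lemma adj_adj [simp]: "adj (adj A) = A"
  by (simp add: cmat_eq_iff)

lemma adj_mult: "adj (A ** B) = adj B ** adj A"
  by (simp add: cmat_eq_iff cmat_mult_nth mult.commute)

lemma adj_add: "adj (A + B) = adj A + adj B"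
  by (simp add: cmat_eq_iff)

lemma adj_diff: "adj (A - B) = adj A - adj B"
  by (simp add: cmat_eq_iff)

lemma adj_zero [simp]: "adj 0 = 0"
  by (simp add: cmat_eq_iff)

lemma adj_one [simp]: "adj (mat 1) = mat 1"
  by (simp add: cmat_eq_iff mat_def)

lemma adj_cscale: "adj (cscale c A) = cscale (cnj c) (adj A)"
  by (simp add: cmat_eq_iff)

lemma adj_sum: "adj (\<Sum>i\<in>I. f i) = (\<Sum>i\<in>I. adj (f i))"
  by (simp add: cmat_eq_iff)

lemma adj_eq_zero_iff: "adj A = 0 \<longleftrightarrow> A = 0"
  by (metis adj_adj adj_zero)

lemma adj_matrix_unit [simp]: "adj (matrix_unit i j) = matrix_unit j i"
  by (auto simp add: cmat_eq_iff matrix_unit_def)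

lemma cmat_mult_add_left: "(A + B) ** C = A ** C + B ** C" for A B C :: "'n::finite cmat"
  by (simp add: cmat_eq_iff cmat_mult_nth sum.distrib algebra_simps)

lemma cmat_mult_add_right: "C ** (A + B) = C ** A + C ** B" for A B C :: "'n::finite cmat"
  by (simp add: cmat_eq_iff cmat_mult_nth sum.distrib algebra_simps)

lemma cmat_mult_diff_left: "(A - B) ** C = A ** C - B ** C" for A B C :: "'n::finite cmat"
  by (simp add: cmat_eq_iff cmat_mult_nth sum_subtractf algebra_simps)

lemma cmat_mult_diff_right: "C ** (A - B) = C ** A - C ** B" for A B C :: "'n::finite cmat"
  by (simp add: cmat_eq_iff cmat_mult_nth sum_subtractf algebra_simps)

lemmas cmat_distribs = cmat_mult_add_left cmat_mult_add_right cmat_mult_diff_left cmat_mult_diff_right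

lemma cmat_mult_zero [simp]: "0 ** A = 0" "A ** 0 = 0" for A :: "'n::finite cmat"
  by (simp_all add: cmat_eq_iff cmat_mult_nth)

lemma cmat_mult_sum_left: "(\<Sum>i\<in>I. f i) ** A = (\<Sum>i\<in>I. f i ** A)" for A :: "'n::finite cmat" and f :: "'i \<Rightarrow> 'n cmat"
  by (induction I rule: infinite_finite_induct) (simp_all add: cmat_mult_add_left)

lemma cmat_mult_sum_right: "A ** (\<Sum>i\<in>I. f i) = (\<Sum>i\<in>I. A ** f i)" for A :: "'n::finite cmat" and f :: "'i \<Rightarrow> 'n cmat"
  by (induction I rule: infinite_finite_induct) (simp_all add: cmat_mult_add_right)

lemma cscale_mult [simp]: "cscale c A ** B = cscale c (A ** B)" "A ** cscale c B = cscale c (A ** B)"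
  by (simp_all add: cmat_eq_iff cmat_mult_nth sum_distrib_left algebra_simps)

lemma cscale_cscale [simp]: "cscale c (cscale d A) = cscale (c * d) A"
  by (simp add: cmat_eq_iff)

lemma cscale_one [simp]: "cscale 1 A = A"
  by (simp add: cmat_eq_iff)

lemma cscale_zero [simp]: "cscale 0 A = 0" "cscale c 0 = 0"
  by (simp_all add: cmat_eq_iff)

lemma cscale_sum: "cscale c (\<Sum>i\<in>I. f i) = (\<Sum>i\<in>I. cscale c (f i))"
  by (simp add: cmat_eq_iff sum_distrib_left)

lemma norm_cscale: "norm (cscale c A) = cmod c * norm A"
proof -
  have "norm (cscale c A $ i) = cmod c * norm (A $ i)" for i
    by (simp add: norm_vec_def norm_mult L2_set_right_distrib)
  then show ?thesis
    by (simp add: norm_vec_def [where 'a = "complex^'a"] L2_set_right_distrib)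
qed

lemma trace_cscale [simp]: "trace (cscale c A) = c * trace A"
  by (simp add: trace_def sum_distrib_left)

lemma trace_sum: "trace (\<Sum>i\<in>I. f i) = (\<Sum>i\<in>I. trace (f i))" for f :: "'i \<Rightarrow> 'n::finite cmat"
  by (simp add: trace_def sum.swap [of _ I])

lemma trace_adj: "trace (adj A) = cnj (trace A)"
  by (simp add: trace_def)

lemma trace_zero [simp]: "trace (0 :: 'n::finite cmat) = 0"
  by (simp add: trace_def)

lemma trace_adj_mult_self: "trace (adj A ** A) = of_real ((norm A)\<^sup>2)"
proof -
  have "trace (adj A ** A) = (\<Sum>i\<in>UNIV. \<Sum>j\<in>UNIV. of_real ((cmod (A $ j $ i))\<^sup>2))"
    unfolding complex_norm_square by (simp add: trace_def cmat_mult_nth mult.commute)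
  also have "\<dots> = of_real (\<Sum>j\<in>UNIV. \<Sum>i\<in>UNIV. (cmod (A $ j $ i))\<^sup>2)"
    by (subst sum.swap) simp
  also have "(\<Sum>j\<in>UNIV. \<Sum>i\<in>UNIV. (cmod (A $ j $ i))\<^sup>2) = (norm A)\<^sup>2"
    by (simp add: norm_vec_def L2_set_def sum_nonneg)
  finally show ?thesis .
qed

lemma norm_sq_trace: "(norm A)\<^sup>2 = Re (trace (adj A ** A))" for A :: "'n::finite cmat"
  by (simp add: trace_adj_mult_self)

lemma adj_mult_self_eq_zero: "adj A ** A = 0 \<Longrightarrow> A = 0"
  using trace_adj_mult_self[of A] by simp

lemma matrix_unit_mult:
  "matrix_unit i j ** matrix_unit a b = (if j = a then matrix_unit i b else 0)"
  by (auto simp add: cmat_eq_iff cmat_mult_nth matrix_unit_def if_distrib[of "\<lambda>x. x * _"] cong: if_cong)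

lemma sum_matrix_unit: "(\<Sum>i\<in>UNIV. matrix_unit i i) = (mat 1 :: 'n::finite cmat)"
proof -
  have "(\<Sum>x\<in>UNIV. if i = x \<and> j = x then 1 else 0) = (if i = j then 1 else (0 :: complex))" for i j :: 'n
    by (cases "i = j") (auto intro!: sum.neutral)
  then show ?thesis
    by (simp add: cmat_eq_iff matrix_unit_def mat_def)
qed

lemma matrix_unit_expansion:
  "A = (\<Sum>i\<in>UNIV. \<Sum>j\<in>UNIV. cscale (A $ i $ j) (matrix_unit i j))"
proof -
  have "(\<Sum>i\<in>UNIV. \<Sum>j\<in>UNIV. A $ i $ j * (if a = i \<and> b = j then 1 else 0)) = A $ a $ b" for a b
  proof -
    have "(\<Sum>i\<in>UNIV. \<Sum>j\<in>UNIV. A $ i $ j * (if a = i \<and> b = j then 1 else 0))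
        = (\<Sum>i\<in>UNIV. if a = i then A $ i $ b else 0)"
      by (intro sum.cong) (auto simp: if_distrib cong: if_cong)
    then show ?thesis by simp
  qed
  then show ?thesis
    by (simp add: cmat_eq_iff matrix_unit_def)
qed

lemma trace_matrix_unit_mult: "trace (matrix_unit j i ** A) = A $ i $ j"
proof -
  have "(matrix_unit j i ** A) $ a $ a = (if a = j then A $ i $ a else 0)" for a
    by (cases "a = j") (simp_all add: cmat_mult_nth matrix_unit_def if_distrib[of "\<lambda>x. x * _"] cong: if_cong)
  then show ?thesis by (simp add: trace_def)
qed

lemma ket_bra_mult:
  "A ** ket_bra x y = ket_bra (A *v x) y"
  "ket_bra x y ** A = ket_bra x (adj A *v y)"
  by (simp_all add: cmat_eq_iff cmat_mult_nth ket_bra_def matrix_vector_mult_def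
      sum_distrib_left sum_distrib_right mult_ac)

lemma adj_ket_bra: "adj (ket_bra x y) = ket_bra y x"
  by (simp add: cmat_eq_iff ket_bra_def)

lemma cvec_norm_sq: "(\<Sum>i\<in>UNIV. cnj (x $ i) * x $ i) = of_real ((norm x)\<^sup>2)" for x :: "complex^'n"
proof -
  have "(\<Sum>i\<in>UNIV. cnj (x $ i) * x $ i) = (\<Sum>i\<in>UNIV. of_real ((cmod (x $ i))\<^sup>2))"
    unfolding complex_norm_square by (simp add: mult.commute)
  then show ?thesis
    by (simp add: norm_vec_def L2_set_def sum_nonneg)
qed

lemma ket_bra_mult_ket_bra:
  assumes "norm y = 1"
  shows "ket_bra x y ** ket_bra y z = ket_bra x z"
proof -
  have "(ket_bra x y ** ket_bra y z) $ i $ j = x $ i * (\<Sum>k\<in>UNIV. cnj (y $ k) * y $ k) * cnj (z $ j)" for i j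
    by (simp add: cmat_mult_nth ket_bra_def sum_distrib_left sum_distrib_right mult_ac)
  then show ?thesis
    by (simp add: cvec_norm_sq assms cmat_eq_iff ket_bra_def)
qed

lemma trace_ket_bra: "norm x = 1 \<Longrightarrow> trace (ket_bra x x) = 1"
  using cvec_norm_sq[of x] by (simp add: trace_def ket_bra_def mult.commute)

lemma unitaryD:
  assumes "U \<in> unitary_group"
  shows "U ** adj U = mat 1" "adj U ** U = mat 1" "adj U \<in> unitary_group"
  using assms by (simp_all add: unitary_group_def)

lemma unitary_mult: "U \<in> unitary_group \<Longrightarrow> V \<in> unitary_group \<Longrightarrow> U ** V \<in> unitary_group"
  unfolding unitary_group_def
  by (simp add: adj_mult) (metis matrix_mul_assoc matrix_mul_lid)

lemma one_unitary [simp]: "mat 1 \<in> unitary_group"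
  by (simp add: unitary_group_def)

text \<open>In finite dimensions a one-sided inverse is two-sided, so only one of the two defining equations
  has to be computed.\<close>

lemma unitary_if_left_inverse: "U ** adj U = mat 1 \<Longrightarrow> U \<in> unitary_group"
  by (simp add: unitary_group_def matrix_left_right_inverse)

lemma unitary_cscale: "U \<in> unitary_group \<Longrightarrow> cmod z = 1 \<Longrightarrow> cscale z U \<in> unitary_group"
  using complex_norm_square[of z]
  by (intro unitary_if_left_inverse) (simp add: adj_cscale unitaryD mult.commute)

lemma norm_unitary_mult:
  assumes "U \<in> unitary_group"
  shows "norm (U ** A) = norm A" "norm (A ** U) = norm A"
proof -
  have "(norm (U ** A))\<^sup>2 = (norm A)\<^sup>2"
    unfolding norm_sq_trace adj_mult
    by (metis assms matrix_mul_assoc matrix_mul_lid unitaryD(2))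
  then show "norm (U ** A) = norm A" by simp
  have "trace (adj U ** (adj A ** A ** U)) = trace (adj A ** A ** (U ** adj U))"
    using trace_mul_sym[of "adj U" "adj A ** A ** U"] by (simp only: matrix_mul_assoc)
  then have "(norm (A ** U))\<^sup>2 = (norm A)\<^sup>2"
    unfolding norm_sq_trace adj_mult
    by (simp add: assms unitaryD matrix_mul_assoc)
  then show "norm (A ** U) = norm A" by simp
qed

lemma continuous_on_cmat:
  fixes f :: "'x::topological_space \<Rightarrow> 'n::finite cmat"
  assumes "\<And>i j. continuous_on S (\<lambda>x. f x $ i $ j)"
  shows "continuous_on S f"
proof -
  have "f = (\<lambda>x. \<chi> i j. f x $ i $ j)" by (simp add: fun_eq_iff vec_eq_iff)
  moreover have "continuous_on S (\<lambda>x. \<chi> i j. f x $ i $ j)"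
    by (intro continuous_on_vec_lambda assms)
  ultimately show ?thesis by simp
qed

lemma continuous_on_cmat_mult [continuous_intros]:
  fixes f g :: "'x::topological_space \<Rightarrow> 'n::finite cmat"
  assumes "continuous_on S f" "continuous_on S g"
  shows "continuous_on S (\<lambda>x. f x ** g x)"
  by (rule continuous_on_cmat) (auto simp: cmat_mult_nth intro!: continuous_intros assms)

lemma continuous_on_adj [continuous_intros]:
  fixes f :: "'x::topological_space \<Rightarrow> 'n::finite cmat"
  assumes "continuous_on S f"
  shows "continuous_on S (\<lambda>x. adj (f x))"
  by (rule continuous_on_cmat) (auto intro!: continuous_intros assms)

lemma continuous_on_cscale [continuous_intros]:
  fixes f :: "'x::topological_space \<Rightarrow> 'n::finite cmat"
  assumes "continuous_on S c" "continuous_on S f"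
  shows "continuous_on S (\<lambda>x. cscale (c x) (f x))"
  by (rule continuous_on_cmat) (auto intro!: continuous_intros assms)

lemma continuous_on_trace [continuous_intros]:
  fixes f :: "'x::topological_space \<Rightarrow> 'n::finite cmat"
  assumes "continuous_on S f"
  shows "continuous_on S (\<lambda>x. trace (f x))"
  unfolding trace_def by (intro continuous_intros assms)

lemma compact_unitary_group: "compact (unitary_group :: 'n::finite cmat set)"
proof -
  have "norm U \<le> sqrt (real CARD('n))" if "U \<in> unitary_group" for U :: "'n cmat"
  proof -
    have "(norm U)\<^sup>2 = real CARD('n)"
      unfolding norm_sq_trace using that by (simp add: unitaryD trace_I)
    then show ?thesis by (metis norm_ge_zero order_refl real_sqrt_unique)
  qed
  then have "bounded (unitary_group :: 'n cmat set)"
    by (auto simp: bounded_iff)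
  moreover have "closed (unitary_group :: 'n cmat set)"
    unfolding unitary_group_def
    by (intro closed_Collect_conj closed_Collect_eq continuous_intros)
  ultimately show ?thesis by (simp add: compact_eq_bounded_closed)
qed

section \<open>Homomorphisms of matrix algebras\<close>

abbreviation matrix_homs :: "('k::finite cmat \<Rightarrow> 'n::finite cmat) set"
  where "matrix_homs \<equiv> star_homs cmat_algebra cmat_algebra"

abbreviation matrix_auts :: "('k::finite cmat \<Rightarrow> 'k cmat) set"
  where "matrix_auts \<equiv> star_isos cmat_algebra cmat_algebra"

lemma cmat_algebra_simps [simp]:
  "sa_carrier cmat_algebra = UNIV" "sa_add cmat_algebra = (+)" "sa_scale cmat_algebra = cscale"
  "sa_mult cmat_algebra = (**)" "sa_star cmat_algebra = adj" "sa_one cmat_algebra = mat 1"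
  by (simp_all add: cmat_algebra_def fun_eq_iff)

lemma matrix_homs_iff:
  "f \<in> matrix_homs \<longleftrightarrow>
    (\<forall>x y. f (x + y) = f x + f y) \<and> (\<forall>c x. f (cscale c x) = cscale c (f x)) \<and>
    (\<forall>x y. f (x ** y) = f x ** f y) \<and> (\<forall>x. f (adj x) = adj (f x)) \<and> f (mat 1) = mat 1"
  unfolding star_homs_def by (auto simp: PiE_def)

lemma matrix_homD:
  assumes "f \<in> matrix_homs"
  shows "f (x + y) = f x + f y" "f (cscale c x) = cscale c (f x)" "f (x ** y) = f x ** f y"
    "f (adj x) = adj (f x)" "f (mat 1) = mat 1"
  using assms unfolding matrix_homs_iff by blast+

lemma matrix_hom_zero: "f \<in> matrix_homs \<Longrightarrow> f 0 = 0"
  using matrix_homD(1)[of f 0 0] by simp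

lemma matrix_hom_sum: "f \<in> matrix_homs \<Longrightarrow> f (\<Sum>i\<in>I. g i) = (\<Sum>i\<in>I. f (g i))"
  by (induction I rule: infinite_finite_induct) (simp_all add: matrix_hom_zero matrix_homD)

lemma matrix_hom_expansion:
  assumes "f \<in> matrix_homs"
  shows "f A = (\<Sum>i\<in>UNIV. \<Sum>j\<in>UNIV. cscale (A $ i $ j) (f (matrix_unit i j)))"
  by (subst matrix_unit_expansion[of A]) (simp add: matrix_hom_sum matrix_homD assms)

lemma matrix_hom_compose:
  "f \<in> matrix_homs \<Longrightarrow> g \<in> matrix_homs \<Longrightarrow> f \<circ> g \<in> matrix_homs"
  by (simp add: matrix_homs_iff)

lemma conj_matrix_hom:
  assumes "f \<in> matrix_homs" "U \<in> unitary_group"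
  shows "(\<lambda>a. U ** f a ** adj U) \<in> matrix_homs"
proof -
  have "U ** (f x ** f y) ** adj U = U ** f x ** adj U ** (U ** f y ** adj U)" for x y
    by (metis assms(2) matrix_mul_assoc matrix_mul_rid unitaryD(2))
  then show ?thesis
    using assms unfolding matrix_homs_iff
    by (simp add: cmat_distribs adj_mult unitaryD matrix_mul_assoc)
qed

lemma id_matrix_hom: "id \<in> matrix_homs" "(\<lambda>a. a) \<in> matrix_homs"
  by (simp_all add: matrix_homs_iff)

lemma tensor_one_matrix_hom: "tensor_one \<in> matrix_homs"
proof -
  have "tensor_one (x ** y) = tensor_one x ** (tensor_one y :: ('a \<times> 'b) cmat)" for x y
  proof -
    have "(\<Sum>c\<in>UNIV. tensor_one x $ (a, b) $ c * tensor_one y $ c $ (a', b'))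
        = (\<Sum>c\<in>UNIV \<times> UNIV. if snd c = b then (if b = b' then x $ a $ fst c * y $ fst c $ a' else 0) else 0)"
      for a a' and b b' :: 'b
      by (intro sum.cong) (auto simp: tensor_one_def)
    also have "\<dots> a a' b b' = (\<Sum>c\<in>UNIV. \<Sum>d\<in>UNIV. if d = b then (if b = b' then x $ a $ c * y $ c $ a' else 0) else 0)"
      for a a' and b b' :: 'b
      unfolding sum.cartesian_product by (simp add: case_prod_unfold)
    finally show ?thesis
      by (auto simp: cmat_eq_iff cmat_mult_nth) (simp_all add: tensor_one_def cmat_mult_nth)
  qed
  then show ?thesis
    unfolding matrix_homs_iff
    by (auto simp: cmat_eq_iff tensor_one_def mat_def prod_eq_iff)
qed

text \<open>The images of the diagonal matrix units are equivalent projections, hence have the same trace, and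
  they add up to the identity; an off-diagonal unit is a commutator with a diagonal one. The number
  \<open>m\<close> is the multiplicity with which \<open>M\<^sub>k\<close> acts on the space of dimension \<open>n = k m\<close>.\<close>

lemma trace_matrix_hom_unit:
  fixes f :: "'k::finite cmat \<Rightarrow> 'n::finite cmat"
  assumes f: "f \<in> matrix_homs" and card: "CARD('n) = CARD('k) * m"
  shows "trace (f (matrix_unit i j)) = (if i = j then of_nat m else 0)"
proof -
  have eq: "trace (f (matrix_unit i i)) = trace (f (matrix_unit j j))" for i j
  proof -
    have "trace (f (matrix_unit i j) ** f (matrix_unit j i)) = trace (f (matrix_unit j i) ** f (matrix_unit i j))"
      by (rule trace_mul_sym)
    then show ?thesis
      by (simp add: matrix_homD(3)[OF f, symmetric] matrix_unit_mult)
  qed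
  have "of_nat CARD('n) = trace (f (mat 1))"
    by (simp add: matrix_homD[OF f] trace_I)
  also have "\<dots> = (\<Sum>j\<in>UNIV. trace (f (matrix_unit j j)))"
    by (simp add: sum_matrix_unit[symmetric] matrix_hom_sum[OF f] trace_sum)
  also have "\<dots> = (\<Sum>j::'k\<in>UNIV. trace (f (matrix_unit i i)))"
    by (rule sum.cong[OF refl]) (rule eq)
  finally have diag: "trace (f (matrix_unit i i)) = of_nat m"
    using card by simp
  have "trace (f (matrix_unit i j)) = 0" if "i \<noteq> j"
  proof -
    have "trace (f (matrix_unit i i) ** f (matrix_unit i j)) = trace (f (matrix_unit i j) ** f (matrix_unit i i))"
      by (rule trace_mul_sym)
    then show ?thesis
      using that by (simp add: matrix_homD(3)[OF f, symmetric] matrix_unit_mult matrix_hom_zero[OF f])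
  qed
  with diag show ?thesis by auto
qed

lemma trace_matrix_hom:
  fixes f :: "'k::finite cmat \<Rightarrow> 'n::finite cmat"
  assumes f: "f \<in> matrix_homs" and card: "CARD('n) = CARD('k) * m"
  shows "trace (f a) = of_nat m * trace a"
proof -
  have "trace (f a) = (\<Sum>i\<in>UNIV. \<Sum>j\<in>UNIV. if j = i then a $ i $ j * of_nat m else 0)"
    by (subst matrix_hom_expansion[OF f])
      (auto simp: trace_sum trace_matrix_hom_unit[OF f card] if_distrib cong: if_cong intro!: sum.cong)
  then show ?thesis by (simp add: trace_def sum_distrib_left mult.commute)
qed

text \<open>For a homomorphism \<open>f\<close> this is the trace-preserving conditional expectation onto the image of
  \<open>f\<close>, followed by the inverse of \<open>f\<close>. The explicit formula shows that the left inverse depends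
  continuously on \<open>f\<close>, which is what all later continuity statements about inverses rest on.\<close>

definition hom_retraction :: "('k::finite cmat \<Rightarrow> 'n::finite cmat) \<Rightarrow> 'n cmat \<Rightarrow> 'k cmat"
  where "hom_retraction f T =
    (\<chi> i j. of_nat CARD('k) / of_nat CARD('n) * trace (f (matrix_unit j i) ** T))"

lemma hom_retraction_apply:
  fixes f :: "'k::finite cmat \<Rightarrow> ('n::finite) cmat"
  assumes f: "f \<in> matrix_homs" and card: "CARD('n) = CARD('k) * m"
  shows "hom_retraction f (f a) = a"
proof -
  have "m \<noteq> 0" using card by (metis card_0_eq finite UNIV_not_empty mult_0_right)
  then show ?thesis
    by (simp add: cmat_eq_iff hom_retraction_def matrix_homD(3)[OF f, symmetric]
      trace_matrix_hom[OF f card] trace_matrix_unit_mult card)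
qed

lemma matrix_hom_inj:
  fixes f :: "'k::finite cmat \<Rightarrow> 'n::finite cmat"
  assumes "f \<in> matrix_homs" and "CARD('n) = CARD('k) * m"
  shows "inj f"
  by (metis assms hom_retraction_apply injI)

section \<open>The Skolem--Noether theorem\<close>

definition is_projection :: "'n::finite cmat \<Rightarrow> bool"
  where "is_projection p \<longleftrightarrow> adj p = p \<and> p ** p = p"

text \<open>A projection of positive trace is not zero, so it fixes a unit vector, and the rank one projection
  onto that vector can be subtracted.\<close>

lemma projection_split_vector:
  assumes p: "is_projection p" and tr: "trace p = of_nat (Suc d)"
  obtains x where "norm x = 1" "p *v x = x" "is_projection (p - ket_bra x x)"
    "trace (p - ket_bra x x) = of_nat d" "(p - ket_bra x x) *v x = 0"
proof -
  have "p \<noteq> 0" using tr by (auto simp del: of_nat_Suc)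
  then obtain y where y: "p *v y \<noteq> 0" by (metis matrix_eq matrix_vector_mult_0)
  define x where "x = (1 / norm (p *v y)) *\<^sub>R (p *v y)"
  have nx: "norm x = 1" using y by (simp add: x_def)
  have px: "p *v x = x"
  proof -
    have "p *v (c *\<^sub>R z) = c *\<^sub>R (p *v z)" for c z
      by (simp add: matrix_vector_mult_def vec_eq_iff scaleR_sum_right)
    then show ?thesis
      using p by (simp add: x_def matrix_vector_mul_assoc is_projection_def)
  qed
  have *: "p ** ket_bra x x = ket_bra x x" "ket_bra x x ** p = ket_bra x x"
    using p px by (simp_all add: ket_bra_mult is_projection_def)
  have q: "is_projection (p - ket_bra x x)"
    using p by (simp add: is_projection_def adj_diff adj_ket_bra cmat_distribs * ket_bra_mult_ket_bra nx)
  have "ket_bra x x *v x = x"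
  proof -
    have "(ket_bra x x *v x) $ i = x $ i * (\<Sum>j\<in>UNIV. cnj (x $ j) * x $ j)" for i
      by (simp add: matrix_vector_mult_def ket_bra_def sum_distrib_left mult_ac)
    then show ?thesis by (simp add: vec_eq_iff cvec_norm_sq nx)
  qed
  then have "(p - ket_bra x x) *v x = 0"
    by (simp add: matrix_vector_mult_diff_rdistrib px)
  then show thesis
    using that[OF nx px q] tr by (simp add: trace_sub trace_ket_bra nx)
qed

text \<open>Projections of equal trace are Murray--von Neumann equivalent. Rank one projections are split off
  from both until nothing remains, and the partial isometry is built up from the rank one operators
  between the chosen unit vectors; the cross terms vanish because these vectors are orthogonal to
  what is left of the projections.\<close>

lemma projections_equivalent:
  assumes "is_projection p" "is_projection p'" "trace p = of_nat d" "trace p' = of_nat d"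
  shows "\<exists>V. adj V ** V = p \<and> V ** adj V = p'"
  using assms
proof (induction d arbitrary: p p')
  case 0
  have "q = 0" if "is_projection q" "trace q = of_nat 0" for q :: "'a cmat"
    using that trace_adj_mult_self[of q] by (simp add: is_projection_def)
  with 0 show ?case by (intro exI[of _ 0]) auto
next
  case (Suc d)
  obtain x where x: "norm x = 1" "p *v x = x" "is_projection (p - ket_bra x x)"
    "trace (p - ket_bra x x) = of_nat d" "(p - ket_bra x x) *v x = 0"
    by (rule projection_split_vector[OF Suc.prems(1,3)])
  obtain y where y: "norm y = 1" "p' *v y = y" "is_projection (p' - ket_bra y y)"
    "trace (p' - ket_bra y y) = of_nat d" "(p' - ket_bra y y) *v y = 0"
    by (rule projection_split_vector[OF Suc.prems(2,4)])
  obtain V where V: "adj V ** V = p - ket_bra x x" "V ** adj V = p' - ket_bra y y"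
    using Suc.IH[OF x(3) y(3) x(4) y(4)] by blast
  have zero: "ket_bra 0 z = 0" for z :: "complex^'a"
    by (simp add: cmat_eq_iff ket_bra_def)
  have 1: "V ** ket_bra x y = 0"
  proof (rule adj_mult_self_eq_zero)
    have "adj V ** (V ** ket_bra x y) = 0"
      unfolding matrix_mul_assoc V(1) unfolding ket_bra_mult(1) x(5) zero by simp
    then show "adj (V ** ket_bra x y) ** (V ** ket_bra x y) = 0"
      by (simp add: adj_mult matrix_mul_assoc[symmetric])
  qed
  have 2: "adj V ** ket_bra y x = 0"
  proof (rule adj_mult_self_eq_zero)
    have "V ** (adj V ** ket_bra y x) = 0"
      unfolding matrix_mul_assoc V(2) unfolding ket_bra_mult(1) y(5) zero by simp
    then show "adj (adj V ** ket_bra y x) ** (adj V ** ket_bra y x) = 0"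
      by (simp add: adj_mult matrix_mul_assoc[symmetric])
  qed
  have 3: "ket_bra y x ** adj V = 0" "ket_bra x y ** V = 0"
    using arg_cong[OF 1, of adj] arg_cong[OF 2, of adj] by (simp_all add: adj_mult adj_ket_bra)
  show ?case
    by (rule exI[of _ "V + ket_bra y x"])
      (simp add: adj_add adj_ket_bra cmat_distribs V 1 2 3 ket_bra_mult_ket_bra x y)
qed

text \<open>Two homomorphisms with the same source and target are unitarily equivalent. A partial isometry
  \<open>V\<close> between the images of one fixed minimal projection exists because these images have the same
  trace; it is transported to the other diagonal units by \<open>f\<close> on one side and by \<open>g\<close> on the
  other, and the translates add up to a unitary intertwiner.\<close>

theorem Skolem_Noether:
  fixes f g :: "'k::finite cmat \<Rightarrow> 'n::finite cmat"
  assumes f: "f \<in> matrix_homs" and g: "g \<in> matrix_homs" and card: "CARD('n) = CARD('k) * m"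
  obtains U where "U \<in> unitary_group" "\<And>a. g a = U ** f a ** adj U"
proof -
  let ?e = "matrix_unit :: 'k \<Rightarrow> 'k \<Rightarrow> 'k cmat"
  define o1 :: 'k where "o1 = undefined"
  have proj: "is_projection (h (?e o1 o1))" if "h \<in> matrix_homs" for h :: "'k cmat \<Rightarrow> 'n cmat"
    unfolding is_projection_def
    by (simp add: matrix_homD(3)[OF that, symmetric] matrix_homD(4)[OF that, symmetric] matrix_unit_mult)
  have "trace (f (?e o1 o1)) = of_nat m" "trace (g (?e o1 o1)) = of_nat m"
    by (simp_all add: trace_matrix_hom_unit[OF f card] trace_matrix_hom_unit[OF g card])
  then obtain V where V: "adj V ** V = f (?e o1 o1)" "V ** adj V = g (?e o1 o1)"
    using projections_equivalent[OF proj[OF f] proj[OF g]] by blast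
  \<comment> \<open>the sum of the translates of \<open>V\<close>, each going between the images of the \<open>i\<close>-th diagonal unit\<close>
  define U where "U = (\<Sum>i\<in>UNIV. g (?e i o1) ** V ** f (?e o1 i))"
  have adjU: "adj U = (\<Sum>j\<in>UNIV. f (?e j o1) ** adj V ** g (?e o1 j))"
    by (simp add: U_def adj_sum adj_mult matrix_homD(4)[OF f, symmetric] matrix_homD(4)[OF g, symmetric]
        matrix_mul_assoc)
  have summand: "(g (?e i o1) ** V ** f (?e o1 i)) ** (f (?e j o1) ** adj V ** g (?e o1 j))
      = (if i = j then g (?e i i) else 0)" for i j
  proof -
    have "(g (?e i o1) ** V ** f (?e o1 i)) ** (f (?e j o1) ** adj V ** g (?e o1 j))
      = g (?e i o1) ** (V ** (f (?e o1 i) ** f (?e j o1)) ** adj V) ** g (?e o1 j)"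
      by (simp add: matrix_mul_assoc)
    also have "f (?e o1 i) ** f (?e j o1) = (if i = j then adj V ** V else 0)"
      by (simp add: matrix_homD(3)[OF f, symmetric] matrix_unit_mult V matrix_hom_zero[OF f])
    also have "g (?e i o1) ** (V ** (if i = j then adj V ** V else 0) ** adj V) ** g (?e o1 j)
      = (if i = j then g (?e i o1) ** ((V ** adj V) ** (V ** adj V)) ** g (?e o1 j) else 0)"
      by (simp add: matrix_mul_assoc)
    also have "\<dots> = (if i = j then g (?e i i) else 0)"
      by (simp add: V matrix_homD(3)[OF g, symmetric] matrix_unit_mult)
    finally show ?thesis .
  qed
  have "U ** adj U = (\<Sum>i\<in>UNIV. \<Sum>j\<in>UNIV. if i = j then g (?e i i) else 0)"
    unfolding adjU unfolding U_def by (simp add: cmat_mult_sum_left cmat_mult_sum_right summand)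
  also have "\<dots> = mat 1"
    by (simp add: matrix_hom_sum[OF g, symmetric] sum_matrix_unit matrix_homD[OF g])
  finally have U: "U \<in> unitary_group" by (rule unitary_if_left_inverse)
  have unit: "U ** f (?e a b) = g (?e a b) ** U" for a b
  proof -
    have "U ** f (?e a b) = (\<Sum>i\<in>UNIV. g (?e i o1) ** V ** (f (?e o1 i) ** f (?e a b)))"
      by (simp add: U_def cmat_mult_sum_left matrix_mul_assoc)
    also have "\<dots> = (\<Sum>i\<in>UNIV. if i = a then g (?e a o1) ** V ** f (?e o1 b) else 0)"
      by (intro sum.cong) (auto simp: matrix_homD(3)[OF f, symmetric] matrix_unit_mult matrix_hom_zero[OF f])
    also have "\<dots> = (\<Sum>i\<in>UNIV. if b = i then g (?e a o1) ** V ** f (?e o1 b) else 0)"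
      by simp
    also have "\<dots> = (\<Sum>i\<in>UNIV. (g (?e a b) ** g (?e i o1)) ** V ** f (?e o1 i))"
      by (intro sum.cong) (auto simp: matrix_homD(3)[OF g, symmetric] matrix_unit_mult matrix_hom_zero[OF g])
    also have "\<dots> = g (?e a b) ** U"
      by (simp add: U_def cmat_mult_sum_right matrix_mul_assoc)
    finally show ?thesis .
  qed
  have "U ** f a = g a ** U" for a
    by (subst (1 2) matrix_hom_expansion, rule f, rule g)
      (simp add: cmat_mult_sum_left cmat_mult_sum_right unit)
  then have "g a = U ** f a ** adj U" for a
    by (metis U matrix_mul_assoc matrix_mul_rid unitaryD(1))
  with U show thesis by (rule that)
qed

lemma matrix_aut_inner:
  assumes "a \<in> (matrix_homs :: ('k::finite cmat \<Rightarrow> 'k cmat) set)"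
  obtains u where "u \<in> unitary_group" "\<And>x. a x = u ** x ** adj u"
  by (rule Skolem_Noether[OF id_matrix_hom(2) assms, of 1]) auto

lemma card_prod_multiplicity: "CARD('k::finite \<times> 'l::finite) = CARD('k) * CARD('l)"
  by simp

section \<open>The space of homomorphisms\<close>

abbreviation hom_space :: "('k::finite cmat \<Rightarrow> 'n::finite cmat) topology"
  where "hom_space \<equiv> top_of_set matrix_homs"

lemma continuous_map_lift2:
  assumes "continuous_on UNIV (\<lambda>p. g (fst p) (snd p))"
    and "continuous_map Y euclidean a" "continuous_map Y euclidean b"
  shows "continuous_map Y euclidean (\<lambda>y. g (a y) (b y))"
proof -
  have "continuous_map Y euclidean ((\<lambda>p. g (fst p) (snd p)) \<circ> (\<lambda>y. (a y, b y)))"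
    by (rule continuous_map_compose[where X' = euclidean])
      (use assms in \<open>auto simp: continuous_map_paired euclidean_product_topology
          simp flip: prod_topology_euclidean continuous_map_iff_continuous2\<close>)
  then show ?thesis by (simp add: o_def)
qed

lemma continuous_map_lift1:
  assumes "continuous_on UNIV g" "continuous_map Y euclidean a"
  shows "continuous_map Y euclidean (\<lambda>y. g (a y))"
  using assms continuous_map_compose[of Y euclidean a euclidean g] by (simp add: o_def)

lemma continuous_map_cmat_mult:
  fixes a b :: "'y \<Rightarrow> 'n::finite cmat"
  assumes "continuous_map Y euclidean a" "continuous_map Y euclidean b"
  shows "continuous_map Y euclidean (\<lambda>y. a y ** b y)"
  by (rule continuous_map_lift2[OF _ assms]) (intro continuous_intros)

lemma continuous_map_cscale:
  fixes b :: "'y \<Rightarrow> 'n::finite cmat"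
  assumes "continuous_map Y euclidean a" "continuous_map Y euclidean b"
  shows "continuous_map Y euclidean (\<lambda>y. cscale (a y) (b y))"
  by (rule continuous_map_lift2[OF _ assms]) (intro continuous_intros)

lemma continuous_map_cmat_nth:
  fixes a :: "'y \<Rightarrow> 'n::finite cmat"
  assumes "continuous_map Y euclidean a"
  shows "continuous_map Y euclidean (\<lambda>y. a y $ i $ j)"
  by (rule continuous_map_lift1[OF _ assms]) (intro continuous_intros)

lemma continuous_map_into_functions_iff:
  "continuous_map Y (top_of_set S) F \<longleftrightarrow>
    F \<in> topspace Y \<rightarrow> S \<and> (\<forall>T. continuous_map Y euclidean (\<lambda>y. F y T))"
  unfolding continuous_map_in_subtopology euclidean_product_topology[symmetric]
    continuous_map_componentwise_UNIV by auto

lemma continuous_map_function_apply: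
  "continuous_map Y (top_of_set S) F \<Longrightarrow> continuous_map Y euclidean (\<lambda>y. F y T)"
  by (simp add: continuous_map_into_functions_iff)

text \<open>A homomorphism is determined linearly by its values on matrix units, so pointwise
  convergence already makes evaluation jointly continuous.\<close>

lemma continuous_map_hom_eval:
  assumes "continuous_map Y hom_space F" "continuous_map Y euclidean T"
  shows "continuous_map Y euclidean (\<lambda>y. F y (T y))"
proof (rule continuous_map_eq)
  show "continuous_map Y euclidean
      (\<lambda>y. \<Sum>i\<in>UNIV. \<Sum>j\<in>UNIV. cscale (T y $ i $ j) (F y (matrix_unit i j)))"
    by (intro continuous_map_sum finite_class.finite_UNIV continuous_map_cscale
        continuous_map_cmat_nth assms continuous_map_function_apply[OF assms(1)])
  fix y assume "y \<in> topspace Y"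
  then have "F y \<in> matrix_homs" using assms(1) by (auto simp: continuous_map_into_functions_iff)
  then show "(\<Sum>i\<in>UNIV. \<Sum>j\<in>UNIV. cscale (T y $ i $ j) (F y (matrix_unit i j))) = F y (T y)"
    by (simp add: matrix_hom_expansion[of "F y" "T y"])
qed

lemma continuous_map_cmatI:
  fixes a :: "'y \<Rightarrow> 'n::finite cmat"
  assumes "\<And>i j. continuous_map Y euclidean (\<lambda>y. a y $ i $ j)"
  shows "continuous_map Y euclidean a"
proof -
  have "continuous_map Y euclidean
      (\<lambda>y. \<Sum>i\<in>UNIV. \<Sum>j\<in>UNIV. cscale (a y $ i $ j) (matrix_unit i j))"
    by (intro continuous_map_sum finite_class.finite_UNIV continuous_map_cscale assms) simp
  then show ?thesis by (simp flip: matrix_unit_expansion)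
qed

lemma continuous_map_hom_retraction:
  fixes F :: "'y \<Rightarrow> 'k::finite cmat \<Rightarrow> 'n::finite cmat"
  assumes "continuous_map Y hom_space F" "continuous_map Y euclidean T"
  shows "continuous_map Y euclidean (\<lambda>y. hom_retraction (F y) (T y))"
proof (rule continuous_map_cmatI)
  fix i j :: 'k
  have "continuous_map Y euclidean
      (\<lambda>y. of_nat CARD('k) / of_nat CARD('n) * trace (F y (matrix_unit j i) ** T y))"
    by (rule continuous_map_lift1[where g = "\<lambda>A. _ * trace A"])
      (intro continuous_intros continuous_map_cmat_mult assms continuous_map_function_apply[OF assms(1)])+
  then show "continuous_map Y euclidean (\<lambda>y. hom_retraction (F y) (T y) $ i $ j)"
    by (simp add: hom_retraction_def)
qed

text \<open>Homomorphisms with the same image differ by an automorphism of \<open>M\<^sub>k\<close>, and automorphisms are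
  inner. Thus the fibres of \<open>f \<mapsto> range f\<close> are the orbits of \<open>PU(k)\<close>.\<close>

lemma matrix_hom_same_range:
  fixes f g :: "'k::finite cmat \<Rightarrow> 'n::finite cmat"
  assumes f: "f \<in> matrix_homs" and g: "g \<in> matrix_homs" and card: "CARD('n) = CARD('k) * m"
    and range: "range f \<subseteq> range g"
  obtains u where "u \<in> unitary_group" "f = (\<lambda>x. g (u ** x ** adj u))"
proof -
  define a where "a x = hom_retraction g (f x)" for x
  have ga: "g (a x) = f x" for x
    using range hom_retraction_apply[OF g card] unfolding a_def by (metis rangeI subsetD rangeE)
  have inj: "x = y" if "g x = g y" for x y
    using that hom_retraction_apply[OF g card] by metis
  have "a \<in> matrix_homs"
    unfolding matrix_homs_iff
    by (intro conjI allI; rule inj) (simp_all add: ga matrix_homD[OF g] matrix_homD[OF f])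
  then obtain u where "u \<in> unitary_group" "\<And>x. a x = u ** x ** adj u"
    by (rule matrix_aut_inner) blast
  with that ga show thesis by (metis ext)
qed

lemma precomp_conj_matrix_hom:
  assumes "f \<in> matrix_homs" "u \<in> unitary_group"
  shows "(\<lambda>x. f (u ** x ** adj u)) \<in> matrix_homs"
  using matrix_hom_compose[OF assms(1) conj_matrix_hom[OF id_matrix_hom(2) assms(2)]]
  by (simp add: o_def)

lemma range_precomp_conj:
  assumes "u \<in> unitary_group"
  shows "range (\<lambda>x. f (u ** x ** adj u)) = range f"
proof -
  have "u ** (adj u ** y ** u) ** adj u = (u ** adj u) ** y ** (u ** adj u)" for y
    by (simp only: matrix_mul_assoc)
  then have "surj (\<lambda>x. u ** x ** adj u)"
    by (intro surjI[where f = "\<lambda>y. adj u ** y ** u"]) (simp add: unitaryD[OF assms])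
  then have "f ` range (\<lambda>x. u ** x ** adj u) = range f" by (simp only:)
  then show ?thesis by (simp only: image_image)
qed

lemma Hausdorff_hom_space: "Hausdorff_space hom_space"
  by (intro Hausdorff_space_subtopology)
    (simp add: euclidean_product_topology[symmetric] Hausdorff_space_product_topology)

text \<open>By Skolem--Noether the unitary group acts transitively on homomorphisms, and a continuous
  surjection from a compact space onto a Hausdorff space is a quotient map. This replaces an explicit
  continuous choice of the conjugating unitary.\<close>

lemma quotient_map_conj:
  fixes f0 :: "'k::finite cmat \<Rightarrow> 'n::finite cmat"
  assumes f0: "f0 \<in> matrix_homs" and card: "CARD('n) = CARD('k) * m"
  shows "quotient_map (top_of_set unitary_group) hom_space (\<lambda>U a. U ** f0 a ** adj U)"
proof (rule continuous_imp_quotient_map)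
  show "continuous_map (top_of_set unitary_group) hom_space (\<lambda>U a. U ** f0 a ** adj U)"
    by (auto simp: continuous_map_into_functions_iff conj_matrix_hom[OF f0]
        intro!: continuous_intros)
  show "compact_space (top_of_set (unitary_group :: 'n cmat set))"
    by (simp add: compact_space_subtopology compact_unitary_group)
  show "Hausdorff_space (hom_space :: ('k cmat \<Rightarrow> 'n cmat) topology)"
    by (rule Hausdorff_hom_space)
  show "(\<lambda>U a. U ** f0 a ** adj U) ` topspace (top_of_set unitary_group) = topspace hom_space"
  proof (intro equalityI subsetI)
    fix g :: "'k cmat \<Rightarrow> 'n cmat" assume "g \<in> topspace hom_space"
    then have "g \<in> matrix_homs" by simp
    then obtain U where "U \<in> unitary_group" "\<And>a. g a = U ** f0 a ** adj U"
      by (rule Skolem_Noether[OF f0 _ card]) blast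
    then show "g \<in> (\<lambda>U a. U ** f0 a ** adj U) ` topspace (top_of_set unitary_group)"
      by (auto simp: fun_eq_iff)
  qed (auto simp: conj_matrix_hom[OF f0])
qed

lemma compact_hom_space:
  assumes "f0 \<in> (matrix_homs :: ('k::finite cmat \<Rightarrow> 'n::finite cmat) set)" and "CARD('n) = CARD('k) * m"
  shows "compact_space (hom_space :: ('k cmat \<Rightarrow> 'n cmat) topology)"
proof -
  note q = quotient_map_conj[OF assms]
  have "compactin hom_space ((\<lambda>U a. U ** f0 a ** adj U) ` topspace (top_of_set (unitary_group :: 'n cmat set)))"
    by (rule image_compactin[OF _ quotient_imp_continuous_map[OF q]])
      (simp add: compactin_subtopology compact_unitary_group)
  then show ?thesis
    unfolding quotient_imp_surjective_map[OF q] by (simp add: compact_space_def)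
qed

section \<open>The space of subalgebras as a quotient of the space of homomorphisms\<close>

lemma topspace_final_topology:
  assumes "\<And>X f. (X, f) \<in> F \<Longrightarrow> f ` topspace X \<subseteq> S"
  shows "topspace (final_topology S F) = S"
proof
  have "openin (final_topology S F) S"
    unfolding openin_final_topology
  proof (intro conjI ballI, simp, clarify)
    fix X f assume "(X, f) \<in> F"
    then have "{x \<in> topspace X. f x \<in> S} = topspace X" using assms by blast
    then show "openin X {x \<in> topspace X. f x \<in> S}" by simp
  qed
  then show "S \<subseteq> topspace (final_topology S F)" by (rule openin_subset)
  show "topspace (final_topology S F) \<subseteq> S"
    unfolding topspace_def openin_final_topology by blast
qed

lemma cmat_subalgebra_simps [simp]:
  "sa_carrier (cmat_subalgebra S) = S" "sa_add (cmat_subalgebra S) = (+)"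
  "sa_scale (cmat_subalgebra S) = cscale" "sa_mult (cmat_subalgebra S) = (**)"
  "sa_star (cmat_subalgebra S) = adj" "sa_one (cmat_subalgebra S) = mat 1"
  by (simp_all add: cmat_subalgebra_def)

lemma star_isos_cmat_subalgebra_iff:
  "f \<in> star_isos cmat_algebra (cmat_subalgebra S) \<longleftrightarrow> f \<in> matrix_homs \<and> range f = S"
  for f :: "'k::finite cmat \<Rightarrow> ('k \<times> 'l::finite) cmat"
proof -
  have "f \<in> star_homs cmat_algebra (cmat_subalgebra S) \<longleftrightarrow> f \<in> matrix_homs \<and> range f \<subseteq> S"
    unfolding star_homs_def by (auto simp: PiE_def)
  then show ?thesis
    using matrix_hom_inj[OF _ card_prod_multiplicity, of f]
    unfolding star_isos_def by (auto simp: bij_betw_def)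
qed

lemma k_subalgebras_eq_ranges:
  "k_subalgebras = range ` (matrix_homs :: ('k::finite cmat \<Rightarrow> ('k \<times> 'l::finite) cmat) set)"
proof -
  have "unital_star_subalgebra cmat_algebra (range f)" if "f \<in> matrix_homs"
    for f :: "'k cmat \<Rightarrow> ('k \<times> 'l) cmat"
    unfolding unital_star_subalgebra_def
    by (auto simp: matrix_homD[OF that, symmetric])
  then have *: "S \<in> k_subalgebras \<longleftrightarrow> (\<exists>f. f \<in> (matrix_homs :: ('k cmat \<Rightarrow> ('k \<times> 'l) cmat) set) \<and> range f = S)"
    for S :: "('k \<times> 'l) cmat set"
    unfolding k_subalgebras_def ex_in_conv[symmetric] star_isos_cmat_subalgebra_iff by blast
  show ?thesis
  proof (intro equalityI subsetI)
    fix S :: "('k \<times> 'l) cmat set"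
    assume "S \<in> k_subalgebras"
    then obtain f where "f \<in> (matrix_homs :: ('k cmat \<Rightarrow> ('k \<times> 'l) cmat) set)" "range f = S"
      unfolding * by (elim exE conjE)
    then show "S \<in> range ` (matrix_homs :: ('k cmat \<Rightarrow> ('k \<times> 'l) cmat) set)"
      by (intro image_eqI) simp_all
  next
    fix S :: "('k \<times> 'l) cmat set"
    assume "S \<in> range ` (matrix_homs :: ('k cmat \<Rightarrow> ('k \<times> 'l) cmat) set)"
    then obtain f where "f \<in> (matrix_homs :: ('k cmat \<Rightarrow> ('k \<times> 'l) cmat) set)" "S = range f"
      by (elim imageE)
    then show "S \<in> k_subalgebras"
      unfolding * by (intro exI[of _ f]) simp
  qed
qed

text \<open>The orbit map that defines the topology of \<open>Gr\<close> factors through the space of homomorphisms, so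
  \<open>Gr\<close> is also the orbit space of \<open>PU(k)\<close> acting on that space by precomposition.\<close>

lemma quotient_map_range_Gr:
  "quotient_map hom_space Gr (\<lambda>f :: 'k::finite cmat \<Rightarrow> ('k \<times> 'l::finite) cmat. range f)"
proof -
  let ?t = "tensor_one :: 'k cmat \<Rightarrow> ('k \<times> 'l) cmat"
  let ?conj = "\<lambda>U a. U ** ?t a ** adj U"
  have q: "quotient_map (top_of_set unitary_group) hom_space ?conj"
    by (rule quotient_map_conj[OF tensor_one_matrix_hom card_prod_multiplicity])
  have Gr: "(Gr :: ('k \<times> 'l) cmat set topology)
      = final_topology k_subalgebras {(top_of_set unitary_group, \<lambda>U. range (?conj U))}"
    unfolding Gr_def by (simp add: image_image)
  have im: "(\<lambda>U. range (?conj U)) ` unitary_group = k_subalgebras"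
    unfolding k_subalgebras_eq_ranges
    by (subst quotient_imp_surjective_map[OF q, simplified, symmetric]) (simp only: image_image)
  have top: "topspace Gr = (k_subalgebras :: ('k \<times> 'l) cmat set set)"
    unfolding Gr by (rule topspace_final_topology) (use im in auto)
  have "quotient_map (top_of_set unitary_group) Gr (\<lambda>U. range (?conj U))"
    unfolding quotient_map_def top using im
    by (auto simp: Gr openin_final_topology)
  then have qc: "quotient_map (top_of_set unitary_group) Gr (range \<circ> ?conj)"
    by (simp add: o_def)
  show ?thesis
    by (rule quotient_map_from_composition[OF quotient_imp_continuous_map[OF q] _ qc])
      (rule continuous_compose_quotient_map[OF q quotient_imp_continuous_map[OF qc]])
qed

lemma topspace_Gr: "topspace Gr = k_subalgebras"
  using quotient_imp_surjective_map[OF quotient_map_range_Gr] k_subalgebras_eq_ranges by auto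

lemma closedin_if_preimage_quotient_map:
  "quotient_map X Y f \<Longrightarrow> closedin X {x \<in> topspace X. f x \<in> U} \<Longrightarrow> U \<subseteq> topspace Y \<Longrightarrow> closedin Y U"
  by (simp add: quotient_map_closedin)

text \<open>The saturation of a closed set of homomorphisms is its image under the action of the compact group
  of unitaries, hence compact.\<close>

lemma closed_map_range_Gr:
  "closed_map hom_space Gr (\<lambda>f :: 'k::finite cmat \<Rightarrow> ('k \<times> 'l::finite) cmat. range f)"
  unfolding closed_map_def
proof (intro allI impI)
  fix C :: "('k cmat \<Rightarrow> ('k \<times> 'l) cmat) set"
  assume C: "closedin hom_space C"
  then have CX: "C \<subseteq> matrix_homs" using closedin_subset by fastforce
  let ?act = "\<lambda>(f, u). \<lambda>x. f (u ** x ** adj u)"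
  let ?Z = "prod_topology hom_space (top_of_set unitary_group)
    :: (('k cmat \<Rightarrow> ('k \<times> 'l) cmat) \<times> 'k cmat) topology"
  have saturation: "{f \<in> topspace hom_space. range f \<in> range ` C} = ?act ` (C \<times> unitary_group)"
    (is "?sat = _")
  proof (intro equalityI subsetI)
    fix f :: "'k cmat \<Rightarrow> ('k \<times> 'l) cmat" assume "f \<in> {f \<in> topspace hom_space. range f \<in> range ` C}"
    then have f: "f \<in> matrix_homs" and "range f \<in> range ` C" by simp_all
    then obtain g where g: "g \<in> C" "range f = range g" by (elim imageE)
    have "g \<in> matrix_homs" using CX g(1) by (rule subsetD)
    then obtain u where u: "u \<in> unitary_group" "f = (\<lambda>x. g (u ** x ** adj u))"
      by (rule matrix_hom_same_range[OF f _ card_prod_multiplicity equalityD1[OF g(2)]])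
    show "f \<in> ?act ` (C \<times> unitary_group)"
      by (rule image_eqI[of _ _ "(g, u)"]) (simp_all add: u g(1))
  next
    fix f :: "'k cmat \<Rightarrow> ('k \<times> 'l) cmat" assume "f \<in> ?act ` (C \<times> unitary_group)"
    then obtain g u where g: "g \<in> C" "u \<in> unitary_group" and f: "f = (\<lambda>x. g (u ** x ** adj u))" by auto
    have "f \<in> matrix_homs" unfolding f using subsetD[OF CX g(1)] g(2) by (rule precomp_conj_matrix_hom)
    moreover have "range f = range g" unfolding f by (rule range_precomp_conj[OF g(2)])
    ultimately show "f \<in> ?sat" using g(1) by simp
  qed
  have "continuous_map ?Z hom_space ?act"
    unfolding continuous_map_into_functions_iff case_prod_unfold
  proof (intro conjI allI)
    fix T :: "'k cmat"
    have u: "continuous_map ?Z euclidean snd"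
      using continuous_map_snd continuous_map_into_fulltopology by blast
    have "continuous_map ?Z euclidean (\<lambda>z. snd z ** T ** adj (snd z))"
      by (rule continuous_map_lift1[OF _ u]) (intro continuous_intros)
    then show "continuous_map ?Z euclidean (\<lambda>z. fst z (snd z ** T ** adj (snd z)))"
      by (rule continuous_map_hom_eval[OF continuous_map_fst])
  qed (simp add: precomp_conj_matrix_hom Pi_iff)
  moreover have "compactin ?Z (C \<times> unitary_group)"
  proof -
    have "compactin hom_space C"
      by (rule closedin_compact_space[OF compact_hom_space[OF tensor_one_matrix_hom card_prod_multiplicity] C])
    moreover have "compactin (top_of_set (unitary_group :: 'k cmat set)) unitary_group"
      by (simp add: compactin_subtopology compact_unitary_group)
    ultimately show ?thesis by (simp only: compactin_Times simp_thms)
  qed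
  ultimately have "compactin hom_space (?act ` (C \<times> unitary_group))"
    by (rule image_compactin[rotated])
  then have "closedin hom_space ?sat"
    unfolding saturation by (rule compactin_imp_closedin[OF Hausdorff_hom_space])
  moreover have "range ` C \<subseteq> topspace Gr"
    unfolding topspace_Gr k_subalgebras_eq_ranges by (rule image_mono[OF CX])
  ultimately show "closedin Gr (range ` C)"
    by (intro closedin_if_preimage_quotient_map[OF quotient_map_range_Gr])
qed

section \<open>Polar decomposition\<close>

text \<open>These turn out to be the positive semidefinite matrices. The extremal formulation makes the polar
  decomposition a matter of compactness, and it is visibly a closed condition.\<close>

definition trace_maximal :: "'n::finite cmat \<Rightarrow> bool"
  where "trace_maximal h \<longleftrightarrow> (\<forall>v\<in>unitary_group. Re (trace (v ** h)) \<le> Re (trace h))"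

text \<open>A unitary that maximizes the real part of the trace of \<open>u\<^sup>* w\<close> exists by compactness.\<close>

lemma polar_decomposition:
  obtains u where "u \<in> unitary_group" "trace_maximal (adj u ** w)"
proof -
  have "continuous_on unitary_group (\<lambda>u. Re (trace (adj u ** w)))"
    by (intro continuous_intros)
  then obtain u where u: "u \<in> unitary_group"
    and max: "\<And>v. v \<in> unitary_group \<Longrightarrow> Re (trace (adj v ** w)) \<le> Re (trace (adj u ** w))"
    using continuous_attains_sup[OF compact_unitary_group] one_unitary by (metis empty_iff)
  have "Re (trace (v ** (adj u ** w))) \<le> Re (trace (adj u ** w))" if "v \<in> unitary_group" for v
    using max[of "u ** adj v"] that u by (simp add: adj_mult unitary_mult unitaryD matrix_mul_assoc)
  with u that show thesis by (auto simp: trace_maximal_def)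
qed

lemma phase_unitary:
  assumes x: "norm x = 1" and z: "cmod z = 1"
  shows "mat 1 + cscale (z - 1) (ket_bra x x) \<in> unitary_group"
proof (rule unitary_if_left_inverse)
  let ?P = "ket_bra x x"
  have zz: "z * cnj z = 1" using z complex_norm_square[of z] by simp
  have "(mat 1 + cscale (z - 1) ?P) ** adj (mat 1 + cscale (z - 1) ?P)
      = mat 1 + cscale ((z - 1) + cnj (z - 1) + (z - 1) * cnj (z - 1)) ?P"
    by (simp add: adj_add adj_cscale adj_ket_bra cmat_distribs ket_bra_mult_ket_bra x)
      (simp add: cmat_eq_iff algebra_simps)
  also have "(z - 1) + cnj (z - 1) + (z - 1) * cnj (z - 1) = 0"
    using zz by (simp add: algebra_simps)
  finally show "(mat 1 + cscale (z - 1) ?P) ** adj (mat 1 + cscale (z - 1) ?P) = mat 1"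
    by (simp only: cscale_zero add_0_right)
qed

text \<open>Among the unitaries \<open>1 + (z - 1) |x\<rangle>\<langle>x|\<close> with \<open>|z| = 1\<close>, which only change the phase in the
  direction \<open>x\<close>, the identity is optimal only if \<open>\<langle>x, h x\<rangle>\<close> already has phase zero.\<close>

lemma trace_maximal_ket_bra:
  assumes h: "trace_maximal h" and x: "norm x = 1"
  shows "trace (ket_bra x x ** h) = of_real (cmod (trace (ket_bra x x ** h)))"
proof (cases "trace (ket_bra x x ** h) = 0")
  case False
  define z where "z = trace (ket_bra x x ** h)"
  \<comment> \<open>the phase that makes \<open>w * z\<close> real and nonnegative\<close>
  define w where "w = cnj z / of_real (cmod z)"
  have z0: "z \<noteq> 0" using False by (simp add: z_def)
  have w: "cmod w = 1" using z0 by (simp add: w_def norm_divide)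
  have "Re (trace ((mat 1 + cscale (w - 1) (ket_bra x x)) ** h)) \<le> Re (trace h)"
    using h phase_unitary[OF x w] by (simp add: trace_maximal_def)
  then have "Re (w * z) \<le> Re z"
    by (simp add: cmat_distribs trace_add z_def[symmetric] left_diff_distrib)
  moreover have "w * z = of_real (cmod z)"
    using z0 complex_norm_square[of z] by (simp add: w_def field_simps power2_eq_square)
  ultimately have "cmod z \<le> Re z" by simp
  then have "Re z = cmod z" using complex_Re_le_cmod[of z] by simp
  then show ?thesis
    unfolding z_def[symmetric] using cmod_power2[of z] by (simp add: complex_eq_iff)
qed simp

lemma trace_maximal_nonneg:
  assumes h: "trace_maximal h"
  obtains r where "r \<ge> 0" "trace (adj X ** h ** X) = of_real r"
proof -
  have vec: "\<exists>r\<ge>0. trace (ket_bra x x ** h) = of_real r" for x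
  proof (cases "x = 0")
    case True
    then have "ket_bra x x = 0" by (simp add: cmat_eq_iff ket_bra_def)
    then show ?thesis by (intro exI[of _ 0]) simp
  next
    case False
    define y where "y = (1 / norm x) *\<^sub>R x"
    have "ket_bra x x = cscale (of_real ((norm x)\<^sup>2)) (ket_bra y y)"
      using False by (simp add: cmat_eq_iff ket_bra_def y_def scaleR_conv_of_real[where 'a = complex] power2_eq_square)
    moreover have "norm y = 1" using False by (simp add: y_def)
    ultimately have "trace (ket_bra x x ** h) = of_real ((norm x)\<^sup>2 * cmod (trace (ket_bra y y ** h)))"
      using trace_maximal_ket_bra[OF h, of y] by simp
    then show ?thesis
      by (intro exI[of _ "(norm x)\<^sup>2 * cmod (trace (ket_bra y y ** h))"]) simp
  qed
  define x where "x c = (\<chi> i. X $ i $ c)" for c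
  define r where "r c = Re (trace (ket_bra (x c) (x c) ** h))" for c
  have r: "r c \<ge> 0" "trace (ket_bra (x c) (x c) ** h) = of_real (r c)" for c
    using vec[of "x c"] by (auto simp: r_def)
  have "(\<Sum>c\<in>UNIV. ket_bra (x c) (x c)) = X ** adj X"
    by (simp add: cmat_eq_iff cmat_mult_nth ket_bra_def x_def)
  then have "trace (X ** adj X ** h) = of_real (\<Sum>c\<in>UNIV. r c)"
    by (simp add: r(2) cmat_mult_sum_left trace_sum flip: \<open>_ = X ** adj X\<close>)
  then have "trace (adj X ** h ** X) = of_real (\<Sum>c\<in>UNIV. r c)"
    using trace_mul_sym[of "adj X ** h" X] by (simp add: matrix_mul_assoc)
  with r(1) show thesis by (intro that[of "sum r UNIV"]) (simp_all add: sum_nonneg)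
qed

text \<open>Polarization, with \<open>X + Y\<close> and \<open>X + \<i> Y\<close>.\<close>

lemma sesquilinear_trace_zero:
  assumes "\<And>X. trace (adj X ** D ** X) = 0"
  shows "D = 0"
proof -
  have add: "trace (adj X ** D ** Y) + trace (adj Y ** D ** X) = 0" for X Y
    using assms[of "X + Y"] assms[of X] assms[of Y]
    by (simp add: adj_add cmat_distribs trace_add add.commute)
  have "trace (adj X ** D ** Y) = 0" for X Y
    using add[of X Y] add[of X "cscale \<i> Y"] by (simp add: adj_cscale)
  from this[of D "mat 1"] have "trace (adj D ** D) = 0" by simp
  then show ?thesis by (simp add: trace_adj_mult_self)
qed

lemma trace_maximal_hermitian:
  assumes h: "trace_maximal h"
  shows "adj h = h"
proof -
  have "trace (adj X ** (h - adj h) ** X) = 0" for X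
  proof -
    obtain r where r: "trace (adj X ** h ** X) = of_real r"
      by (rule trace_maximal_nonneg[OF h])
    have "trace (adj X ** adj h ** X) = cnj (trace (adj X ** h ** X))"
      by (simp add: trace_adj[symmetric] adj_mult matrix_mul_assoc)
    with r show ?thesis by (simp add: cmat_distribs trace_sub)
  qed
  then have "h - adj h = 0" by (rule sesquilinear_trace_zero)
  then show ?thesis by simp
qed

text \<open>The Cauchy--Schwarz argument for the semidefinite form given by \<open>h\<close>: moving from the null vector
  \<open>X\<close> a little in the direction \<open>- h X\<close> would make the form negative.\<close>

lemma trace_maximal_null:
  assumes h: "trace_maximal h" and X: "trace (adj X ** h ** X) = 0"
  shows "h ** X = 0"
proof -
  define G where "G = h ** X"
  obtain b where b: "b \<ge> 0" "trace (adj G ** h ** G) = of_real b"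
    by (rule trace_maximal_nonneg[OF h])
  \<comment> \<open>a step so short that the quadratic term \<open>s\<^sup>2 b\<close> is dominated by the linear one\<close>
  define s where "s = (norm G)\<^sup>2 / (b + 1)"
  obtain r where r: "r \<ge> 0" "trace (adj (X - cscale (of_real s) G) ** h ** (X - cscale (of_real s) G)) = of_real r"
    by (rule trace_maximal_nonneg[OF h])
  have 1: "trace (adj G ** h ** X) = of_real ((norm G)\<^sup>2)"
    using trace_adj_mult_self[of "h ** X"] by (simp only: G_def matrix_mul_assoc)
  have "trace (adj X ** h ** G) = cnj (trace (adj G ** h ** X))"
    by (simp add: trace_adj[symmetric] adj_mult matrix_mul_assoc trace_maximal_hermitian[OF h])
  with 1 have 2: "trace (adj X ** h ** G) = of_real ((norm G)\<^sup>2)" by simp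
  have "of_real r = (of_real (s\<^sup>2 * b - 2 * s * (norm G)\<^sup>2) :: complex)"
    unfolding r(2)[symmetric]
    by (simp add: adj_diff adj_cscale cmat_distribs trace_sub trace_add X 1 2 b power2_eq_square algebra_simps)
  then have "r = s\<^sup>2 * b - 2 * s * (norm G)\<^sup>2" by (simp only: of_real_eq_iff)
  also have "\<dots> = s * (s * b - 2 * (norm G)\<^sup>2)" by (simp add: algebra_simps power2_eq_square)
  also have "s * b - 2 * (norm G)\<^sup>2 \<le> - (norm G)\<^sup>2"
  proof -
    have "s * b \<le> s * (b + 1)"
      using b(1) by (intro mult_left_mono) (simp_all add: s_def)
    moreover have "s * (b + 1) = (norm G)\<^sup>2" using b(1) by (simp add: s_def)
    ultimately show ?thesis by linarith
  qed
  then have "s * (s * b - 2 * (norm G)\<^sup>2) \<le> s * - (norm G)\<^sup>2"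
    using b(1) by (intro mult_left_mono) (simp_all add: s_def)
  finally have "s * (norm G)\<^sup>2 \<le> 0" using r(1) by simp
  then have "G = 0"
    using b(1) by (auto simp: s_def mult_le_0_iff divide_le_0_iff)
  then show ?thesis by (simp add: G_def)
qed

text \<open>The form of \<open>h\<close> takes at \<open>(v - 1)\<^sup>*\<close> the value \<open>2 Re (tr h - tr (v h))\<close>, and maximality of both
  \<open>h\<close> and \<open>v h\<close> forces the two traces to have the same real part.\<close>

lemma polar_unique:
  assumes h: "trace_maximal h" "trace_maximal (v ** h)" and v: "v \<in> unitary_group" and inv: "invertible h"
  shows "v = mat 1"
proof -
  have "Re (trace (v ** h)) \<le> Re (trace h)"
    using h(1) v by (simp add: trace_maximal_def)
  moreover have "Re (trace (adj v ** (v ** h))) \<le> Re (trace (v ** h))"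
    using h(2) v by (simp add: trace_maximal_def unitaryD)
  moreover have "adj v ** (v ** h) = h" by (simp add: matrix_mul_assoc unitaryD v)
  ultimately have eq: "Re (trace (v ** h)) = Re (trace h)" by simp
  define X where "X = adj (v - mat 1)"
  obtain r where r: "r \<ge> 0" "trace (adj X ** h ** X) = of_real r"
    by (rule trace_maximal_nonneg[OF h(1)])
  have hv: "h ** adj v = adj (v ** h)" by (simp add: adj_mult trace_maximal_hermitian[OF h(1)])
  have "trace (v ** h ** adj v) = trace h"
    using trace_mul_sym[of "v ** h" "adj v"] by (simp add: matrix_mul_assoc unitaryD v)
  then have "trace (adj X ** h ** X) = trace h - trace (v ** h) - cnj (trace (v ** h)) + trace h"
    by (simp add: X_def adj_diff cmat_distribs trace_sub hv trace_adj flip: matrix_mul_assoc)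
  then have "Re (trace (adj X ** h ** X)) = 0" using eq by simp
  with r have "trace (adj X ** h ** X) = 0" by simp
  then have "h ** X = 0" by (rule trace_maximal_null[OF h(1)])
  moreover obtain h' where "h' ** h = mat 1" using inv by (auto simp: invertible_def)
  ultimately have "X = 0" by (metis cmat_mult_zero(2) matrix_mul_assoc matrix_mul_lid)
  then show ?thesis by (simp add: X_def adj_eq_zero_iff)
qed

section \<open>A slice for the action of automorphisms\<close>

text \<open>A linear map in \<open>w\<close> that measures how far conjugation by \<open>w\<close> brings \<open>f\<close> close to \<open>f0\<close>: for
  unitary \<open>w\<close> the square of its norm is the Hilbert--Schmidt inner product of \<open>f0\<close> with
  \<open>x \<mapsto> f (w x w\<^sup>*)\<close>. The index \<open>undefined\<close> merely selects one fixed row of matrix units.\<close>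

definition compare :: "('k::finite cmat \<Rightarrow> 'n::finite cmat) \<Rightarrow> ('k cmat \<Rightarrow> 'n cmat) \<Rightarrow> 'k cmat \<Rightarrow> 'n cmat"
  where "compare f0 f w = (\<Sum>i\<in>UNIV. f0 (matrix_unit undefined i) ** f (w ** matrix_unit i undefined))"

text \<open>The unit vectors on which the linear map \<open>compare f0 f\<close> attains its operator norm. All matrices of
  norm one compete, not only multiples of unitary ones: this makes the solutions a unit sphere in a linear
  subspace.\<close>

definition optimal :: "('k::finite cmat \<Rightarrow> 'n::finite cmat) \<Rightarrow> ('k cmat \<Rightarrow> 'n cmat) \<Rightarrow> 'k cmat set"
  where "optimal f0 f = {w. norm w = 1 \<and> (\<forall>v. norm v = 1 \<longrightarrow> norm (compare f0 f v) \<le> norm (compare f0 f w))}"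

lemma compare_linear:
  assumes "f \<in> matrix_homs"
  shows "compare f0 f (v + w) = compare f0 f v + compare f0 f w"
    "compare f0 f (v - w) = compare f0 f v - compare f0 f w"
    "compare f0 f (cscale c w) = cscale c (compare f0 f w)"
proof -
  show add: "compare f0 f (v + w) = compare f0 f v + compare f0 f w" for v w
    by (simp add: compare_def cmat_distribs matrix_homD[OF assms] sum.distrib)
  show "compare f0 f (cscale c w) = cscale c (compare f0 f w)"
    by (simp add: compare_def matrix_homD[OF assms] cscale_sum)
  show "compare f0 f (v - w) = compare f0 f v - compare f0 f w"
    using add[of "v - w" w] by simp
qed

lemma continuous_map_compare:
  assumes "continuous_map Y hom_space F" "continuous_map Y euclidean W"
  shows "continuous_map Y euclidean (\<lambda>y. compare f0 (F y) (W y))"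
  unfolding compare_def
  by (intro continuous_map_sum finite_class.finite_UNIV continuous_map_cmat_mult
      continuous_map_hom_eval[OF assms(1)] assms(2)) simp_all

lemma optimal_nonempty:
  assumes f: "f \<in> matrix_homs"
  shows "\<exists>w. w \<in> optimal f0 f"
proof -
  have "continuous_map euclidean euclidean (\<lambda>w. compare f0 f w)"
    by (rule continuous_map_compare) (use f in simp_all)
  then have "continuous_on (sphere 0 1) (\<lambda>w. norm (compare f0 f w))"
    by (intro continuous_on_norm) (auto intro: continuous_on_subset)
  moreover have "sphere (0 :: 'a cmat) 1 \<noteq> {}"
  proof -
    have "norm (mat 1 :: 'a cmat) \<noteq> 0"
      using trace_I[where 'a = complex and 'n = 'a] by auto
    then have "(1 / norm (mat 1 :: 'a cmat)) *\<^sub>R (mat 1 :: 'a cmat) \<in> sphere 0 1" by simp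
    then show ?thesis by blast
  qed
  ultimately obtain w where "w \<in> sphere 0 1"
    "\<And>v. v \<in> sphere 0 1 \<Longrightarrow> norm (compare f0 f v) \<le> norm (compare f0 f w)"
    using continuous_attains_sup[OF compact_sphere] by metis
  then show ?thesis by (auto simp: optimal_def)
qed

text \<open>Replacing \<open>f\<close> in its orbit translates the set of optimal matrices.\<close>

lemma optimal_precomp:
  assumes f: "f \<in> matrix_homs" and u: "u \<in> unitary_group"
  shows "w \<in> optimal f0 (\<lambda>x. f (u ** x ** adj u)) \<longleftrightarrow> u ** w \<in> optimal f0 f"
proof -
  have fu: "f (adj u) \<in> unitary_group"
    by (rule unitary_if_left_inverse) (simp add: matrix_homD[OF f, symmetric] unitaryD u)
  have "compare f0 (\<lambda>x. f (u ** x ** adj u)) v = compare f0 f (u ** v) ** f (adj u)" for v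
    by (simp add: compare_def cmat_mult_sum_left matrix_homD(3)[OF f] matrix_mul_assoc)
  then have *: "norm (compare f0 (\<lambda>x. f (u ** x ** adj u)) v) = norm (compare f0 f (u ** v))" for v
    by (simp add: norm_unitary_mult fu)
  have "(\<forall>v. norm v = 1 \<longrightarrow> norm (compare f0 f (u ** v)) \<le> r) \<longleftrightarrow>
      (\<forall>v. norm v = 1 \<longrightarrow> norm (compare f0 f v) \<le> r)" for r
  proof (intro iffI allI impI)
    fix v :: "'a cmat" assume *: "\<forall>v. norm v = 1 \<longrightarrow> norm (compare f0 f (u ** v)) \<le> r" "norm v = 1"
    then have "norm (compare f0 f (u ** (adj u ** v))) \<le> r"
      using u by (simp add: norm_unitary_mult unitaryD)
    then show "norm (compare f0 f v) \<le> r" by (simp add: matrix_mul_assoc unitaryD u)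
  qed (simp add: norm_unitary_mult u)
  then show ?thesis by (simp add: optimal_def * norm_unitary_mult u)
qed

text \<open>By the parallelogram law, the vectors on which a linear map attains its norm form a subspace.\<close>

lemma optimal_combination:
  assumes f: "f \<in> matrix_homs" and w: "w1 \<in> optimal f0 f" "w2 \<in> optimal f0 f"
    and norm: "norm (cscale a w1 + cscale b w2) = 1"
  shows "cscale a w1 + cscale b w2 \<in> optimal f0 f"
proof -
  define M where "M = norm (compare f0 f w1)"
  have M: "norm (compare f0 f w1) = M" "norm (compare f0 f w2) = M"
    using w by (auto simp: M_def optimal_def intro: antisym)
  have bound: "norm (compare f0 f v) \<le> M * norm v" for v
  proof (cases "v = 0")
    case True
    then show ?thesis using compare_linear(3)[OF f, of f0 0 0] by simp
  next
    case False
    have "norm (compare f0 f (cscale (of_real (1 / norm v)) v)) \<le> M"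
      using w(1) False by (auto simp: optimal_def M_def norm_cscale norm_divide)
    then show ?thesis
      using False by (simp add: compare_linear[OF f] norm_cscale norm_divide field_simps)
  qed
  define x y where "x = cscale a w1" and "y = cscale b w2"
  have xy: "norm (compare f0 f x) = M * norm x" "norm (compare f0 f y) = M * norm y"
    using w by (simp_all add: x_def y_def compare_linear[OF f] norm_cscale M optimal_def)
  have pl: "(norm (p + q))\<^sup>2 + (norm (p - q))\<^sup>2 = 2 * (norm p)\<^sup>2 + 2 * (norm q)\<^sup>2"
    for p q :: "'m::real_inner"
    by (simp add: power2_norm_eq_inner inner_add inner_diff inner_commute algebra_simps)
  \<comment> \<open>both summands are at most \<open>M\<^sup>2\<close> times the corresponding summand on the right, so equality holds in each\<close>
  have "(norm (compare f0 f (x + y)))\<^sup>2 + (norm (compare f0 f (x - y)))\<^sup>2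
      = M\<^sup>2 * ((norm (x + y))\<^sup>2 + (norm (x - y))\<^sup>2)"
    unfolding compare_linear[OF f] pl xy by (simp add: algebra_simps power_mult_distrib)
  moreover have "(norm (compare f0 f (x - y)))\<^sup>2 \<le> M\<^sup>2 * (norm (x - y))\<^sup>2"
    unfolding power_mult_distrib[symmetric] by (intro power_mono bound) simp
  ultimately have "M\<^sup>2 * (norm (x + y))\<^sup>2 \<le> (norm (compare f0 f (x + y)))\<^sup>2"
    by (simp add: algebra_simps)
  then have "M\<^sup>2 \<le> (norm (compare f0 f (x + y)))\<^sup>2"
    using norm by (simp add: x_def y_def)
  then have "M \<le> norm (compare f0 f (x + y))"
    by (rule power2_le_imp_le) simp
  moreover have "norm (compare f0 f v) \<le> M" if "norm v = 1" for v
    using bound[of v] that by simp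
  ultimately show ?thesis
    using norm unfolding optimal_def x_def y_def mem_Collect_eq by (auto intro: order_trans)
qed

text \<open>For \<open>f = f0\<close> the comparison is the trace times a fixed matrix, and the Cauchy--Schwarz inequality
  against the identity has scalar matrices as its only cases of equality.\<close>

lemma optimal_self:
  assumes f0: "f0 \<in> (matrix_homs :: ('k::finite cmat \<Rightarrow> 'n::finite cmat) set)"
    and card: "CARD('n) = CARD('k) * m" and w: "w \<in> optimal f0 f0"
  obtains c where "c \<noteq> 0" "w = cscale c (mat 1)"
proof -
  let ?e = "matrix_unit (undefined :: 'k) undefined"
  have cmp: "compare f0 f0 v = cscale (trace v) (f0 ?e)" for v
  proof -
    have "matrix_unit undefined i ** (v ** matrix_unit i undefined) = cscale (v $ i $ i) ?e" for i
    proof -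
      have "(matrix_unit undefined i ** (v ** matrix_unit i undefined)) $ a $ b = (cscale (v $ i $ i) ?e) $ a $ b" for a b
        by (auto simp: cmat_mult_nth matrix_unit_def if_distrib[of "\<lambda>x. x * _"] if_distrib[of "\<lambda>x. _ * x"] cong: if_cong)
      then show ?thesis by (simp add: cmat_eq_iff)
    qed
    then have "compare f0 f0 v = (\<Sum>i\<in>UNIV. cscale (v $ i $ i) (f0 ?e))"
      by (simp add: compare_def matrix_homD[OF f0, symmetric])
    also have "\<dots> = cscale (trace v) (f0 ?e)"
      by (simp add: trace_def cmat_eq_iff sum_distrib_right)
    finally show ?thesis .
  qed
  \<comment> \<open>injectivity of \<open>f0\<close> makes the comparison a nonzero multiple of the trace\<close>
  have "f0 ?e \<noteq> 0"
  proof
    assume "f0 ?e = 0"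
    then have "f0 ?e = f0 0" by (simp add: matrix_hom_zero[OF f0])
    then have "?e = 0" using matrix_hom_inj[OF f0 card] by (simp add: inj_eq)
    then have "?e $ undefined $ undefined = 0" by simp
    then show False by (simp add: matrix_unit_def)
  qed
  then have le: "cmod (trace v) \<le> cmod (trace w)" if "norm v = 1" for v :: "'k cmat"
    using w that by (simp add: optimal_def cmp norm_cscale)
  define k where "k = real CARD('k)"
  have k: "k > 0" by (simp add: k_def)
  have nI: "(norm (mat 1 :: 'k cmat))\<^sup>2 = k"
    unfolding norm_sq_trace by (simp add: trace_I k_def)
  then have nI': "norm (mat 1 :: 'k cmat) = sqrt k" by (metis norm_ge_zero real_sqrt_unique)
  have "sqrt k \<le> cmod (trace w)"
  proof -
    have "norm (cscale (of_real (1 / sqrt k)) (mat 1 :: 'k cmat)) = 1"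
      unfolding norm_cscale nI' using k by (simp add: norm_divide)
    from le[OF this] show ?thesis
      using k by (simp add: trace_I norm_mult norm_divide k_def[symmetric] real_div_sqrt)
  qed
  then have tr: "k \<le> (cmod (trace w))\<^sup>2"
    using k by (metis abs_le_square_iff abs_of_nonneg norm_ge_zero order_less_imp_le real_sqrt_ge_zero real_sqrt_pow2)
  \<comment> \<open>the orthogonal projection of \<open>w\<close> onto the scalar matrices is \<open>c\<close> times the identity\<close>
  define c where "c = trace w / of_real k"
  have "trace (adj (w - cscale c (mat 1)) ** (w - cscale c (mat 1)))
      = trace (adj w ** w) - cnj c * trace w - c * cnj (trace w) + cnj c * c * of_real k"
    by (simp add: adj_diff adj_cscale cmat_distribs trace_sub trace_add trace_I k_def trace_adj algebra_simps)
  also have "\<dots> = 1 - of_real ((cmod (trace w))\<^sup>2 / k)"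
    using k w complex_norm_square[of "trace w"]
    by (simp add: trace_adj_mult_self optimal_def c_def field_simps)
  finally have "(norm (w - cscale c (mat 1)))\<^sup>2 = 1 - (cmod (trace w))\<^sup>2 / k"
    unfolding trace_adj_mult_self by (metis of_real_1 of_real_diff of_real_eq_iff)
  also have "\<dots> \<le> 0" using tr k by (simp add: field_simps)
  finally have "w = cscale c (mat 1)" by simp
  moreover have "c \<noteq> 0" using tr k by (auto simp: c_def)
  ultimately show thesis using that by blast
qed

text \<open>The homomorphisms for which an optimal matrix is singular, or two of them are orthogonal. Outside
  this set the optimal matrix is invertible and unique up to a phase. The two conditions are combined
  in one equation; two copies of a singular optimal matrix satisfy it.\<close>

definition ambiguous :: "('k::finite cmat \<Rightarrow> 'n::finite cmat) \<Rightarrow> ('k cmat \<Rightarrow> 'n cmat) set"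
  where "ambiguous f0 = {f \<in> matrix_homs. \<exists>w1 w2. w1 \<in> optimal f0 f \<and> w2 \<in> optimal f0 f \<and>
    trace (adj w1 ** w2) * det w1 = 0}"

text \<open>The slice: homomorphisms for which the unitary part of an optimal matrix is the identity.\<close>

definition normalized :: "('k::finite cmat \<Rightarrow> 'n::finite cmat) \<Rightarrow> ('k cmat \<Rightarrow> 'n cmat) set"
  where "normalized f0 = {f \<in> matrix_homs. \<exists>h \<in> optimal f0 f. trace_maximal h}"

lemma closedin_le:
  assumes "continuous_map X euclideanreal f" "continuous_map X euclideanreal g"
  shows "closedin X {x \<in> topspace X. f x \<le> g x}"
proof -
  have "closedin X {x \<in> topspace X. g x - f x \<in> {0..}}"
    by (rule closedin_continuous_map_preimage[OF continuous_map_diff[OF assms(2,1)]]) simp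
  then show ?thesis by simp
qed

lemma closedin_optimal:
  "closedin (prod_topology hom_space (top_of_set (sphere 0 1))) {(f, w). f \<in> matrix_homs \<and> w \<in> optimal f0 f}"
  (is "closedin ?Z ?S")
proof -
  have top: "topspace ?Z = matrix_homs \<times> sphere 0 1" by simp
  have "closedin ?Z {z \<in> topspace ?Z. norm (compare f0 (fst z) v) \<le> norm (compare f0 (fst z) (snd z))}" for v
  proof (rule closedin_le)
    show "continuous_map ?Z euclideanreal (\<lambda>z. norm (compare f0 (fst z) v))"
      by (intro continuous_map_norm continuous_map_compare continuous_map_fst) simp
    have "continuous_map ?Z euclidean snd"
      using continuous_map_snd continuous_map_into_fulltopology by blast
    then show "continuous_map ?Z euclideanreal (\<lambda>z. norm (compare f0 (fst z) (snd z)))"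
      by (intro continuous_map_norm continuous_map_compare continuous_map_fst)
  qed
  \<comment> \<open>the factor \<open>topspace ?Z\<close> keeps the intersection inside the space when the index set is empty\<close>
  then have "closedin ?Z (topspace ?Z \<inter> (\<Inter>v\<in>{v. norm v = 1}.
      {z \<in> topspace ?Z. norm (compare f0 (fst z) v) \<le> norm (compare f0 (fst z) (snd z))}))"
    by (cases "{v :: 'a cmat. norm v = 1} = {}")
      (simp only: image_empty Inter_empty Int_UNIV_right closedin_topspace,
        intro closedin_Int closedin_topspace closedin_Inter, simp, elim imageE, simp only:)
  moreover have "topspace ?Z \<inter> (\<Inter>v\<in>{v. norm v = 1}.
      {z \<in> topspace ?Z. norm (compare f0 (fst z) v) \<le> norm (compare f0 (fst z) (snd z))}) = ?S"
    unfolding top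
  proof (intro equalityI subsetI)
    fix z assume "z \<in> ?S"
    then show "z \<in> matrix_homs \<times> sphere 0 1 \<inter> (\<Inter>v\<in>{v. norm v = 1}.
      {z \<in> matrix_homs \<times> sphere 0 1. norm (compare f0 (fst z) v) \<le> norm (compare f0 (fst z) (snd z))})"
      by (clarsimp simp: optimal_def)
  qed (clarsimp simp: optimal_def)
  ultimately show ?thesis by (simp only:)
qed

text \<open>Quantifying existentially over a compact space preserves closedness.\<close>

lemma closedin_hom_space_project:
  fixes S :: "(('k::finite cmat \<Rightarrow> 'n::finite cmat) \<times> 'w) set"
  assumes "CARD('n) = CARD('k) * m" "f0 \<in> (matrix_homs :: ('k cmat \<Rightarrow> 'n cmat) set)"
    and "compact_space W" "closedin (prod_topology hom_space W) S"
  shows "closedin hom_space (fst ` S)"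
proof -
  have "compactin (prod_topology hom_space W) S"
    by (rule closedin_compact_space[OF _ assms(4)])
      (simp add: compact_space_prod_topology compact_hom_space[OF assms(2,1)] assms(3))
  then have "compactin hom_space (fst ` S)"
    by (rule image_compactin[OF _ continuous_map_fst])
  then show ?thesis by (rule compactin_imp_closedin[OF Hausdorff_hom_space])
qed

lemma closedin_normalized:
  fixes f0 :: "'k::finite cmat \<Rightarrow> 'n::finite cmat"
  assumes "CARD('n) = CARD('k) * m" "f0 \<in> matrix_homs"
  shows "closedin hom_space (normalized f0)"
proof -
  let ?W = "top_of_set (sphere 0 1) :: 'k cmat topology"
  have "closed {h :: 'k cmat. trace_maximal h}"
    unfolding trace_maximal_def Ball_def
    by (intro closed_Collect_all closed_Collect_imp open_Collect_const closed_Collect_le continuous_intros)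
  then have "closedin ?W {h \<in> topspace ?W. h \<in> {h. trace_maximal h}}"
    by (intro closedin_continuous_map_preimage[where Y = euclidean]) simp_all
  then have "closedin (prod_topology hom_space ?W) (matrix_homs \<times> {h \<in> topspace ?W. h \<in> {h. trace_maximal h}})"
    unfolding closedin_prod_Times_iff by (metis closedin_topspace topspace_euclidean_subtopology)
  then have "closedin (prod_topology hom_space ?W)
      ({(f, w). f \<in> matrix_homs \<and> w \<in> optimal f0 f} \<inter> matrix_homs \<times> {h \<in> topspace ?W. h \<in> {h. trace_maximal h}})"
    by (intro closedin_Int closedin_optimal)
  then have "closedin hom_space (fst ` ({(f, w). f \<in> matrix_homs \<and> w \<in> optimal f0 f} \<inter>
      matrix_homs \<times> {h \<in> topspace ?W. h \<in> {h. trace_maximal h}}))"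
    by (intro closedin_hom_space_project[OF assms, of ?W]) (simp_all add: compact_space_subtopology)
  also have "fst ` ({(f, w). f \<in> matrix_homs \<and> w \<in> optimal f0 f} \<inter>
      matrix_homs \<times> {h \<in> topspace ?W. h \<in> {h. trace_maximal h}}) = normalized f0"
    by (force simp: normalized_def optimal_def)
  finally show ?thesis .
qed

lemma closedin_ambiguous:
  fixes f0 :: "'k::finite cmat \<Rightarrow> 'n::finite cmat"
  assumes "CARD('n) = CARD('k) * m" "f0 \<in> matrix_homs"
  shows "closedin hom_space (ambiguous f0)"
proof -
  let ?S1 = "top_of_set (sphere 0 1) :: 'k cmat topology"
  let ?W = "prod_topology ?S1 ?S1"
  let ?Z = "prod_topology hom_space ?W :: (('k cmat \<Rightarrow> 'n cmat) \<times> 'k cmat \<times> 'k cmat) topology"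
  let ?O = "{(f, w). f \<in> matrix_homs \<and> w \<in> optimal f0 f}"
  have 1: "closedin ?Z {z \<in> topspace ?Z. (fst z, fst (snd z)) \<in> ?O}"
    by (rule closedin_continuous_map_preimage[OF _ closedin_optimal])
      (intro continuous_map_pairedI continuous_map_fst continuous_map_compose[OF continuous_map_snd, unfolded o_def])
  have 2: "closedin ?Z {z \<in> topspace ?Z. (fst z, snd (snd z)) \<in> ?O}"
    by (rule closedin_continuous_map_preimage[OF _ closedin_optimal])
      (intro continuous_map_pairedI continuous_map_fst continuous_map_snd continuous_map_compose[OF continuous_map_snd, unfolded o_def])
  have c: "continuous_map ?Z euclidean (\<lambda>z. fst (snd z))" "continuous_map ?Z euclidean (\<lambda>z. snd (snd z))"
    using continuous_map_compose[OF continuous_map_snd continuous_map_fst, of hom_space ?S1 ?S1]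
      continuous_map_compose[OF continuous_map_snd continuous_map_snd, of hom_space ?S1 ?S1]
    by (auto simp: o_def intro: continuous_map_into_fulltopology)
  have "continuous_map ?Z euclidean (\<lambda>z. trace (adj (fst (snd z)) ** snd (snd z)) * det (fst (snd z)))"
    by (rule continuous_map_lift2[OF _ c]) (unfold det_def, intro continuous_intros)
  then have 3: "closedin ?Z {z \<in> topspace ?Z. trace (adj (fst (snd z)) ** snd (snd z)) * det (fst (snd z)) \<in> {0}}"
    by (rule closedin_continuous_map_preimage) simp
  let ?T = "{z \<in> topspace ?Z. (fst z, fst (snd z)) \<in> ?O} \<inter> {z \<in> topspace ?Z. (fst z, snd (snd z)) \<in> ?O}
     \<inter> {z \<in> topspace ?Z. trace (adj (fst (snd z)) ** snd (snd z)) * det (fst (snd z)) \<in> {0}}"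
  have "closedin ?Z ?T" by (intro closedin_Int 1 2 3)
  then have "closedin hom_space (fst ` ?T)"
    by (intro closedin_hom_space_project[OF assms, of ?W]) (simp_all only: compact_space_prod_topology, simp add: compact_space_subtopology)
  also have "fst ` ?T = ambiguous f0"
  proof (intro equalityI subsetI)
    fix f assume "f \<in> fst ` ?T"
    then show "f \<in> ambiguous f0" by (auto simp: ambiguous_def)
  next
    fix f assume "f \<in> ambiguous f0"
    then obtain w1 w2 where "f \<in> matrix_homs" "w1 \<in> optimal f0 f" "w2 \<in> optimal f0 f"
      "trace (adj w1 ** w2) * det w1 = 0" by (auto simp: ambiguous_def)
    then show "f \<in> fst ` ?T" by (intro image_eqI[of _ _ "(f, w1, w2)"]) (auto simp: optimal_def)
  qed
  finally show ?thesis .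
qed

lemma self_not_ambiguous:
  assumes card: "CARD('n) = CARD('k) * m"
    and f0: "f0 \<in> (matrix_homs :: ('k::finite cmat \<Rightarrow> 'n::finite cmat) set)"
  shows "f0 \<notin> ambiguous f0"
proof
  assume "f0 \<in> ambiguous f0"
  then obtain w1 w2 where w: "w1 \<in> optimal f0 f0" "w2 \<in> optimal f0 f0"
    and zero: "trace (adj w1 ** w2) * det w1 = 0" by (auto simp: ambiguous_def)
  obtain c1 where c1: "c1 \<noteq> 0" "w1 = cscale c1 (mat 1)" by (rule optimal_self[OF f0 card w(1)])
  obtain c2 where c2: "c2 \<noteq> 0" "w2 = cscale c2 (mat 1)" by (rule optimal_self[OF f0 card w(2)])
  have "w1 ** cscale (1 / c1) (mat 1) = mat 1" "cscale (1 / c1) (mat 1) ** w1 = mat 1"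
    using c1 by simp_all
  then have "det w1 \<noteq> 0" unfolding invertible_det_nz[symmetric] invertible_def by blast
  moreover have "trace (adj w1 ** w2) \<noteq> 0"
    using c1 c2 by (simp add: adj_cscale trace_I)
  ultimately show False using zero by simp
qed

lemma ambiguous_saturated:
  assumes card: "CARD('n) = CARD('k) * m"
    and f: "f \<in> (matrix_homs :: ('k::finite cmat \<Rightarrow> 'n::finite cmat) set)" and g: "g \<in> ambiguous f0"
    and range: "range f = range g"
  shows "f \<in> ambiguous f0"
proof -
  have "g \<in> matrix_homs" using g by (simp add: ambiguous_def)
  then obtain u where u: "u \<in> unitary_group" and gu: "g = (\<lambda>x. f (u ** x ** adj u))"
    using matrix_hom_same_range[OF _ f card] range by (metis order_refl)
  obtain w1 w2 where w: "w1 \<in> optimal f0 g" "w2 \<in> optimal f0 g"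
    and zero: "trace (adj w1 ** w2) * det w1 = 0" using g by (auto simp: ambiguous_def)
  have "adj (u ** w1) ** (u ** w2) = adj w1 ** (adj u ** u) ** w2"
    by (simp only: adj_mult matrix_mul_assoc)
  then have "trace (adj (u ** w1) ** (u ** w2)) * det (u ** w1) = trace (adj w1 ** w2) * (det u * det w1)"
    by (simp add: unitaryD u det_mul)
  also have "\<dots> = 0" using zero by auto
  finally show ?thesis
    using w f optimal_precomp[OF f u] unfolding ambiguous_def gu by blast
qed

text \<open>Otherwise the component of one optimal matrix orthogonal to the other would, after scaling, be
  optimal as well.\<close>

lemma optimal_unique_up_to_phase:
  assumes f: "f \<in> matrix_homs" "f \<notin> ambiguous f0" and w: "w1 \<in> optimal f0 f" "w2 \<in> optimal f0 f"
  obtains z where "cmod z = 1" "w2 = cscale z w1"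
proof -
  define z where "z = trace (adj w1 ** w2)"
  have n: "norm w1 = 1" "norm w2 = 1" using w by (simp_all add: optimal_def)
  have "w2 = cscale z w1"
  proof (rule ccontr)
    assume "w2 \<noteq> cscale z w1"
    then have n0: "norm (w2 - cscale z w1) \<noteq> 0" by simp
    define r where "r = norm (w2 - cscale z w1)"
    define w where "w = cscale (of_real (1 / r)) (w2 - cscale z w1)"
    have "norm w = 1" using n0 unfolding w_def norm_cscale r_def by (simp add: norm_divide)
    moreover have w': "w = cscale (- (of_real (1 / r) * z)) w1 + cscale (of_real (1 / r)) w2"
      by (simp add: w_def cmat_eq_iff algebra_simps)
    ultimately have "w \<in> optimal f0 f"
      using optimal_combination[OF f(1) w] by metis
    moreover have "trace (adj w1 ** w) = 0"
      by (simp add: w_def cmat_distribs trace_sub trace_adj_mult_self n z_def[symmetric])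
    ultimately have "f \<in> ambiguous f0"
      using f(1) w(1) unfolding ambiguous_def by fastforce
    with f(2) show False by simp
  qed
  moreover from this n have "cmod z = 1" by (metis norm_cscale mult.right_neutral)
  ultimately show thesis using that by blast
qed

text \<open>Translate by the unitary part of an optimal matrix.\<close>

lemma normalized_exists:
  fixes f f0 :: "'k::finite cmat \<Rightarrow> 'n::finite cmat"
  assumes f: "f \<in> matrix_homs"
  shows "\<exists>g \<in> normalized f0. range g = range f"
proof -
  obtain w where w: "w \<in> optimal f0 f" using optimal_nonempty[OF f] by blast
  obtain u where u: "u \<in> unitary_group" "trace_maximal (adj u ** w)" by (rule polar_decomposition)
  have "u ** (adj u ** w) = w" by (simp add: matrix_mul_assoc unitaryD u)
  then have "adj u ** w \<in> optimal f0 (\<lambda>x. f (u ** x ** adj u))"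
    using optimal_precomp[OF f u(1)] w by simp
  then have "(\<lambda>x. f (u ** x ** adj u)) \<in> normalized f0"
    using u precomp_conj_matrix_hom[OF f u(1)] by (auto simp: normalized_def)
  then show ?thesis using range_precomp_conj[OF u(1), of f] by blast
qed

text \<open>Two normalized homomorphisms in one orbit differ by a unitary \<open>u\<close> that carries one positive
  optimal matrix to a multiple of the other by a phase. By uniqueness of the polar decomposition \<open>u\<close>
  is a scalar, and conjugation by it is trivial.\<close>

lemma normalized_unique:
  assumes card: "CARD('n) = CARD('k) * m"
    and f: "f \<in> normalized f0" and g: "g \<in> normalized f0" and range: "range g = range f"
    and amb: "f \<notin> ambiguous (f0 :: 'k::finite cmat \<Rightarrow> 'n::finite cmat)"
  shows "g = f"
proof -
  have fX: "f \<in> matrix_homs" and gX: "g \<in> matrix_homs" using f g by (simp_all add: normalized_def)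
  obtain u where u: "u \<in> unitary_group" and gu: "g = (\<lambda>x. f (u ** x ** adj u))"
    using matrix_hom_same_range[OF gX fX card] range by (metis order_refl)
  obtain h1 where h1: "h1 \<in> optimal f0 f" "trace_maximal h1" using f by (auto simp: normalized_def)
  obtain h2 where h2: "h2 \<in> optimal f0 g" "trace_maximal h2" using g by (auto simp: normalized_def)
  have uh2: "u ** h2 \<in> optimal f0 f" using h2(1) optimal_precomp[OF fX u] unfolding gu by blast
  obtain z where z: "cmod z = 1" "h1 = cscale z (u ** h2)"
    by (rule optimal_unique_up_to_phase[OF fX amb uh2 h1(1)])
  have zz: "z * cnj z = 1" using z(1) complex_norm_square[of z] by simp
  have "det (u ** h2) \<noteq> 0" using amb fX uh2 unfolding ambiguous_def by auto
  then have "invertible h2" by (simp add: det_mul invertible_det_nz)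
  moreover have "trace_maximal (cscale z u ** h2)" using h1(2) z(2) by simp
  ultimately have "cscale z u = mat 1"
    using h2(2) polar_unique unitary_cscale[OF u z(1)] by blast
  moreover have "u = cscale (cnj z) (cscale z u)" using zz by (simp add: mult.commute)
  ultimately have "u = cscale (cnj z) (mat 1)" by simp
  then have "u ** x ** adj u = x" for x using zz by (simp add: adj_cscale mult.commute)
  then show ?thesis by (simp add: gu)
qed

text \<open>The orbit map from homomorphisms to subalgebras has local sections: over the complement of the
  ambiguous subalgebras every fibre contains exactly one normalized homomorphism. The section is
  continuous because the normalized homomorphisms form a closed set and the orbit map is closed, so
  that preimages of closed sets under the section are closed. A formula for the section would need the
  largest eigenvalue and a square root; compactness avoids both.\<close>

theorem Gr_local_section:
  fixes f0 :: "'k::finite cmat \<Rightarrow> ('k \<times> 'l::finite) cmat"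
  assumes f0: "f0 \<in> matrix_homs"
  obtains V \<sigma> where "openin Gr V" "range f0 \<in> V" "continuous_map (subtopology Gr V) hom_space \<sigma>"
    "\<And>S. S \<in> V \<Longrightarrow> range (\<sigma> S :: 'k cmat \<Rightarrow> ('k \<times> 'l) cmat) = S"
proof -
  note card = card_prod_multiplicity[where 'k = 'k and 'l = 'l]
  define V where "V = topspace Gr - range ` ambiguous f0"
  have V: "openin Gr V"
    unfolding V_def using closedin_ambiguous[OF card f0] closed_map_range_Gr unfolding closed_map_def
    by (intro openin_diff) auto
  have f0V: "range f0 \<in> V"
  proof -
    have "range f0 \<in> topspace Gr" unfolding topspace_Gr k_subalgebras_eq_ranges using f0 by (rule imageI)
    moreover have "range f0 \<notin> range ` ambiguous f0"
    proof
      assume "range f0 \<in> range ` ambiguous f0"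
      then obtain g where "g \<in> ambiguous f0" "range f0 = range g" by (elim imageE)
      then show False using ambiguous_saturated[OF card f0] self_not_ambiguous[OF card f0] by blast
    qed
    ultimately show ?thesis by (simp add: V_def)
  qed
  have ex: "\<exists>f. f \<in> normalized f0 \<and> range f = S" if "S \<in> V" for S
  proof -
    from that have "S \<in> range ` (matrix_homs :: ('k cmat \<Rightarrow> ('k \<times> 'l) cmat) set)"
      by (simp add: V_def topspace_Gr flip: k_subalgebras_eq_ranges)
    then obtain g where "g \<in> (matrix_homs :: ('k cmat \<Rightarrow> ('k \<times> 'l) cmat) set)" "S = range g" by (elim imageE)
    then show ?thesis using normalized_exists[of g f0] by auto
  qed
  define \<sigma> where "\<sigma> S = (SOME f. f \<in> normalized f0 \<and> range f = S)" for S
  have \<sigma>: "\<sigma> S \<in> normalized f0" "range (\<sigma> S) = S" if "S \<in> V" for S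
    using someI_ex[OF ex[OF that]] by (simp_all add: \<sigma>_def)
  have uniq: "f = \<sigma> S" if "S \<in> V" "f \<in> normalized f0" "range f = S" for f S
  proof -
    have "\<sigma> S \<notin> ambiguous f0"
      using \<sigma>(2)[OF that(1)] that(1) unfolding V_def by (metis DiffE imageI)
    then show ?thesis
      using normalized_unique[OF card \<sigma>(1)[OF that(1)] that(2)] \<sigma>(2)[OF that(1)] that(3) by simp
  qed
  have top: "topspace (subtopology Gr V) = V" using openin_subset[OF V] by auto
  have nX: "normalized f0 \<subseteq> matrix_homs" by (auto simp: normalized_def)
  have cont: "continuous_map (subtopology Gr V) hom_space \<sigma>"
    unfolding continuous_map_closedin top
  proof (intro conjI allI impI)
    show "\<sigma> \<in> V \<rightarrow> topspace hom_space" using \<sigma>(1) nX by auto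
    fix C :: "('k cmat \<Rightarrow> ('k \<times> 'l) cmat) set" assume "closedin hom_space C"
    then have "closedin hom_space (normalized f0 \<inter> C)"
      by (intro closedin_Int closedin_normalized[OF card f0])
    then have "closedin Gr (range ` (normalized f0 \<inter> C))"
      using closed_map_range_Gr unfolding closed_map_def by blast
    moreover have "{S \<in> V. \<sigma> S \<in> C} = range ` (normalized f0 \<inter> C) \<inter> V"
    proof (intro equalityI subsetI)
      fix S assume "S \<in> {S \<in> V. \<sigma> S \<in> C}"
      then show "S \<in> range ` (normalized f0 \<inter> C) \<inter> V"
        using \<sigma>[of S] by (intro IntI image_eqI[of _ _ "\<sigma> S"]) simp_all
    next
      fix S assume S: "S \<in> range ` (normalized f0 \<inter> C) \<inter> V"
      then have "S \<in> range ` (normalized f0 \<inter> C)" by (rule IntD1)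
      then obtain f where f: "f \<in> normalized f0 \<inter> C" "S = range f" by (elim imageE)
      have SV: "S \<in> V" using S by (rule IntD2)
      have "f = \<sigma> S" by (rule uniq[OF SV IntD1[OF f(1)] f(2)[symmetric]])
      then have "\<sigma> S \<in> C" using IntD2[OF f(1)] by (simp only:)
      with SV show "S \<in> {S \<in> V. \<sigma> S \<in> C}" by (simp only: mem_Collect_eq simp_thms)
    qed
    ultimately show "closedin (subtopology Gr V) {S \<in> V. \<sigma> S \<in> C}"
      unfolding closedin_subtopology by blast
  qed
  show thesis by (rule that[OF V f0V cont \<sigma>(2)])
qed

section \<open>Maps into and out of final topologies\<close>

lemma continuous_map_locally:
  assumes "\<And>y. y \<in> topspace Y \<Longrightarrow> \<exists>N. openin Y N \<and> y \<in> N \<and> continuous_map (subtopology Y N) Z F"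
  shows "continuous_map Y Z F"
proof (rule pasting_lemma[where I = "{N. openin Y N \<and> continuous_map (subtopology Y N) Z F}" and T = "\<lambda>N. N" and f = "\<lambda>_. F"])
  fix y assume "y \<in> topspace Y"
  then show "\<exists>j. j \<in> {N. openin Y N \<and> continuous_map (subtopology Y N) Z F} \<and> y \<in> j \<and> F y = F y"
    using assms by blast
qed auto

lemma continuous_map_into_final_topology:
  assumes "\<And>X f. (X, f) \<in> F \<Longrightarrow> f ` topspace X \<subseteq> S" and "(X, f) \<in> F"
  shows "continuous_map X (final_topology S F) f"
proof -
  have top: "topspace (final_topology S F) = S" by (rule topspace_final_topology[OF assms(1)])
  show ?thesis
    unfolding continuous_map_def top using assms by (auto simp: openin_final_topology)
qed

lemma continuous_map_from_final_subtopology: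
  assumes "\<And>X f. (X, f) \<in> F \<Longrightarrow> f ` topspace X \<subseteq> S" and N: "openin (final_topology S F) N"
    and cont: "\<And>X f. (X, f) \<in> F \<Longrightarrow> continuous_map (subtopology X {x \<in> topspace X. f x \<in> N}) Z (\<lambda>x. g (f x))"
    and g: "\<And>p. p \<in> N \<Longrightarrow> g p \<in> topspace Z"
  shows "continuous_map (subtopology (final_topology S F) N) Z g"
proof -
  have top: "topspace (final_topology S F) = S" by (rule topspace_final_topology[OF assms(1)])
  have NS: "N \<subseteq> S" using openin_subset[OF N] top by simp
  show ?thesis
    unfolding continuous_map_def
  proof (intro conjI allI impI)
    fix V assume V: "openin Z V"
    have "openin (final_topology S F) {p \<in> N. g p \<in> V}"
      unfolding openin_final_topology
    proof (intro conjI ballI, use NS in blast, clarify)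
      fix X f assume Xf: "(X, f) \<in> F"
      let ?W = "{x \<in> topspace X. f x \<in> N}"
      have "openin X ?W" using N Xf unfolding openin_final_topology by blast
      moreover have "openin (subtopology X ?W) {x \<in> topspace (subtopology X ?W). g (f x) \<in> V}"
        by (rule openin_continuous_map_preimage[OF cont[OF Xf] V])
      ultimately have "openin X {x \<in> topspace (subtopology X ?W). g (f x) \<in> V}"
        by (rule openin_trans_full[rotated])
      also have "{x \<in> topspace (subtopology X ?W). g (f x) \<in> V} = {x \<in> topspace X. f x \<in> {p \<in> N. g p \<in> V}}"
        by auto
      finally show "openin X {x \<in> topspace X. f x \<in> {p \<in> N. g p \<in> V}}" .
    qed
    moreover have "{p \<in> topspace (subtopology (final_topology S F) N). g p \<in> V} = {p \<in> N. g p \<in> V} \<inter> N"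
      using NS by (auto simp: top)
    ultimately show "openin (subtopology (final_topology S F) N)
        {p \<in> topspace (subtopology (final_topology S F) N). g p \<in> V}"
      unfolding openin_subtopology by blast
  qed (use g in auto)
qed

section \<open>Bundles of matrix algebras and of their homomorphisms\<close>

lemma local_trivializationD:
  assumes "(U, c) \<in> local_trivializations A"
  shows "openin (ab_base A) U" "\<And>x. x \<in> U \<Longrightarrow> x \<in> topspace (ab_base A)"
    "\<And>x. x \<in> U \<Longrightarrow> c x \<in> star_isos cmat_algebra (ab_fibre A x)"
    "\<And>x. x \<in> U \<Longrightarrow> inj (c x)" "\<And>x. x \<in> U \<Longrightarrow> range (c x) = sa_carrier (ab_fibre A x)"
    "homeomorphic_map (prod_topology (subtopology (ab_base A) U) euclidean)
      (subtopology (ab_total A) (U \<times> UNIV)) (\<lambda>(x, T). (x, c x T))"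
proof -
  show U: "openin (ab_base A) U"
    "homeomorphic_map (prod_topology (subtopology (ab_base A) U) euclidean)
      (subtopology (ab_total A) (U \<times> UNIV)) (\<lambda>(x, T). (x, c x T))"
    and c: "\<And>x. x \<in> U \<Longrightarrow> c x \<in> star_isos cmat_algebra (ab_fibre A x)"
    using assms unfolding local_trivializations_def by blast+
  show "\<And>x. x \<in> U \<Longrightarrow> x \<in> topspace (ab_base A)" using openin_subset[OF U(1)] by blast
  show "\<And>x. x \<in> U \<Longrightarrow> inj (c x)" "\<And>x. x \<in> U \<Longrightarrow> range (c x) = sa_carrier (ab_fibre A x)"
    using c unfolding star_isos_def bij_betw_def by auto
qed

lemma continuous_map_fibre_coordinate:
  fixes c :: "'b \<Rightarrow> 'k::finite cmat \<Rightarrow> 'a"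
  assumes c: "(U, c) \<in> local_trivializations A" and W: "continuous_map Y (ab_total A) W"
    and U: "\<And>y. y \<in> topspace Y \<Longrightarrow> fst (W y) \<in> U"
  shows "continuous_map Y euclidean (\<lambda>y. inv (c (fst (W y))) (snd (W y)))"
proof -
  let ?X = "prod_topology (subtopology (ab_base A) U) (euclidean :: 'k cmat topology)"
  let ?E = "subtopology (ab_total A) (U \<times> UNIV)"
  note hm = local_trivializationD(6)[OF c]
  obtain g where g: "homeomorphic_maps ?X ?E (\<lambda>(x, T). (x, c x T)) g"
    using hm unfolding homeomorphic_map_maps by blast
  have W': "continuous_map Y ?E W"
    using W U by (auto simp: continuous_map_in_subtopology mem_Times_iff)
  then have "continuous_map Y euclidean (snd \<circ> (g \<circ> W))"
    using g unfolding homeomorphic_maps_def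
    by (intro continuous_map_compose[OF _ continuous_map_snd] continuous_map_compose) auto
  then show ?thesis
  proof (rule continuous_map_eq)
    fix y assume "y \<in> topspace Y"
    then have "W y \<in> topspace ?E" using W' by (auto simp: continuous_map_def)
    then have "W y \<in> (\<lambda>(x, T). (x, c x T)) ` topspace ?X"
      using homeomorphic_imp_surjective_map[OF hm] by simp
    then obtain x T where xT: "x \<in> U" "(x, T) \<in> topspace ?X" "W y = (x, c x T)" by auto
    have "g (x, c x T) = (x, T)" using g xT(2) unfolding homeomorphic_maps_def by auto
    then show "(snd \<circ> (g \<circ> W)) y = inv (c (fst (W y))) (snd (W y))"
      using xT local_trivializationD(4)[OF c xT(1)] by simp
  qed
qed

lemma continuous_map_into_total:
  fixes c :: "'b \<Rightarrow> 'k::finite cmat \<Rightarrow> 'a"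
  assumes c: "(U, c) \<in> local_trivializations A" and X: "continuous_map Y (ab_base A) X"
    and U: "\<And>y. y \<in> topspace Y \<Longrightarrow> X y \<in> U" and T: "continuous_map Y euclidean T"
  shows "continuous_map Y (ab_total A) (\<lambda>y. (X y, c (X y) (T y)))"
proof -
  have "continuous_map Y (prod_topology (subtopology (ab_base A) U) euclidean) (\<lambda>y. (X y, T y))"
    using X U T by (auto simp: continuous_map_paired continuous_map_in_subtopology)
  then have "continuous_map Y (subtopology (ab_total A) (U \<times> UNIV)) ((\<lambda>(x, T). (x, c x T)) \<circ> (\<lambda>y. (X y, T y)))"
    by (rule continuous_map_compose) (rule homeomorphic_imp_continuous_map[OF local_trivializationD(6)[OF c]])
  then show ?thesis by (simp add: continuous_map_in_subtopology o_def)
qed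

definition H_chart :: "('b, 'a) algebra_bundle \<Rightarrow> ('b \<Rightarrow> 'k::finite cmat \<Rightarrow> 'a) \<Rightarrow>
    'b \<times> ('k cmat \<Rightarrow> ('k \<times> 'l::finite) cmat) \<Rightarrow> 'b \<times> ('a \<Rightarrow> ('k \<times> 'l) cmat)"
  where "H_chart A c = (\<lambda>(x, f). (x, compose (sa_carrier (ab_fibre A x)) f (inv (c x))))"

lemma hom_in_coordinates:
  fixes h :: "'a \<Rightarrow> 'n::finite cmat" and c :: "'k::finite cmat \<Rightarrow> 'a"
  assumes h: "h \<in> star_homs F cmat_algebra" and c: "c \<in> star_isos cmat_algebra F"
  shows "h \<circ> c \<in> matrix_homs" "compose (sa_carrier F) (h \<circ> c) (inv c) = h"
    "range (h \<circ> c) = h ` sa_carrier F"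
proof -
  have bij: "inj c" "range c = sa_carrier F" and cF: "\<And>T. c T \<in> sa_carrier F"
    using c unfolding star_isos_def bij_betw_def by auto
  show "h \<circ> c \<in> matrix_homs"
    using h c cF unfolding matrix_homs_iff star_isos_def star_homs_def by (simp add: Pi_iff)
  show "compose (sa_carrier F) (h \<circ> c) (inv c) = h"
  proof
    fix v show "compose (sa_carrier F) (h \<circ> c) (inv c) v = h v"
      using h bij unfolding star_homs_def
      by (cases "v \<in> sa_carrier F") (simp_all add: compose_def f_inv_into_f PiE_def extensional_def)
  qed
  show "range (h \<circ> c) = h ` sa_carrier F" by (simp only: image_comp[symmetric] bij(2))
qed

lemma hom_from_coordinates:
  fixes f :: "'k::finite cmat \<Rightarrow> 'n::finite cmat" and c :: "'k cmat \<Rightarrow> 'a"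
  assumes f: "f \<in> matrix_homs" and c: "c \<in> star_isos cmat_algebra F"
  shows "compose (sa_carrier F) f (inv c) \<in> star_homs F cmat_algebra"
    "compose (sa_carrier F) f (inv c) \<circ> c = f"
    "compose (sa_carrier F) f (inv c) (c T) = f T"
proof -
  have bij: "inj c" "range c = sa_carrier F" and cF: "\<And>T. c T \<in> sa_carrier F"
    using c unfolding star_isos_def bij_betw_def by auto
  show val: "compose (sa_carrier F) f (inv c) (c T) = f T" for T
    by (simp add: compose_def cF bij(1))
  then show "compose (sa_carrier F) f (inv c) \<circ> c = f" by (simp add: fun_eq_iff)
  have hom: "sa_add F (c x) (c y) = c (x + y)" "sa_scale F a (c x) = c (cscale a x)"
      "sa_mult F (c x) (c y) = c (x ** y)" "sa_star F (c x) = c (adj x)" "sa_one F = c (mat 1)" for a x y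
    using c unfolding star_isos_def star_homs_def by simp_all
  show "compose (sa_carrier F) f (inv c) \<in> star_homs F cmat_algebra"
    unfolding star_homs_def
  proof (intro CollectI conjI ballI allI)
    show "compose (sa_carrier F) f (inv c) \<in> sa_carrier F \<rightarrow>\<^sub>E sa_carrier cmat_algebra"
      by (auto simp: compose_def)
  qed (auto simp: bij(2)[symmetric] hom matrix_homD[OF f] val[unfolded bij(2)[symmetric]])
qed

lemma H_bundle_charts:
  fixes A :: "('b, 'a) algebra_bundle"
  shows "(H_bundle A :: ('b \<times> ('a \<Rightarrow> ('k::finite \<times> 'l::finite) cmat)) topology) =
    final_topology (SIGMA x : topspace (ab_base A). star_homs (ab_fibre A x) cmat_algebra)
      {(prod_topology (subtopology (ab_base A) U) hom_space, H_chart A c) | U c.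
        (U, c :: 'b \<Rightarrow> 'k cmat \<Rightarrow> 'a) \<in> local_trivializations A}"
  unfolding H_bundle_def H_chart_def ..

lemma H_chart_image:
  fixes c :: "'b \<Rightarrow> 'k::finite cmat \<Rightarrow> 'a"
  assumes "(U, c) \<in> local_trivializations A"
  shows "(H_chart A c :: _ \<Rightarrow> _ \<times> (_ \<Rightarrow> ('k \<times> 'l::finite) cmat)) ` topspace (prod_topology (subtopology (ab_base A) U) hom_space)
    \<subseteq> (SIGMA x : topspace (ab_base A). star_homs (ab_fibre A x) cmat_algebra)"
  by (auto simp: H_chart_def intro!: hom_from_coordinates(1) local_trivializationD(2,3)[OF assms])

lemma topspace_H_bundle:
  "topspace (H_bundle A :: ('b \<times> ('a \<Rightarrow> ('k::finite \<times> 'l::finite) cmat)) topology) =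
    (SIGMA x : topspace (ab_base A). star_homs (ab_fibre A x) cmat_algebra)"
  unfolding H_bundle_charts by (rule topspace_final_topology) (use H_chart_image in fast)

lemma continuous_map_from_H_bundle:
  fixes A :: "('b, 'a) algebra_bundle" and P :: "('b \<times> ('a \<Rightarrow> ('k::finite \<times> 'l::finite) cmat)) topology"
  defines "P \<equiv> H_bundle A"
  assumes "openin P N"
    and "\<And>U c. (U, c :: 'b \<Rightarrow> 'k cmat \<Rightarrow> 'a) \<in> local_trivializations A \<Longrightarrow>
      continuous_map (subtopology (prod_topology (subtopology (ab_base A) U) hom_space)
        {z \<in> topspace (prod_topology (subtopology (ab_base A) U) hom_space). H_chart A c z \<in> N}) Z (\<lambda>z. g (H_chart A c z))"
    and "\<And>p. p \<in> N \<Longrightarrow> g p \<in> topspace Z"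
  shows "continuous_map (subtopology P N) Z g"
  unfolding P_def H_bundle_charts
proof (rule continuous_map_from_final_subtopology)
  show "openin (final_topology (SIGMA x : topspace (ab_base A). star_homs (ab_fibre A x) cmat_algebra)
      {(prod_topology (subtopology (ab_base A) U) hom_space, H_chart A c) | U c.
        (U, c :: 'b \<Rightarrow> 'k cmat \<Rightarrow> 'a) \<in> local_trivializations A}) N"
    using assms(2) unfolding P_def H_bundle_charts .
qed (use assms(3,4) H_chart_image in fast)+

lemma continuous_map_H_bundle_fst:
  "continuous_map (H_bundle A :: ('b \<times> ('a \<Rightarrow> ('k::finite \<times> 'l::finite) cmat)) topology) (ab_base A) fst"
proof -
  let ?P = "H_bundle A :: ('b \<times> ('a \<Rightarrow> ('k \<times> 'l) cmat)) topology"
  have "continuous_map (subtopology ?P (topspace ?P)) (ab_base A) fst"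
  proof (rule continuous_map_from_H_bundle)
    fix U and c :: "'b \<Rightarrow> 'k cmat \<Rightarrow> 'a"
    let ?X = "prod_topology (subtopology (ab_base A) U) (hom_space :: ('k cmat \<Rightarrow> ('k \<times> 'l) cmat) topology)"
    have "continuous_map ?X (ab_base A) fst"
      using continuous_map_fst continuous_map_into_fulltopology by blast
    then have sub: "continuous_map (subtopology ?X N) (ab_base A) fst" for N
      by (rule continuous_map_from_subtopology)
    have *: "fst (H_chart A c z) = fst z" for z
      by (simp add: H_chart_def case_prod_unfold)
    show "continuous_map (subtopology ?X {z \<in> topspace ?X. H_chart A c z \<in> topspace ?P}) (ab_base A)
        (\<lambda>z. fst (H_chart A c z))"
      unfolding * by (rule sub)
    show "openin ?P (topspace ?P)" by simp
  qed (auto simp: topspace_H_bundle)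
  then show ?thesis by simp
qed

lemma continuous_map_into_H_bundle_chart:
  fixes c :: "'b \<Rightarrow> 'k::finite cmat \<Rightarrow> 'a"
  assumes c: "(U, c) \<in> local_trivializations A" and X: "continuous_map Y (ab_base A) X"
    and U: "\<And>y. y \<in> topspace Y \<Longrightarrow> X y \<in> U" and F: "continuous_map Y hom_space F"
  shows "continuous_map Y (H_bundle A) (\<lambda>y. H_chart A c (X y, F y :: _ \<Rightarrow> ('k \<times> 'l::finite) cmat))"
proof -
  let ?X = "prod_topology (subtopology (ab_base A) U) (hom_space :: ('k cmat \<Rightarrow> ('k \<times> 'l) cmat) topology)"
  have "continuous_map ?X (H_bundle A) (H_chart A c)"
    unfolding H_bundle_charts
    by (rule continuous_map_into_final_topology) (use c H_chart_image in fast)+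
  moreover have "continuous_map Y ?X (\<lambda>y. (X y, F y))"
    using X U F by (auto simp: continuous_map_paired continuous_map_in_subtopology)
  ultimately have "continuous_map Y (H_bundle A) (H_chart A c \<circ> (\<lambda>y. (X y, F y)))"
    by (intro continuous_map_compose)
  then show ?thesis by (simp add: o_def)
qed

lemma openin_H_bundle_over:
  assumes "openin (ab_base A) U"
  shows "openin (H_bundle A :: ('b \<times> ('a \<Rightarrow> ('k::finite \<times> 'l::finite) cmat)) topology)
    {z \<in> topspace (H_bundle A). fst z \<in> U}"
  by (rule openin_continuous_map_preimage[OF continuous_map_H_bundle_fst assms])

text \<open>The coordinates of the homomorphism bundle in a chart are continuous. The topology is final, so this
  has to be tested in every other chart, where the change of coordinates is continuous because it
  comes from the two trivializations of the algebra bundle. Together with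
  \<open>continuous_map_into_H_bundle_chart\<close> this makes the charts homeomorphisms.\<close>

lemma continuous_map_H_coordinate:
  fixes c :: "'b \<Rightarrow> 'k::finite cmat \<Rightarrow> 'a"
    and F :: "'y \<Rightarrow> 'b \<times> ('a \<Rightarrow> ('k \<times> 'l::finite) cmat)"
  assumes c: "(U, c) \<in> local_trivializations A" and F: "continuous_map Y (H_bundle A) F"
    and U: "\<And>y. y \<in> topspace Y \<Longrightarrow> fst (F y) \<in> U"
  shows "continuous_map Y hom_space (\<lambda>y. snd (F y) \<circ> c (fst (F y)))"
proof -
  let ?P = "H_bundle A :: ('b \<times> ('a \<Rightarrow> ('k \<times> 'l) cmat)) topology"
  let ?N = "{z \<in> topspace ?P. fst z \<in> U}"
  have "continuous_map (subtopology ?P ?N) hom_space (\<lambda>z. snd z \<circ> c (fst z))"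
    unfolding continuous_map_into_functions_iff
  proof (intro conjI allI)
    show "(\<lambda>z. snd z \<circ> c (fst z)) \<in> topspace (subtopology ?P ?N) \<rightarrow> matrix_homs"
      by (auto simp: topspace_H_bundle intro!: hom_in_coordinates(1)[OF _ local_trivializationD(3)[OF c]])
    fix T
    show "continuous_map (subtopology ?P ?N) euclidean (\<lambda>z. (snd z \<circ> c (fst z)) T)"
    proof (rule continuous_map_from_H_bundle)
      show "openin ?P ?N" by (rule openin_H_bundle_over[OF local_trivializationD(1)[OF c]])
      fix V and d :: "'b \<Rightarrow> 'k cmat \<Rightarrow> 'a" assume d: "(V, d) \<in> local_trivializations A"
      let ?X = "prod_topology (subtopology (ab_base A) V) (hom_space :: ('k cmat \<Rightarrow> ('k \<times> 'l) cmat) topology)"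
      let ?X' = "subtopology ?X {z \<in> topspace ?X. H_chart A d z \<in> ?N}"
      have top: "fst z \<in> V" "fst z \<in> U" "snd z \<in> matrix_homs" if "z \<in> topspace ?X'" for z
        using that by (auto simp: H_chart_def)
      have "continuous_map ?X (ab_base A) fst"
        using continuous_map_fst continuous_map_into_fulltopology by blast
      then have base: "continuous_map ?X' (ab_base A) fst"
        by (rule continuous_map_from_subtopology)
      have "continuous_map ?X' (ab_total A) (\<lambda>z. (fst z, c (fst z) T))"
        by (rule continuous_map_into_total[OF c base]) (use top in auto)
      then have "continuous_map ?X' euclidean (\<lambda>z. inv (d (fst (fst z, c (fst z) T))) (snd (fst z, c (fst z) T)))"
        by (rule continuous_map_fibre_coordinate[OF d]) (use top in auto)
      then have "continuous_map ?X' euclidean (\<lambda>z. snd z (inv (d (fst z)) (c (fst z) T)))"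
        unfolding fst_conv snd_conv
        by (rule continuous_map_hom_eval[rotated]) (rule continuous_map_from_subtopology[OF continuous_map_snd])
      then show "continuous_map ?X' euclidean (\<lambda>z. (snd (H_chart A d z) \<circ> c (fst (H_chart A d z))) T)"
      proof (rule continuous_map_eq)
        fix z assume z: "z \<in> topspace ?X'"
        have "c (fst z) T \<in> sa_carrier (ab_fibre A (fst z))"
          using local_trivializationD(5)[OF c top(2)[OF z]] by auto
        then show "snd z (inv (d (fst z)) (c (fst z) T)) = (snd (H_chart A d z) \<circ> c (fst (H_chart A d z))) T"
          by (simp add: H_chart_def case_prod_unfold compose_def)
      qed
    qed simp
  qed
  moreover have "continuous_map Y (subtopology ?P ?N) F"
    using F U continuous_map_funspace[OF F] by (auto simp: continuous_map_in_subtopology Pi_iff)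
  ultimately have "continuous_map Y hom_space ((\<lambda>z. snd z \<circ> c (fst z)) \<circ> F)"
    by (intro continuous_map_compose)
  then show ?thesis by (simp add: o_def)
qed

lemma obtain_local_trivialization:
  assumes "matrix_bundle TYPE('k::finite) A" "x \<in> topspace (ab_base A)"
  obtains U and c :: "'b \<Rightarrow> 'k::finite cmat \<Rightarrow> 'a" where "(U, c) \<in> local_trivializations A" "x \<in> U"
  using assms unfolding matrix_bundle_def by blast

text \<open>This lemma and the next characterize the homomorphism bundle without charts: evaluation of
  homomorphisms on the fibres of the algebra bundle is continuous, and a map into the bundle is
  continuous as soon as its evaluation on local families of algebra elements is. Both are stated for
  maps from an arbitrary space \<open>Y\<close>, so that fibre products need not be mentioned.\<close>

lemma continuous_map_H_eval:
  fixes A :: "('b, 'a) algebra_bundle" and F :: "'y \<Rightarrow> 'b \<times> ('a \<Rightarrow> ('k::finite \<times> 'l::finite) cmat)"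
  assumes A: "matrix_bundle TYPE('k) A" and F: "continuous_map Y (H_bundle A) F"
    and W: "continuous_map Y (ab_total A) W"
    and same: "\<And>y. y \<in> topspace Y \<Longrightarrow> fst (W y) = fst (F y)"
  shows "continuous_map Y euclidean (\<lambda>y. snd (F y) (snd (W y)))"
proof (rule continuous_map_locally)
  fix y assume y: "y \<in> topspace Y"
  have base: "continuous_map Y (ab_base A) (fst \<circ> F)"
    by (rule continuous_map_compose[OF F continuous_map_H_bundle_fst])
  then have "fst (F y) \<in> topspace (ab_base A)" using y by (auto simp: continuous_map_def)
  then obtain U and c :: "'b \<Rightarrow> 'k cmat \<Rightarrow> 'a" where c: "(U, c) \<in> local_trivializations A" "fst (F y) \<in> U"
    by (rule obtain_local_trivialization[OF A])
  let ?N = "{y \<in> topspace Y. (fst \<circ> F) y \<in> U}"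
  have F': "continuous_map (subtopology Y ?N) (H_bundle A) F"
    and W': "continuous_map (subtopology Y ?N) (ab_total A) W"
    by (intro continuous_map_from_subtopology F W)+
  have "continuous_map (subtopology Y ?N) hom_space (\<lambda>y. snd (F y) \<circ> c (fst (F y)))"
    by (rule continuous_map_H_coordinate[OF c(1) F']) auto
  moreover have "continuous_map (subtopology Y ?N) euclidean (\<lambda>y. inv (c (fst (W y))) (snd (W y)))"
    by (rule continuous_map_fibre_coordinate[OF c(1) W']) (use same in auto)
  ultimately have "continuous_map (subtopology Y ?N) euclidean
      (\<lambda>y. (snd (F y) \<circ> c (fst (F y))) (inv (c (fst (W y))) (snd (W y))))"
    by (rule continuous_map_hom_eval)
  then have "continuous_map (subtopology Y ?N) euclidean (\<lambda>y. snd (F y) (snd (W y)))"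
  proof (rule continuous_map_eq)
    fix y assume "y \<in> topspace (subtopology Y ?N)"
    then have y: "y \<in> topspace Y" "fst (F y) \<in> U" by auto
    have "W y \<in> topspace (ab_total A)" using W y(1) by (auto simp: continuous_map_def)
    then have "snd (W y) \<in> sa_carrier (ab_fibre A (fst (W y)))"
      using A unfolding matrix_bundle_def by (auto simp: mem_Times_iff)
    then have "snd (W y) \<in> range (c (fst (F y)))"
      using local_trivializationD(5)[OF c(1) y(2)] same[OF y(1)] by simp
    then show "(snd (F y) \<circ> c (fst (F y))) (inv (c (fst (W y))) (snd (W y))) = snd (F y) (snd (W y))"
      by (simp add: same[OF y(1)] f_inv_into_f)
  qed
  moreover have "openin Y ?N"
    by (rule openin_continuous_map_preimage[OF base local_trivializationD(1)[OF c(1)]])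
  ultimately show "\<exists>N. openin Y N \<and> y \<in> N \<and> continuous_map (subtopology Y N) euclidean (\<lambda>y. snd (F y) (snd (W y)))"
    using y c(2) by (intro exI[of _ ?N]) simp
qed

text \<open>It suffices to evaluate on the constant sections of local trivializations, since the fibre of the
  bundle carries the topology of pointwise convergence.\<close>

lemma continuous_map_into_H_bundle:
  fixes A :: "('b, 'a) algebra_bundle" and h :: "'y \<Rightarrow> 'a \<Rightarrow> ('k::finite \<times> 'l::finite) cmat"
  assumes A: "matrix_bundle TYPE('k) A" and X: "continuous_map Y (ab_base A) X"
    and h: "\<And>y. y \<in> topspace Y \<Longrightarrow> h y \<in> star_homs (ab_fibre A (X y)) cmat_algebra"
    and eval: "\<And>N w. openin Y N \<Longrightarrow> continuous_map (subtopology Y N) (ab_total A) (\<lambda>y. (X y, w y)) \<Longrightarrow>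
      continuous_map (subtopology Y N) euclidean (\<lambda>y. h y (w y))"
  shows "continuous_map Y (H_bundle A) (\<lambda>y. (X y, h y))"
proof (rule continuous_map_locally)
  fix y assume y: "y \<in> topspace Y"
  then have "X y \<in> topspace (ab_base A)" using X by (auto simp: continuous_map_def)
  then obtain U and c :: "'b \<Rightarrow> 'k cmat \<Rightarrow> 'a" where c: "(U, c) \<in> local_trivializations A" "X y \<in> U"
    by (rule obtain_local_trivialization[OF A])
  let ?N = "{y \<in> topspace Y. X y \<in> U}"
  have N: "openin Y ?N"
    by (rule openin_continuous_map_preimage[OF X local_trivializationD(1)[OF c(1)]])
  have X': "continuous_map (subtopology Y ?N) (ab_base A) X"
    by (rule continuous_map_from_subtopology[OF X])
  have "continuous_map (subtopology Y ?N) euclidean (\<lambda>y. h y (c (X y) T))" for T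
    by (rule eval[OF N continuous_map_into_total[OF c(1) X']]) auto
  then have "continuous_map (subtopology Y ?N) hom_space (\<lambda>y. h y \<circ> c (X y))"
    unfolding continuous_map_into_functions_iff
    by (auto intro!: hom_in_coordinates(1)[OF h local_trivializationD(3)[OF c(1)]])
  then have "continuous_map (subtopology Y ?N) (H_bundle A) (\<lambda>y. H_chart A c (X y, h y \<circ> c (X y)))"
    by (intro continuous_map_into_H_bundle_chart[OF c(1) X']) auto
  then have "continuous_map (subtopology Y ?N) (H_bundle A) (\<lambda>y. (X y, h y))"
  proof (rule continuous_map_eq)
    fix y assume "y \<in> topspace (subtopology Y ?N)"
    then show "H_chart A c (X y, h y \<circ> c (X y)) = (X y, h y)"
      using hom_in_coordinates(2)[OF h[of y] local_trivializationD(3)[OF c(1)]] by (simp add: H_chart_def)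
  qed
  with N y c(2) show "\<exists>N. openin Y N \<and> y \<in> N \<and> continuous_map (subtopology Y N) (H_bundle A) (\<lambda>y. (X y, h y))"
    by (intro exI[of _ ?N]) simp
qed

lemma H_hom_inj_on:
  fixes A :: "('b, 'a) algebra_bundle" and h :: "'a \<Rightarrow> ('k::finite \<times> 'l::finite) cmat"
  assumes A: "matrix_bundle TYPE('k) A" and x: "x \<in> topspace (ab_base A)"
    and h: "h \<in> star_homs (ab_fibre A x) cmat_algebra"
  shows "inj_on h (sa_carrier (ab_fibre A x))"
proof -
  obtain U and c :: "'b \<Rightarrow> 'k cmat \<Rightarrow> 'a" where c: "(U, c) \<in> local_trivializations A" "x \<in> U"
    using x by (rule obtain_local_trivialization[OF A])
  have "inj (h \<circ> c x)"
    using hom_in_coordinates(1)[OF h local_trivializationD(3)[OF c]] card_prod_multiplicity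
    by (rule matrix_hom_inj)
  then show ?thesis
    using local_trivializationD(5)[OF c] by (metis inj_on_imageI)
qed

text \<open>The inverse of a homomorphism on its image varies continuously: in coordinates it is
  \<open>hom_retraction\<close>.\<close>

lemma continuous_map_H_inverse:
  fixes A :: "('b, 'a) algebra_bundle" and F :: "'y \<Rightarrow> 'b \<times> ('a \<Rightarrow> ('k::finite \<times> 'l::finite) cmat)"
  assumes A: "matrix_bundle TYPE('k) A" and F: "continuous_map Y (H_bundle A) F"
    and T: "continuous_map Y euclidean T"
    and im: "\<And>y. y \<in> topspace Y \<Longrightarrow> T y \<in> snd (F y) ` sa_carrier (ab_fibre A (fst (F y)))"
  shows "continuous_map Y (ab_total A)
    (\<lambda>y. (fst (F y), inv_into (sa_carrier (ab_fibre A (fst (F y)))) (snd (F y)) (T y)))"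
    (is "continuous_map Y _ ?G")
proof (rule continuous_map_locally)
  fix y assume y: "y \<in> topspace Y"
  have base: "continuous_map Y (ab_base A) (fst \<circ> F)"
    by (rule continuous_map_compose[OF F continuous_map_H_bundle_fst])
  then have "fst (F y) \<in> topspace (ab_base A)" using y by (auto simp: continuous_map_def)
  then obtain U and c :: "'b \<Rightarrow> 'k cmat \<Rightarrow> 'a" where c: "(U, c) \<in> local_trivializations A" "fst (F y) \<in> U"
    by (rule obtain_local_trivialization[OF A])
  let ?N = "{y \<in> topspace Y. (fst \<circ> F) y \<in> U}"
  have F': "continuous_map (subtopology Y ?N) (H_bundle A) F"
    and T': "continuous_map (subtopology Y ?N) euclidean T"
    and X': "continuous_map (subtopology Y ?N) (ab_base A) (\<lambda>y. fst (F y))"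
    using base by (auto intro!: continuous_map_from_subtopology F T simp: o_def)
  have "continuous_map (subtopology Y ?N) hom_space (\<lambda>y. snd (F y) \<circ> c (fst (F y)))"
    by (rule continuous_map_H_coordinate[OF c(1) F']) auto
  then have "continuous_map (subtopology Y ?N) euclidean (\<lambda>y. hom_retraction (snd (F y) \<circ> c (fst (F y))) (T y))"
    using T' by (rule continuous_map_hom_retraction)
  then have "continuous_map (subtopology Y ?N) (ab_total A)
      (\<lambda>y. (fst (F y), c (fst (F y)) (hom_retraction (snd (F y) \<circ> c (fst (F y))) (T y))))"
    by (intro continuous_map_into_total[OF c(1) X']) auto
  then have "continuous_map (subtopology Y ?N) (ab_total A) ?G"
  proof (rule continuous_map_eq)
    fix y assume "y \<in> topspace (subtopology Y ?N)"
    then have y: "y \<in> topspace Y" "fst (F y) \<in> U" by auto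
    obtain x h where xh: "F y = (x, h)" by fastforce
    have "F y \<in> topspace (H_bundle A)" using continuous_map_funspace[OF F] y(1) by (rule funcset_mem)
    then have "(x, h) \<in> topspace (H_bundle A)" unfolding xh .
    then have x: "x \<in> topspace (ab_base A)" and h: "h \<in> star_homs (ab_fibre A x) cmat_algebra"
      by (simp_all add: topspace_H_bundle)
    have xU: "x \<in> U" using y(2) xh by simp
    note cx = local_trivializationD(3,5)[OF c(1) xU]
    have "T y \<in> range (h \<circ> c x)" using im[OF y(1)] xh hom_in_coordinates(3)[OF h cx(1)] by simp
    then obtain a where a: "T y = h (c x a)" by auto
    have "hom_retraction (h \<circ> c x) ((h \<circ> c x) a) = a"
      by (rule hom_retraction_apply[OF hom_in_coordinates(1)[OF h cx(1)] card_prod_multiplicity])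
    moreover have "inv_into (sa_carrier (ab_fibre A x)) h (h (c x a)) = c x a"
      by (rule inv_into_f_f[OF H_hom_inj_on[OF A x h]]) (use cx(2) in auto)
    ultimately show "(fst (F y), c (fst (F y)) (hom_retraction (snd (F y) \<circ> c (fst (F y))) (T y))) = ?G y"
      by (simp add: xh a)
  qed
  moreover have "openin Y ?N"
    by (rule openin_continuous_map_preimage[OF base local_trivializationD(1)[OF c(1)]])
  ultimately show "\<exists>N. openin Y N \<and> y \<in> N \<and> continuous_map (subtopology Y N) (ab_total A) ?G"
    using y c(2) by (intro exI[of _ ?N]) simp
qed

text \<open>In coordinates the moment map is the quotient map onto \<open>Gr\<close>.\<close>

lemma continuous_map_moment_map:
  fixes A :: "('b, 'a) algebra_bundle"
  assumes A: "matrix_bundle TYPE('k::finite) A"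
  shows "continuous_map (H_bundle A) Gr (moment_map A :: 'b \<times> ('a \<Rightarrow> ('k \<times> 'l::finite) cmat) \<Rightarrow> _)"
proof (rule continuous_map_locally)
  let ?P = "H_bundle A :: ('b \<times> ('a \<Rightarrow> ('k \<times> 'l) cmat)) topology"
  fix y assume y: "y \<in> topspace ?P"
  then have "fst y \<in> topspace (ab_base A)" by (auto simp: topspace_H_bundle)
  then obtain U and c :: "'b \<Rightarrow> 'k cmat \<Rightarrow> 'a" where c: "(U, c) \<in> local_trivializations A" "fst y \<in> U"
    by (rule obtain_local_trivialization[OF A])
  let ?N = "{y \<in> topspace ?P. fst y \<in> U}"
  have "continuous_map (subtopology ?P ?N) hom_space (\<lambda>y. snd y \<circ> c (fst y))"
    by (rule continuous_map_H_coordinate[OF c(1) continuous_map_from_subtopology[OF continuous_map_id[unfolded id_def]]]) auto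
  then have "continuous_map (subtopology ?P ?N) Gr (range \<circ> (\<lambda>y. snd y \<circ> c (fst y)))"
    by (rule continuous_map_compose[OF _ quotient_imp_continuous_map[OF quotient_map_range_Gr]])
  then have "continuous_map (subtopology ?P ?N) Gr (moment_map A)"
  proof (rule continuous_map_eq)
    fix y assume "y \<in> topspace (subtopology ?P ?N)"
    then have "fst y \<in> U" "snd y \<in> star_homs (ab_fibre A (fst y)) cmat_algebra"
      by (auto simp: topspace_H_bundle)
    then show "(range \<circ> (\<lambda>y. snd y \<circ> c (fst y))) y = moment_map A y"
      using hom_in_coordinates(3)[of "snd y" "ab_fibre A (fst y)" "c (fst y)"] local_trivializationD(3)[OF c(1)]
      by (simp add: moment_map_def case_prod_unfold)
  qed
  with y c(2) openin_H_bundle_over[OF local_trivializationD(1)[OF c(1)]]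
  show "\<exists>N. openin ?P N \<and> y \<in> N \<and> continuous_map (subtopology ?P N) Gr (moment_map A)"
    by (intro exI[of _ ?N]) simp
qed

section \<open>The tautological bundle\<close>

lemma tautological_bundle_simps [simp]:
  "ab_base tautological_bundle = Gr" "ab_fibre tautological_bundle = cmat_subalgebra"
  by (simp_all add: tautological_bundle_def)

lemma continuous_map_tautological_total:
  "continuous_map Y (ab_total tautological_bundle) (\<lambda>y. (S y, T y)) \<longleftrightarrow>
    continuous_map Y Gr S \<and> continuous_map Y euclidean T \<and> (\<forall>y\<in>topspace Y. T y \<in> S y)"
  by (auto simp: tautological_bundle_def continuous_map_in_subtopology continuous_map_paired)

text \<open>A local section of the orbit map assigns to each subalgebra an isomorphism from \<open>M\<^sub>k\<close>, which is a
  local trivialization. Its inverse is continuous by the formula for \<open>hom_retraction\<close>.\<close>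

lemma tautological_matrix_bundle:
  "matrix_bundle TYPE('k::finite) (tautological_bundle ::
    (('k \<times> 'l::finite) cmat set, ('k \<times> 'l) cmat) algebra_bundle)"
proof -
  let ?E = "tautological_bundle :: (('k \<times> 'l) cmat set, ('k \<times> 'l) cmat) algebra_bundle"
  have "\<exists>(V, \<sigma> :: ('k \<times> 'l) cmat set \<Rightarrow> 'k cmat \<Rightarrow> ('k \<times> 'l) cmat) \<in> local_trivializations ?E. S \<in> V"
    if S: "S \<in> topspace Gr" for S
  proof -
    have "S \<in> range ` (matrix_homs :: ('k cmat \<Rightarrow> ('k \<times> 'l) cmat) set)"
      using S unfolding topspace_Gr k_subalgebras_eq_ranges .
    then obtain f0 where f0: "f0 \<in> (matrix_homs :: ('k cmat \<Rightarrow> ('k \<times> 'l) cmat) set)" "S = range f0"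
      by (elim imageE)
    obtain V \<sigma> where V: "openin Gr V" "range f0 \<in> V" and cont: "continuous_map (subtopology Gr V) hom_space \<sigma>"
      and ran: "\<And>S. S \<in> V \<Longrightarrow> range (\<sigma> S :: 'k cmat \<Rightarrow> ('k \<times> 'l) cmat) = S"
      by (rule Gr_local_section[OF f0(1)]) blast
    have top: "topspace (subtopology Gr V) = V" using openin_subset[OF V(1)] by auto
    have hom: "\<sigma> S \<in> matrix_homs" if "S \<in> V" for S
      using continuous_map_funspace[OF cont] that unfolding top by auto
    let ?X = "prod_topology (subtopology Gr V) (euclidean :: 'k cmat topology)"
    let ?Y = "subtopology (ab_total ?E) (V \<times> UNIV)"
    \<comment> \<open>the retraction inverts \<open>\<sigma> S\<close> on \<open>S\<close>, its image\<close>
    have "homeomorphic_maps ?X ?Y (\<lambda>(S, T). (S, \<sigma> S T)) (\<lambda>(S, T). (S, hom_retraction (\<sigma> S) T))"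
      unfolding homeomorphic_maps_def
    proof (intro conjI ballI)
      have fst: "continuous_map ?X (subtopology Gr V) fst" by (rule continuous_map_fst)
      have \<sigma>: "continuous_map ?X hom_space (\<lambda>z. \<sigma> (fst z))"
        using continuous_map_compose[OF fst cont] by (simp add: o_def)
      have "continuous_map ?X (ab_total ?E) (\<lambda>z. (fst z, \<sigma> (fst z) (snd z)))"
        unfolding continuous_map_tautological_total
      proof (intro conjI ballI)
        show "continuous_map ?X Gr fst" using fst by (rule continuous_map_into_fulltopology)
        show "continuous_map ?X euclidean (\<lambda>z. \<sigma> (fst z) (snd z))"
          by (rule continuous_map_hom_eval[OF \<sigma> continuous_map_snd])
        fix z assume "z \<in> topspace ?X"
        then have "fst z \<in> V" by auto
        from ran[OF this] show "\<sigma> (fst z) (snd z) \<in> fst z" by (metis rangeI)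
      qed
      then show "continuous_map ?X ?Y (\<lambda>(S, T). (S, \<sigma> S T))"
        by (auto simp: continuous_map_in_subtopology case_prod_unfold)
      have fst': "continuous_map ?Y Gr fst" and snd': "continuous_map ?Y euclidean snd"
        using continuous_map_id[of "ab_total ?E"] continuous_map_tautological_total[of "ab_total ?E" fst snd]
        by (auto intro: continuous_map_from_subtopology)
      have fst'': "continuous_map ?Y (subtopology Gr V) fst"
        using fst' by (auto simp: continuous_map_in_subtopology)
      have "continuous_map ?Y hom_space (\<lambda>z. \<sigma> (fst z))"
        using continuous_map_compose[OF fst'' cont] by (simp add: o_def)
      then show "continuous_map ?Y ?X (\<lambda>(S, T). (S, hom_retraction (\<sigma> S) T))"
        unfolding case_prod_unfold using fst'' snd'
        by (intro continuous_map_pairedI continuous_map_hom_retraction)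
    next
      fix z assume "z \<in> topspace ?X"
      then have "fst z \<in> V" by auto
      then show "(case (case z of (S, T) \<Rightarrow> (S, \<sigma> S T)) of (S, T) \<Rightarrow> (S, hom_retraction (\<sigma> S) T)) = z"
        by (simp add: case_prod_unfold hom_retraction_apply[OF hom card_prod_multiplicity])
    next
      fix z assume "z \<in> topspace ?Y"
      then have z: "fst z \<in> V" "snd z \<in> fst z" by (auto simp: tautological_bundle_def)
      then obtain a where "snd z = \<sigma> (fst z) a" using ran[OF z(1)] by (metis rangeE)
      then show "(case (case z of (S, T) \<Rightarrow> (S, hom_retraction (\<sigma> S) T)) of (S, T) \<Rightarrow> (S, \<sigma> S T)) = z"
        by (simp add: case_prod_unfold hom_retraction_apply[OF hom[OF z(1)] card_prod_multiplicity] prod_eq_iff)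
    qed
    then have "homeomorphic_map ?X ?Y (\<lambda>(S, T). (S, \<sigma> S T))"
      by (rule homeomorphic_maps_imp_map)
    moreover have "\<sigma> S \<in> star_isos cmat_algebra (cmat_subalgebra S)" if "S \<in> V" for S
      unfolding star_isos_cmat_subalgebra_iff using hom[OF that] ran[OF that] by (rule conjI)
    ultimately have "(V, \<sigma>) \<in> local_trivializations ?E"
      unfolding local_trivializations_def using V(1) by simp
    then show ?thesis using V(2) unfolding f0(2) by blast
  qed
  moreover have "topspace (ab_total ?E) = (SIGMA x : topspace (ab_base ?E). sa_carrier (ab_fibre ?E x))"
    by (auto simp: tautological_bundle_def)
  ultimately show ?thesis unfolding matrix_bundle_def by simp
qed

abbreviation arrow_space ::
    "(('k::finite \<times> 'l::finite) cmat set \<times> (('k \<times> 'l) cmat \<Rightarrow> ('k \<times> 'l) cmat)) topology"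
  where "arrow_space \<equiv> H_bundle tautological_bundle"

lemma topspace_arrow_space:
  "topspace arrow_space = (SIGMA S : k_subalgebras. star_homs (cmat_subalgebra S) cmat_algebra)"
  by (simp add: topspace_H_bundle topspace_Gr)

section \<open>Composition and division of homomorphisms\<close>

text \<open>The arrow that carries \<open>z'\<close> to \<open>z\<close>, when both lie over the same base point. Inverses in the groupoid
  are a special case (\<open>inverse_eq_division\<close>).\<close>

definition H_division :: "('b, 'a) algebra_bundle \<Rightarrow> 'b \<times> ('a \<Rightarrow> ('k::finite \<times> 'l::finite) cmat) \<Rightarrow>
    'b \<times> ('a \<Rightarrow> ('k \<times> 'l) cmat) \<Rightarrow> ('k \<times> 'l) cmat set \<times> (('k \<times> 'l) cmat \<Rightarrow> ('k \<times> 'l) cmat)"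
  where "H_division A z z' = (moment_map A z',
    restrict (snd z \<circ> inv_into (sa_carrier (ab_fibre A (fst z'))) (snd z')) (moment_map A z'))"

lemma moment_map_apply: "moment_map A z = snd z ` sa_carrier (ab_fibre A (fst z))"
  by (simp add: moment_map_def case_prod_unfold)

lemma H_action_apply: "H_action A g z = (fst z, compose (sa_carrier (ab_fibre A (fst z))) (snd g) (snd z))"
  by (simp add: H_action_def case_prod_unfold)

lemma matrix_bundle_fibre:
  assumes "matrix_bundle TYPE('k::finite) A" "x \<in> topspace (ab_base A)"
  obtains c :: "'k::finite cmat \<Rightarrow> 'a" where "c \<in> star_isos cmat_algebra (ab_fibre A x)"
proof -
  obtain U and c :: "'b \<Rightarrow> 'k cmat \<Rightarrow> 'a" where "(U, c) \<in> local_trivializations A" "x \<in> U"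
    by (rule obtain_local_trivialization[OF assms])
  then show thesis by (intro that) (rule local_trivializationD(3))
qed

lemma H_action_hom:
  assumes g: "g \<in> star_homs (cmat_subalgebra S) cmat_algebra" and h: "h \<in> star_homs F cmat_algebra"
    and S: "S = h ` sa_carrier F" and c: "c \<in> star_isos cmat_algebra F"
  shows "compose (sa_carrier F) g h \<in> star_homs F cmat_algebra"
proof -
  define f where "f = h \<circ> c"
  have f: "f \<in> matrix_homs" and fS: "\<And>a. f a \<in> S"
    using hom_in_coordinates(1,3)[OF h c] S unfolding f_def by auto
  have "g \<circ> f \<in> matrix_homs"
    using g fS unfolding matrix_homs_iff star_homs_def
    by (simp add: matrix_homD[OF f])
  then have "compose (sa_carrier F) (g \<circ> f) (inv c) \<in> star_homs F cmat_algebra"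
    using c by (rule hom_from_coordinates(1))
  also have "compose (sa_carrier F) (g \<circ> f) (inv c) = compose (sa_carrier F) g h"
    using c unfolding star_isos_def bij_betw_def by (auto simp: compose_def f_def fun_eq_iff f_inv_into_f)
  finally show ?thesis .
qed

text \<open>Transport along an isomorphism \<open>c\<close> from \<open>M\<^sub>k\<close> reduces the algebraic identities to those of the
  matrix homomorphisms \<open>h \<circ> c\<close> and \<open>h' \<circ> c\<close>; the fibre \<open>F\<close> itself comes without axioms.\<close>

lemma H_division_hom:
  fixes h :: "'a \<Rightarrow> ('k::finite \<times> 'l::finite) cmat" and c :: "'k cmat \<Rightarrow> 'a"
  assumes h': "h' \<in> star_homs F cmat_algebra" and h: "h \<in> star_homs F cmat_algebra"
    and inj: "inj_on h (sa_carrier F)" and c: "c \<in> star_isos cmat_algebra F"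
  shows "restrict (h' \<circ> inv_into (sa_carrier F) h) (h ` sa_carrier F)
    \<in> star_homs (cmat_subalgebra (h ` sa_carrier F)) (cmat_algebra :: ('k \<times> 'l) cmat star_algebra)"
    (is "?k \<in> _")
proof -
  have f: "h \<circ> c \<in> matrix_homs" and f': "h' \<circ> c \<in> matrix_homs" and ran: "h ` sa_carrier F = range (h \<circ> c)"
    using hom_in_coordinates(1,3)[OF h c] hom_in_coordinates(1)[OF h' c] by auto
  have cF: "c a \<in> sa_carrier F" for a using c unfolding star_isos_def bij_betw_def by auto
  have k: "?k ((h \<circ> c) a) = (h' \<circ> c) a" for a
    using cF[of a] by (simp add: inv_into_f_f[OF inj])
  have "(\<forall>x\<in>range (h \<circ> c). \<forall>y\<in>range (h \<circ> c). ?k (x + y) = ?k x + ?k y) \<and>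
      (\<forall>a. \<forall>x\<in>range (h \<circ> c). ?k (cscale a x) = cscale a (?k x)) \<and>
      (\<forall>x\<in>range (h \<circ> c). \<forall>y\<in>range (h \<circ> c). ?k (x ** y) = ?k x ** ?k y) \<and>
      (\<forall>x\<in>range (h \<circ> c). ?k (adj x) = adj (?k x)) \<and> ?k (mat 1) = mat 1"
  proof (intro conjI allI ballI)
    fix x y a assume "x \<in> range (h \<circ> c)" "y \<in> range (h \<circ> c)"
    then obtain p q where pq: "x = (h \<circ> c) p" "y = (h \<circ> c) q" by (elim rangeE)
    show "?k (x + y) = ?k x + ?k y" "?k (x ** y) = ?k x ** ?k y"
      unfolding pq matrix_homD(1,3)[OF f, symmetric] k by (rule matrix_homD[OF f'])+
  next
    fix a x assume "x \<in> range (h \<circ> c)"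
    then obtain p where p: "x = (h \<circ> c) p" by (elim rangeE)
    show "?k (cscale a x) = cscale a (?k x)" "?k (adj x) = adj (?k x)"
      unfolding p matrix_homD(2,4)[OF f, symmetric] k by (rule matrix_homD[OF f'])+
  next
    show "?k (mat 1) = mat 1"
      unfolding matrix_homD(5)[OF f, symmetric] k by (simp only: matrix_homD(5)[OF f'] matrix_homD(5)[OF f])
  qed
  then show ?thesis unfolding star_homs_def ran by simp
qed

text \<open>Composition is continuous since its evaluation is evaluation of \<open>h\<close> followed by evaluation of
  \<open>g\<close>. For the tautological bundle this is the continuity of the groupoid multiplication.\<close>

lemma continuous_map_H_action:
  fixes A :: "('b, 'a) algebra_bundle" and h :: "'y \<Rightarrow> 'b \<times> ('a \<Rightarrow> ('k::finite \<times> 'l::finite) cmat)"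
  assumes A: "matrix_bundle TYPE('k) A" and g: "continuous_map Y arrow_space g"
    and h: "continuous_map Y (H_bundle A) h"
    and same: "\<And>y. y \<in> topspace Y \<Longrightarrow> fst (g y) = moment_map A (h y)"
  shows "continuous_map Y (H_bundle A) (\<lambda>y. H_action A (g y) (h y))"
  unfolding H_action_apply
proof (rule continuous_map_into_H_bundle[OF A])
  show X: "continuous_map Y (ab_base A) (\<lambda>y. fst (h y))"
    using continuous_map_compose[OF h continuous_map_H_bundle_fst] by (simp add: o_def)
  have mem: "fst (h y) \<in> topspace (ab_base A)" "snd (h y) \<in> star_homs (ab_fibre A (fst (h y))) cmat_algebra"
      "snd (g y) \<in> star_homs (cmat_subalgebra (fst (g y))) cmat_algebra" if "y \<in> topspace Y" for y
    using funcset_mem[OF continuous_map_funspace[OF h] that] funcset_mem[OF continuous_map_funspace[OF g] that]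
    by (auto simp: topspace_H_bundle)
  show "compose (sa_carrier (ab_fibre A (fst (h y)))) (snd (g y)) (snd (h y))
      \<in> star_homs (ab_fibre A (fst (h y))) cmat_algebra" if y: "y \<in> topspace Y" for y
  proof -
    obtain c :: "'k cmat \<Rightarrow> 'a" where "c \<in> star_isos cmat_algebra (ab_fibre A (fst (h y)))"
      by (rule matrix_bundle_fibre[OF A mem(1)[OF y]])
    then show ?thesis
      by (rule H_action_hom[OF mem(3,2)[OF y] same[OF y, unfolded moment_map_apply]])
  qed
  fix N w
  let ?Y = "subtopology Y N"
  assume w: "continuous_map ?Y (ab_total A) (\<lambda>y. (fst (h y), w y))"
  have hN: "continuous_map ?Y (H_bundle A) h" and gN: "continuous_map ?Y arrow_space g"
    by (intro continuous_map_from_subtopology h g)+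
  have wF: "w y \<in> sa_carrier (ab_fibre A (fst (h y)))" if "y \<in> topspace ?Y" for y
    using funcset_mem[OF continuous_map_funspace[OF w] that] A unfolding matrix_bundle_def by auto
  have "continuous_map ?Y euclidean (\<lambda>y. snd (h y) (w y))"
    using continuous_map_H_eval[OF A hN w] by simp
  moreover have "continuous_map ?Y Gr (\<lambda>y. fst (g y))"
    using continuous_map_compose[OF gN continuous_map_H_bundle_fst] by (simp add: o_def)
  moreover have "\<forall>y\<in>topspace ?Y. snd (h y) (w y) \<in> fst (g y)"
    using wF same by (auto simp: moment_map_apply)
  ultimately have "continuous_map ?Y (ab_total tautological_bundle) (\<lambda>y. (fst (g y), snd (h y) (w y)))"
    by (simp add: continuous_map_tautological_total)
  then have "continuous_map ?Y euclidean (\<lambda>y. snd (g y) (snd (h y) (w y)))"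
    using continuous_map_H_eval[OF tautological_matrix_bundle gN] by fastforce
  then show "continuous_map ?Y euclidean
      (\<lambda>y. compose (sa_carrier (ab_fibre A (fst (h y)))) (snd (g y)) (snd (h y)) (w y))"
    by (rule continuous_map_eq) (simp add: compose_def wF)
qed

text \<open>Division is evaluated by applying the inverse of \<open>h\<close> and then \<open>h'\<close>.\<close>

lemma continuous_map_H_division:
  fixes A :: "('b, 'a) algebra_bundle" and h h' :: "'y \<Rightarrow> 'b \<times> ('a \<Rightarrow> ('k::finite \<times> 'l::finite) cmat)"
  assumes A: "matrix_bundle TYPE('k) A" and h': "continuous_map Y (H_bundle A) h'"
    and h: "continuous_map Y (H_bundle A) h"
    and same: "\<And>y. y \<in> topspace Y \<Longrightarrow> fst (h' y) = fst (h y)"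
  shows "continuous_map Y arrow_space (\<lambda>y. H_division A (h' y) (h y))"
  unfolding H_division_def
proof (rule continuous_map_into_H_bundle[OF tautological_matrix_bundle])
  show "continuous_map Y (ab_base tautological_bundle) (\<lambda>y. moment_map A (h y))"
    using continuous_map_compose[OF h continuous_map_moment_map[OF A]] by (simp add: o_def)
  show "restrict (snd (h' y) \<circ> inv_into (sa_carrier (ab_fibre A (fst (h y)))) (snd (h y))) (moment_map A (h y))
      \<in> star_homs (ab_fibre tautological_bundle (moment_map A (h y))) cmat_algebra" if y: "y \<in> topspace Y" for y
  proof -
    have mem: "fst (h y) \<in> topspace (ab_base A)" "snd (h y) \<in> star_homs (ab_fibre A (fst (h y))) cmat_algebra"
        "snd (h' y) \<in> star_homs (ab_fibre A (fst (h y))) cmat_algebra"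
      using funcset_mem[OF continuous_map_funspace[OF h] y] funcset_mem[OF continuous_map_funspace[OF h'] y] same[OF y]
      by (auto simp: topspace_H_bundle)
    obtain c :: "'k cmat \<Rightarrow> 'a" where "c \<in> star_isos cmat_algebra (ab_fibre A (fst (h y)))"
      by (rule matrix_bundle_fibre[OF A mem(1)])
    then show ?thesis
      unfolding tautological_bundle_simps moment_map_apply
      by (rule H_division_hom[OF mem(3,2) H_hom_inj_on[OF A mem(1,2)]])
  qed
  fix N w
  let ?Y = "subtopology Y N"
  assume "continuous_map ?Y (ab_total tautological_bundle) (\<lambda>y. (moment_map A (h y), w y))"
  then have w: "continuous_map ?Y euclidean w" "\<And>y. y \<in> topspace ?Y \<Longrightarrow> w y \<in> moment_map A (h y)"
    by (auto simp: continuous_map_tautological_total)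
  have hN: "continuous_map ?Y (H_bundle A) h" and hN': "continuous_map ?Y (H_bundle A) h'"
    by (intro continuous_map_from_subtopology h h')+
  have "continuous_map ?Y (ab_total A)
      (\<lambda>y. (fst (h y), inv_into (sa_carrier (ab_fibre A (fst (h y)))) (snd (h y)) (w y)))"
    by (rule continuous_map_H_inverse[OF A hN w(1)]) (use w(2) in \<open>simp add: moment_map_apply\<close>)
  then have "continuous_map ?Y euclidean
      (\<lambda>y. snd (h' y) (inv_into (sa_carrier (ab_fibre A (fst (h y)))) (snd (h y)) (w y)))"
    using continuous_map_H_eval[OF A hN'] same by fastforce
  then show "continuous_map ?Y euclidean (\<lambda>y. restrict (snd (h' y) \<circ>
      inv_into (sa_carrier (ab_fibre A (fst (h y)))) (snd (h y))) (moment_map A (h y)) (w y))"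
    by (rule continuous_map_eq) (use w(2) in simp)
qed

lemma H_action_division:
  assumes z': "z' \<in> topspace (H_bundle A)" and same: "fst z' = fst z" and inj: "inj_on (snd z) (sa_carrier (ab_fibre A (fst z)))"
  shows "H_action A (H_division A z' z) z = z'"
proof -
  have "snd z' \<in> extensional (sa_carrier (ab_fibre A (fst z)))"
    using z' same by (auto simp: topspace_H_bundle star_homs_def PiE_def)
  then have "compose (sa_carrier (ab_fibre A (fst z))) (snd (H_division A z' z)) (snd z) = snd z'"
    by (auto simp: fun_eq_iff compose_def H_division_def moment_map_apply inv_into_f_f[OF inj] extensional_def)
  then show ?thesis by (simp add: H_action_apply prod_eq_iff same)
qed

lemma H_division_action:
  assumes g: "g \<in> topspace arrow_space" and S: "fst g = moment_map A z"
    and inj: "inj_on (snd z) (sa_carrier (ab_fibre A (fst z)))"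
  shows "H_division A (H_action A g z) z = g"
proof -
  have "snd g \<in> extensional (moment_map A z)"
    using g S by (auto simp: topspace_H_bundle star_homs_def PiE_def)
  then have "snd (H_division A (H_action A g z) z) = snd g"
    by (auto simp: fun_eq_iff compose_def H_division_def H_action_apply moment_map_apply extensional_def
        inv_into_f_f[OF inj])
  then show ?thesis by (simp add: H_division_def prod_eq_iff S)
qed

lemma moment_map_H_action:
  "fst g = moment_map A z \<Longrightarrow> moment_map A (H_action A g z) = snd g ` fst g"
  by (simp add: moment_map_apply H_action_apply compose_def image_image)

section \<open>Local triviality\<close>

text \<open>The typical fibre has to live on the points of the total space, so the fibre over the chosen base
  point takes the place of the space of homomorphisms.\<close>

lemma locally_trivial_H_bundle:
  fixes A :: "('b, 'a) algebra_bundle"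
  assumes A: "matrix_bundle TYPE('k::finite) A"
  shows "locally_trivial (H_bundle A :: ('b \<times> ('a \<Rightarrow> ('k \<times> 'l::finite) cmat)) topology) (ab_base A) H_proj"
  unfolding locally_trivial_def
proof (intro conjI ballI)
  let ?P = "H_bundle A :: ('b \<times> ('a \<Rightarrow> ('k \<times> 'l) cmat)) topology"
  show "H_proj ` topspace ?P \<subseteq> topspace (ab_base A)"
    by (auto simp: H_proj_def topspace_H_bundle)
  fix b assume "b \<in> topspace (ab_base A)"
  then obtain U and c :: "'b \<Rightarrow> 'k cmat \<Rightarrow> 'a" where c: "(U, c) \<in> local_trivializations A" and b: "b \<in> U"
    by (rule obtain_local_trivialization[OF A])
  let ?F = "subtopology ?P {z. fst z = b}"
  let ?PU = "subtopology ?P {z. H_proj z \<in> U}"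
  let ?UF = "prod_topology (subtopology (ab_base A) U) ?F"
  \<comment> \<open>parallel transport in the chart to the fibre over \<open>b\<close>, and back\<close>
  let ?\<psi> = "\<lambda>z. (fst z, H_chart A c (b, snd z \<circ> c (fst z)))"
  let ?\<chi> = "\<lambda>w. H_chart A c (fst w, snd (snd w) \<circ> c b)"
  have fst_chart: "fst (H_chart A c w) = fst w" for w :: "'b \<times> ('k cmat \<Rightarrow> ('k \<times> 'l) cmat)"
    by (simp add: H_chart_def case_prod_unfold)
  have id: "continuous_map ?PU ?P (\<lambda>z. z)"
    by (rule continuous_map_from_subtopology[OF continuous_map_id[unfolded id_def]])
  have base: "continuous_map ?PU (subtopology (ab_base A) U) fst"
    by (auto simp: continuous_map_in_subtopology H_proj_def
        intro: continuous_map_from_subtopology continuous_map_H_bundle_fst)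
  have "continuous_map ?PU hom_space (\<lambda>z. snd z \<circ> c (fst z))"
    by (rule continuous_map_H_coordinate[OF c id]) (simp add: H_proj_def)
  then have "continuous_map ?PU ?P (\<lambda>z. H_chart A c (b, snd z \<circ> c (fst z)))"
    by (rule continuous_map_into_H_bundle_chart[OF c, rotated 2]) (use b local_trivializationD(2)[OF c b] in auto)
  then have "continuous_map ?PU ?F (\<lambda>z. H_chart A c (b, snd z \<circ> c (fst z)))"
    by (auto simp: continuous_map_in_subtopology fst_chart)
  with base have \<psi>: "continuous_map ?PU ?UF ?\<psi>"
    by (rule continuous_map_pairedI)
  have snd': "continuous_map ?UF ?P snd"
    by (rule continuous_map_into_fulltopology[OF continuous_map_snd])
  have "continuous_map ?UF hom_space (\<lambda>w. snd (snd w) \<circ> c (fst (snd w)))"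
    by (rule continuous_map_H_coordinate[OF c snd']) (use b in auto)
  then have "continuous_map ?UF hom_space (\<lambda>w. snd (snd w) \<circ> c b)"
    by (rule continuous_map_eq) auto
  then have "continuous_map ?UF ?P ?\<chi>"
    by (rule continuous_map_into_H_bundle_chart[OF c, rotated 2])
      (auto intro: continuous_map_into_fulltopology[OF continuous_map_fst])
  then have \<chi>: "continuous_map ?UF ?PU ?\<chi>"
    by (auto simp: continuous_map_in_subtopology H_proj_def fst_chart)
  have "homeomorphic_maps ?PU ?UF ?\<psi> ?\<chi>"
    unfolding homeomorphic_maps_def
  proof (intro conjI ballI \<psi> \<chi>)
    fix z assume "z \<in> topspace ?PU"
    then have z: "fst z \<in> U" "snd z \<in> star_homs (ab_fibre A (fst z)) cmat_algebra"
      by (auto simp: topspace_H_bundle H_proj_def)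
    note cz = local_trivializationD(3)[OF c z(1)] and cb = local_trivializationD(3)[OF c b]
    show "?\<chi> (?\<psi> z) = z"
      using hom_from_coordinates(2)[OF hom_in_coordinates(1)[OF z(2) cz] cb] hom_in_coordinates(2)[OF z(2) cz]
      by (simp add: H_chart_def)
  next
    fix w assume "w \<in> topspace ?UF"
    then have w: "fst w \<in> U" "snd (snd w) \<in> star_homs (ab_fibre A b) cmat_algebra" "fst (snd w) = b"
      by (auto simp: topspace_H_bundle)
    note cw = local_trivializationD(3)[OF c w(1)] and cb = local_trivializationD(3)[OF c b]
    show "?\<psi> (?\<chi> w) = w"
      using hom_from_coordinates(2)[OF hom_in_coordinates(1)[OF w(2) cb] cw] hom_in_coordinates(2)[OF w(2) cb] w(3)
      by (simp add: H_chart_def prod_eq_iff)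
  qed
  then have "homeomorphic_map ?PU ?UF ?\<psi>"
    by (rule homeomorphic_maps_imp_map)
  moreover have "\<forall>x \<in> topspace ?P. H_proj x \<in> U \<longrightarrow> fst (?\<psi> x) = H_proj x"
    by (simp add: H_proj_def)
  ultimately show "\<exists>U (F :: ('b \<times> ('a \<Rightarrow> ('k \<times> 'l) cmat)) topology) \<psi>. openin (ab_base A) U \<and> b \<in> U \<and>
      homeomorphic_map (subtopology ?P {x. H_proj x \<in> U}) (prod_topology (subtopology (ab_base A) U) F) \<psi> \<and>
      (\<forall>x \<in> topspace ?P. H_proj x \<in> U \<longrightarrow> fst (\<psi> x) = H_proj x)"
    using local_trivializationD(1)[OF c] b by (intro exI[of _ U] exI[of _ ?F] exI[of _ ?\<psi>]) simp
qed

lemma H_proj_surjective: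
  fixes A :: "('b, 'a) algebra_bundle"
  assumes A: "matrix_bundle TYPE('k::finite) A"
  shows "H_proj ` topspace (H_bundle A :: ('b \<times> ('a \<Rightarrow> ('k \<times> 'l::finite) cmat)) topology) = topspace (ab_base A)"
proof (intro equalityI subsetI)
  fix x assume x: "x \<in> topspace (ab_base A)"
  obtain c :: "'k cmat \<Rightarrow> 'a" where c: "c \<in> star_isos cmat_algebra (ab_fibre A x)"
    by (rule matrix_bundle_fibre[OF A x])
  have "compose (sa_carrier (ab_fibre A x)) tensor_one (inv c) \<in> star_homs (ab_fibre A x) (cmat_algebra :: ('k \<times> 'l) cmat star_algebra)"
    by (rule hom_from_coordinates(1)[OF tensor_one_matrix_hom c])
  with x have "(x, compose (sa_carrier (ab_fibre A x)) tensor_one (inv c)) \<in> topspace (H_bundle A :: ('b \<times> ('a \<Rightarrow> ('k \<times> 'l) cmat)) topology)"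
    by (simp add: topspace_H_bundle)
  then show "x \<in> H_proj ` topspace (H_bundle A :: ('b \<times> ('a \<Rightarrow> ('k \<times> 'l) cmat)) topology)"
    by (rule image_eqI[rotated]) (simp add: H_proj_def)
qed (auto simp: H_proj_def topspace_H_bundle)

section \<open>The groupoid of subalgebras and its action\<close>

text \<open>The groupoid acts on itself: its arrow space is the homomorphism bundle of the tautological bundle,
  with the target as moment map and the composition as action. Its structure maps are therefore
  covered by the results for general bundles.\<close>

lemma subalgebra_groupoid_simps:
  "gr_objects subalgebra_groupoid = Gr" "gr_arrows subalgebra_groupoid = arrow_space"
  "gr_source subalgebra_groupoid = fst" "gr_target subalgebra_groupoid = moment_map tautological_bundle"
  "gr_comp subalgebra_groupoid = H_action tautological_bundle"
  "gr_ident subalgebra_groupoid = (\<lambda>S. (S, restrict id S))"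
  by (simp_all add: subalgebra_groupoid_def moment_map_def H_action_def fun_eq_iff case_prod_unfold)

lemma identity_arrow:
  assumes "S \<in> k_subalgebras"
  shows "restrict id S \<in> star_homs (cmat_subalgebra S) (cmat_algebra :: ('k::finite \<times> 'l::finite) cmat star_algebra)"
proof -
  have "unital_star_subalgebra cmat_algebra S"
    using assms unfolding k_subalgebras_def by blast
  then show ?thesis
    unfolding unital_star_subalgebra_def star_homs_def by auto
qed

lemma continuous_map_identity_arrow: "continuous_map Gr arrow_space (\<lambda>S. (S, restrict id S))"
proof (rule continuous_map_into_H_bundle[OF tautological_matrix_bundle])
  show "continuous_map Gr (ab_base tautological_bundle) (\<lambda>S. S)" by simp
  show "restrict id S \<in> star_homs (ab_fibre tautological_bundle S) cmat_algebra" if "S \<in> topspace Gr" for S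
    using that by (simp add: identity_arrow topspace_Gr)
  fix N w
  assume "continuous_map (subtopology Gr N) (ab_total tautological_bundle) (\<lambda>S. (S, w S))"
  then have w: "continuous_map (subtopology Gr N) euclidean w" "\<forall>S\<in>topspace (subtopology Gr N). w S \<in> S"
    unfolding continuous_map_tautological_total by blast+
  then show "continuous_map (subtopology Gr N) euclidean (\<lambda>S. restrict id S (w S))"
    by (elim continuous_map_eq) simp
qed

lemma inverse_eq_division:
  "gr_inverse subalgebra_groupoid g = H_division tautological_bundle (fst g, restrict id (fst g)) g"
  by (auto simp: subalgebra_groupoid_def H_division_def moment_map_apply case_prod_unfold fun_eq_iff
      inv_into_into)

lemma moment_map_H_division:
  assumes "fst z' = fst z"  "inj_on (snd z) (sa_carrier (ab_fibre A (fst z)))"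
  shows "snd (H_division A z' z) ` fst (H_division A z' z) = moment_map A z'"
proof -
  have "(snd z' \<circ> inv_into (sa_carrier (ab_fibre A (fst z))) (snd z)) ` (snd z ` sa_carrier (ab_fibre A (fst z)))
      = snd z' ` sa_carrier (ab_fibre A (fst z))"
    unfolding image_image comp_apply by (rule image_cong) (simp_all add: inv_into_f_f[OF assms(2)])
  then show ?thesis
    by (simp add: H_division_def moment_map_apply assms(1))
qed

lemma continuous_map_fibre_product:
  "continuous_map (fibre_product X Y f g) X fst" "continuous_map (fibre_product X Y f g) Y snd"
  unfolding fibre_product_def
  by (auto intro: continuous_map_from_subtopology continuous_map_fst continuous_map_snd)

lemma topspace_fibre_product:
  "z \<in> topspace (fibre_product X Y f g) \<longleftrightarrow> fst z \<in> topspace X \<and> snd z \<in> topspace Y \<and> f (fst z) = g (snd z)"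
  by (auto simp: fibre_product_def mem_Times_iff)

lemma H_action_identity:
  assumes "z \<in> topspace (H_bundle A)"
  shows "H_action A (moment_map A z, restrict id (moment_map A z)) z = z"
proof -
  have "snd z \<in> extensional (sa_carrier (ab_fibre A (fst z)))"
    using assms by (auto simp: topspace_H_bundle star_homs_def PiE_def)
  then show ?thesis
    by (auto simp: H_action_apply prod_eq_iff fun_eq_iff compose_def moment_map_apply extensional_def)
qed

lemma H_action_assoc:
  assumes "fst g' = moment_map A z"
  shows "H_action A (H_action tautological_bundle g g') z = H_action A g (H_action A g' z)"
  using assms by (auto simp: H_action_apply compose_def fun_eq_iff moment_map_apply)

lemma groupoid_action_H_action:
  fixes A :: "('b, 'a) algebra_bundle"
  assumes A: "matrix_bundle TYPE('k::finite) A"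
  shows "groupoid_action (subalgebra_groupoid :: (('k \<times> 'l::finite) cmat set, _) groupoid)
    (H_bundle A) (moment_map A) (H_action A)"
  unfolding groupoid_action_def Let_def subalgebra_groupoid_simps
proof (intro conjI ballI impI)
  let ?P = "H_bundle A :: ('b \<times> ('a \<Rightarrow> ('k \<times> 'l) cmat)) topology"
  show "continuous_map ?P Gr (moment_map A)"
    by (rule continuous_map_moment_map[OF A])
  show "continuous_map (fibre_product arrow_space ?P fst (moment_map A)) ?P
      (\<lambda>(g, h). H_action A g h)"
    unfolding case_prod_unfold
    by (rule continuous_map_H_action[OF A continuous_map_fibre_product]) (simp add: topspace_fibre_product)
qed (simp_all add: moment_map_H_action H_action_identity H_action_assoc moment_map_apply[of tautological_bundle])

lemma topological_groupoid_subalgebras: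
  "topological_groupoid (subalgebra_groupoid ::
    (('k::finite \<times> 'l::finite) cmat set, ('k \<times> 'l) cmat set \<times> (('k \<times> 'l) cmat \<Rightarrow> ('k \<times> 'l) cmat)) groupoid)"
proof -
  let ?T = "tautological_bundle :: (('k \<times> 'l) cmat set, ('k \<times> 'l) cmat) algebra_bundle"
  let ?e = "\<lambda>S :: ('k \<times> 'l) cmat set. (S, restrict (id :: ('k \<times> 'l) cmat \<Rightarrow> _) S)"
  let ?i = "\<lambda>g. H_division ?T (?e (fst g)) g"
  note T = tautological_matrix_bundle
  have s: "continuous_map (arrow_space :: (('k \<times> 'l) cmat set \<times> _) topology) Gr fst"
    using continuous_map_H_bundle_fst[of ?T] by simp
  have target: "moment_map ?T g = snd g ` fst g" for g by (simp add: moment_map_apply)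
  have inj: "inj_on (snd g) (sa_carrier (ab_fibre ?T (fst g)))" if "g \<in> topspace arrow_space" for g
    using that by (intro H_hom_inj_on[OF T]) (auto simp: topspace_H_bundle)
  have e: "?e S \<in> topspace arrow_space" if "S \<in> topspace Gr" for S
    using that by (simp add: topspace_arrow_space identity_arrow topspace_Gr)
  have src: "fst g \<in> topspace Gr" if "g \<in> topspace arrow_space" for g :: "('k \<times> 'l) cmat set \<times> _"
    using that by (auto simp: topspace_arrow_space topspace_Gr)
  have i_eq: "gr_inverse subalgebra_groupoid = ?i"
    by (rule ext) (rule inverse_eq_division)
  show ?thesis
    unfolding topological_groupoid_def Let_def subalgebra_groupoid_simps i_eq
  proof (intro conjI ballI impI)
    show "continuous_map (arrow_space :: (('k \<times> 'l) cmat set \<times> _) topology) Gr fst" by (rule s)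
    show "continuous_map arrow_space Gr (moment_map ?T)"
      by (rule continuous_map_moment_map[OF T])
    show "continuous_map (fibre_product arrow_space arrow_space fst (moment_map ?T)) arrow_space
        (\<lambda>(g, h). H_action ?T g h)"
      unfolding case_prod_unfold
      by (rule continuous_map_H_action[OF T continuous_map_fibre_product]) (simp add: topspace_fibre_product)
    show "continuous_map Gr arrow_space ?e" by (rule continuous_map_identity_arrow)
    have "continuous_map arrow_space arrow_space (\<lambda>g. ?e (fst g))"
      using continuous_map_compose[OF s continuous_map_identity_arrow] by (simp add: o_def)
    then show "continuous_map arrow_space arrow_space ?i"
      by (rule continuous_map_H_division[OF T _ continuous_map_id[unfolded id_def]]) simp
  next
    fix g assume g: "g \<in> topspace (arrow_space :: (('k \<times> 'l) cmat set \<times> _) topology)"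
    show "H_action ?T g (?e (fst g)) = g"
    proof -
      have "snd g \<in> extensional (fst g)"
        using g by (auto simp: topspace_H_bundle star_homs_def PiE_def)
      then show ?thesis
        by (auto simp: H_action_apply prod_eq_iff fun_eq_iff compose_def extensional_def)
    qed
    show "H_action ?T (?e (moment_map ?T g)) g = g" by (rule H_action_identity[OF g])
    show "fst (?i g) = moment_map ?T g" by (simp add: H_division_def)
    show "moment_map ?T (?i g) = fst g"
      unfolding target by (subst moment_map_H_division[OF _ inj[OF g]]) (simp_all add: moment_map_apply)
    show "H_action ?T (?i g) g = ?e (fst g)"
      by (rule H_action_division[OF e[OF src[OF g]] _ inj[OF g]]) simp
    have "snd (H_action ?T g (?i g)) = restrict id (moment_map ?T g)"
      by (auto simp: H_action_apply H_division_def moment_map_apply compose_def fun_eq_iff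
          inv_into_into f_inv_into_f)
    then show "H_action ?T g (?i g) = ?e (moment_map ?T g)"
      by (simp add: prod_eq_iff H_action_apply H_division_def)
  next
    fix g h :: "('k \<times> 'l) cmat set \<times> (('k \<times> 'l) cmat \<Rightarrow> ('k \<times> 'l) cmat)"
    assume "fst g = moment_map ?T h"
    then show "moment_map ?T (H_action ?T g h) = moment_map ?T g"
      using moment_map_H_action[of g ?T h] by (simp add: target[of g])
  next
    fix S show "moment_map ?T (?e S) = S" by (simp add: target)
  qed (simp_all add: H_action_assoc, simp add: H_action_apply)
qed

section \<open>The principal groupoid bundle\<close>

text \<open>The inverse of \<open>(g, h) \<mapsto> (g h, h)\<close> is \<open>(h', h) \<mapsto> (h'/h, h)\<close>.\<close>

theorem theorem18:
  fixes A :: "('b, 'a) algebra_bundle"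
  assumes "universal_matrix_bundle TYPE('k::finite) A"
  shows "principal_groupoid_bundle
    (subalgebra_groupoid ::
      (('k \<times> 'l::finite) cmat set,
       ('k \<times> 'l) cmat set \<times> (('k \<times> 'l) cmat \<Rightarrow> ('k \<times> 'l) cmat)) groupoid)
    (H_bundle A) (moment_map A) (H_action A) (ab_base A) H_proj"
proof -
  have A: "matrix_bundle TYPE('k) A"
    using assms unfolding universal_matrix_bundle_def by blast
  let ?P = "H_bundle A :: ('b \<times> ('a \<Rightarrow> ('k \<times> 'l) cmat)) topology"
  let ?X = "fibre_product arrow_space ?P fst (moment_map A)"
  let ?Y = "fibre_product ?P ?P H_proj H_proj"
  have inj: "inj_on (snd z) (sa_carrier (ab_fibre A (fst z)))" if "z \<in> topspace ?P" for z
    using that by (intro H_hom_inj_on[OF A]) (auto simp: topspace_H_bundle)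
  have act: "continuous_map ?X ?P (\<lambda>z. H_action A (fst z) (snd z))"
    by (rule continuous_map_H_action[OF A continuous_map_fibre_product]) (simp add: topspace_fibre_product)
  have dv: "continuous_map ?Y arrow_space (\<lambda>z. H_division A (fst z) (snd z))"
    by (rule continuous_map_H_division[OF A continuous_map_fibre_product])
      (simp add: topspace_fibre_product H_proj_def)
  have "homeomorphic_maps ?X ?Y (\<lambda>z. (H_action A (fst z) (snd z), snd z)) (\<lambda>z. (H_division A (fst z) (snd z), snd z))"
    unfolding homeomorphic_maps_def
  proof (intro conjI ballI)
    have "continuous_map ?X (prod_topology ?P ?P) (\<lambda>z. (H_action A (fst z) (snd z), snd z))"
      by (intro continuous_map_pairedI act continuous_map_fibre_product)
    then show "continuous_map ?X ?Y (\<lambda>z. (H_action A (fst z) (snd z), snd z))"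
      by (subst (2) fibre_product_def) (simp add: continuous_map_in_subtopology H_proj_def H_action_apply)
    have "continuous_map ?Y (prod_topology arrow_space ?P) (\<lambda>z. (H_division A (fst z) (snd z), snd z))"
      by (intro continuous_map_pairedI dv continuous_map_fibre_product)
    then show "continuous_map ?Y ?X (\<lambda>z. (H_division A (fst z) (snd z), snd z))"
      by (subst (2) fibre_product_def) (simp add: continuous_map_in_subtopology H_division_def)
  next
    fix z assume "z \<in> topspace ?X"
    then show "(H_division A (fst (H_action A (fst z) (snd z), snd z)) (snd (H_action A (fst z) (snd z), snd z)),
        snd (H_action A (fst z) (snd z), snd z)) = z"
      by (simp add: topspace_fibre_product prod_eq_iff H_division_action inj)
  next
    fix z assume "z \<in> topspace ?Y"
    then show "(H_action A (fst (H_division A (fst z) (snd z), snd z)) (snd (H_division A (fst z) (snd z), snd z)),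
        snd (H_division A (fst z) (snd z), snd z)) = z"
      by (simp add: topspace_fibre_product prod_eq_iff H_action_division inj H_proj_def)
  qed
  then have "homeomorphic_map ?X ?Y (\<lambda>(g, h). (H_action A g h, h))"
    unfolding case_prod_unfold by (rule homeomorphic_maps_imp_map)
  then show ?thesis
    unfolding principal_groupoid_bundle_def subalgebra_groupoid_simps
    using topological_groupoid_subalgebras groupoid_action_H_action[OF A] locally_trivial_H_bundle[OF A]
      H_proj_surjective[OF A]
    by (simp add: H_proj_def H_action_apply)
qed

end
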